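(* Let $X$ be a linear diffusion on $I=(\ell,+\infty[$ as described in the context, where moreover $\ell$ is a natural boundary if $\ell=-\infty$, and an entrance-not-exit boundary if $\ell>-\infty$. Let $f:[0,+\infty[\to\,]\ell,+\infty[$ be a continuous function, of class $\mathcal{C}^1$ on $]0,+\infty[$, such that $\zeta(f):=\inf\{t\ge0:f(t)=\ell\}=+\infty$, and assume that for all $x\in I$, $\mathbb{P}_x\left(\lim_{t\to+\infty}(X_t-f(t))<0\right)=1$. Let $H$ be the function $H(t,y)=\mathbb{P}_y(T_{f\circ\theta_t}=+\infty)$. Assume that $H$ is of class $\mathcal{C}^{1,2}$ on $]0,+\infty[\times]\ell,+\infty[$ and is such that, for every $x\in\,]\ell,+\infty[$ and $t>0$, $$\lim_{y\to\ell}\frac{1}{s'(y)}\frac{\partial H(t,y)}{\partial y}\,q(t,x,y)=0.$$ Then the density of the random variable $G_f$ under $\mathbb{P}_x$ is given by $$\mathbb{P}_x(G_f\in dt)=-\frac{q(t,x,f(t))}{s'(f(t))}\,\frac{\partial H(t,y)}{\partial y}\Big|_{y=f(t)}\,dt\qquad(t>0).$$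
   Context: Setting: $\ell\in[-\infty,+\infty[$, and $(X_t,t\ge 0)$ is a linear regular conservative (infinite life-time) diffusion with values in $I=(\ell,+\infty[$, with $+\infty$ a natural boundary, defined on canonical path space; $\mathbb{P}_x$ is its law started from $x$. Its speed measure is $m(dx)=\rho(x)dx$ (absolutely continuous), its scale function $s$ is of class $\mathcal{C}^2$, and its generator is $\mathcal{G}=\frac{1}{\rho(x)}\frac{\partial}{\partial x}\left(\frac{1}{s'(x)}\frac{\partial}{\partial x}\right)$. $X$ has a transition density $q(t,x,y)$ with respect to $m$, jointly continuous, symmetric in $(x,y)$, assumed of class $\mathcal{C}^{1,2,2}$ on $]0,+\infty[\times I\times I$; in particular, $\mathcal{G}q=\partial q/\partial t$ in the variables $(t,x)$ on $]0,+\infty[\times]\ell,+\infty[$. The boundary assumptions on $\ell$ ensure that for every $t>0$ and $x>\ell$, $\lim_{y\to\ell}\frac{1}{s'(y)}\frac{\partial q(t,x,y)}{\partial y}=0$. Last passage time: $G_f:=\sup\{t\ge 0: X_t=f(t)\}$, with $G_f=0$ if this set is empty. First passage time: for a function $g$, $T_g:=\inf\{t\ge 0: X_t=g(t)\}$, with $T_g=+\infty$ if this set is empty. Shift: $(f\circ\theta_t)(u)=f(t+u)$ for $u\ge0$.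
   Formalization: H vanishes for y ≥ f(t), so C^{1,2} regularity of H across the curve is contradictory; here H is assumed C^{1,2} only on {t>0, ℓ<y≤f(t)} (one-sided up to the curve), and ∂H/∂y at y=f(t) is the left derivative. *)

theory Defs
  imports "HOL-Probability.Probability"
begin

text \<open>
  The state space is the open interval \<open>]l, +\<infinity>[\<close>, written \<open>einterval l \<infinity>\<close>, where \<open>l\<close> is an
  extended real. Times are reals; paths are extensional functions on \<open>[0, +\<infinity>[\<close>, so that path
  space is a subspace of the product space.
\<close>

definition path_space :: "ereal \<Rightarrow> (real \<Rightarrow> real) measure" where
  "path_space l = restrict_space (PiM {0..} (\<lambda>_. borel))
     {\<omega>. continuous_on {0..} \<omega> \<and> (\<forall>t\<ge>0. \<omega> t \<in> einterval l \<infinity>)}"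

definition shift_path :: "real \<Rightarrow> (real \<Rightarrow> real) \<Rightarrow> (real \<Rightarrow> real)" where
  "shift_path t \<omega> = restrict (\<lambda>u. \<omega> (t + u)) {0..}"

text \<open>The index set of the filtration is \<open>[0, +\<infinity>]\<close>, so that stopping times may be infinite.\<close>

definition path_filtration :: "ereal \<Rightarrow> ennreal \<Rightarrow> (real \<Rightarrow> real) measure" where
  "path_filtration l t =
     (let J = {u. 0 \<le> u \<and> ennreal u \<le> t}
      in vimage_algebra (space (path_space l)) (\<lambda>\<omega>. restrict \<omega> J) (PiM J (\<lambda>_. borel)))"

lemma filtration_path_filtration: "filtration (space (path_space l)) (path_filtration l)"
proof
  show "space (path_filtration l t) = space (path_space l)" for t
    by (simp add: path_filtration_def Let_def)
  fix r t :: ennreal assume "r \<le> t"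
  define J where "J = (\<lambda>t. {u. 0 \<le> u \<and> ennreal u \<le> t})"
  have sub: "J r \<subseteq> J t" using \<open>r \<le> t\<close> by (auto simp: J_def)
  have meas: "(\<lambda>\<omega>. restrict \<omega> (J r)) \<in> path_filtration l t \<rightarrow>\<^sub>M PiM (J r) (\<lambda>_. borel :: real measure)"
  proof -
    have "(\<lambda>\<omega>. restrict \<omega> (J t)) \<in> path_filtration l t \<rightarrow>\<^sub>M PiM (J t) (\<lambda>_. borel :: real measure)"
      unfolding path_filtration_def Let_def J_def
      by (rule measurable_vimage_algebra1) (auto simp: space_PiM)
    from measurable_compose[OF this measurable_restrict_subset[OF sub]]
    have "(\<lambda>\<omega>. restrict (restrict \<omega> (J t)) (J r)) \<in> path_filtration l t \<rightarrow>\<^sub>M PiM (J r) (\<lambda>_. borel :: real measure)" .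
    then show ?thesis using sub by (simp add: restrict_restrict Int_absorb1)
  qed
  show "sets (path_filtration l r) \<subseteq> sets (path_filtration l t)"
  proof
    fix A assume "A \<in> sets (path_filtration l r)"
    then obtain B where B: "B \<in> sets (PiM (J r) (\<lambda>_. borel :: real measure))"
      and A: "A = (\<lambda>\<omega>. restrict \<omega> (J r)) -` B \<inter> space (path_space l)"
      unfolding path_filtration_def Let_def J_def
      by (subst (asm) sets_vimage_algebra2) (auto simp: space_PiM)
    show "A \<in> sets (path_filtration l t)"
      using measurable_sets[OF meas B] by (simp add: A path_filtration_def Let_def)
  qed
qed

text \<open>
  First and last passage at a moving level. In \<open>ennreal\<close> the infimum of the empty set is \<open>\<infinity>\<close>
  and its supremum is \<open>0\<close>, which are the required conventions.
\<close>

definition first_passage :: "(real \<Rightarrow> real) \<Rightarrow> (real \<Rightarrow> real) \<Rightarrow> ennreal" where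
  "first_passage g \<omega> = Inf (ennreal ` {t. 0 \<le> t \<and> \<omega> t = g t})"

definition last_passage :: "(real \<Rightarrow> real) \<Rightarrow> (real \<Rightarrow> real) \<Rightarrow> ennreal" where
  "last_passage g \<omega> = Sup (ennreal ` {t. 0 \<le> t \<and> \<omega> t = g t})"

definition curve_lifetime :: "ereal \<Rightarrow> (real \<Rightarrow> real) \<Rightarrow> ennreal" where
  "curve_lifetime l g = Inf (ennreal ` {t. 0 \<le> t \<and> ereal (g t) = l})"

definition C2_on :: "real set \<Rightarrow> (real \<Rightarrow> real) \<Rightarrow> bool" where
  "C2_on S u \<longleftrightarrow> u C1_differentiable_on S \<and> deriv u C1_differentiable_on S"

text \<open>
  Class \<open>C\<^sup>1\<^sup>,\<^sup>2\<close> in (time, space). The set \<open>D\<close> need not be open: at points of \<open>D\<close> on its boundary the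
  derivatives are taken along the sections of \<open>D\<close>, so they may be one-sided, and the partial
  derivatives are required to be jointly continuous up to those points.
\<close>

definition C12_on :: "(real \<times> real) set \<Rightarrow> (real \<Rightarrow> real \<Rightarrow> real) \<Rightarrow> bool" where
  "C12_on D F \<longleftrightarrow> (\<exists>Ft Fy Fyy.
     (\<forall>(t, y) \<in> D.
        ((\<lambda>u. F u y) has_real_derivative Ft t y) (at t within {u. (u, y) \<in> D}) \<and>
        ((\<lambda>z. F t z) has_real_derivative Fy t y) (at y within {z. (t, z) \<in> D}) \<and>
        ((\<lambda>z. Fy t z) has_real_derivative Fyy t y) (at y within {z. (t, z) \<in> D})) \<and>
     continuous_on D (\<lambda>(t, y). F t y) \<and>
     continuous_on D (\<lambda>(t, y). Ft t y) \<and>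
     continuous_on D (\<lambda>(t, y). Fy t y) \<and>
     continuous_on D (\<lambda>(t, y). Fyy t y))"

lemma C12_on_subset:
  assumes "C12_on D F" "E \<subseteq> D"
  shows "C12_on E F"
proof -
  obtain Ft Fy Fyy where *:
    "\<And>t y. (t, y) \<in> D \<Longrightarrow> ((\<lambda>u. F u y) has_real_derivative Ft t y) (at t within {u. (u, y) \<in> D})"
    "\<And>t y. (t, y) \<in> D \<Longrightarrow> ((\<lambda>z. F t z) has_real_derivative Fy t y) (at y within {z. (t, z) \<in> D})"
    "\<And>t y. (t, y) \<in> D \<Longrightarrow> ((\<lambda>z. Fy t z) has_real_derivative Fyy t y) (at y within {z. (t, z) \<in> D})"
    "continuous_on D (\<lambda>(t, y). F t y)" "continuous_on D (\<lambda>(t, y). Ft t y)"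
    "continuous_on D (\<lambda>(t, y). Fy t y)" "continuous_on D (\<lambda>(t, y). Fyy t y)"
    using assms(1) unfolding C12_on_def by blast
  have sub: "{u. (u, y) \<in> E} \<subseteq> {u. (u, y) \<in> D}" "{z. (t, z) \<in> E} \<subseteq> {z. (t, z) \<in> D}" for t y
    using assms(2) by auto
  have der: "((\<lambda>u. F u y) has_real_derivative Ft t y) (at t within {u. (u, y) \<in> E}) \<and>
        ((\<lambda>z. F t z) has_real_derivative Fy t y) (at y within {z. (t, z) \<in> E}) \<and>
        ((\<lambda>z. Fy t z) has_real_derivative Fyy t y) (at y within {z. (t, z) \<in> E})"
    if "(t, y) \<in> E" for t y
  proof -
    have "(t, y) \<in> D" using that assms(2) by auto
    then show ?thesis using *(1-3) sub has_field_derivative_subset by meson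
  qed
  have cont: "continuous_on E (\<lambda>(t, y). F t y)" "continuous_on E (\<lambda>(t, y). Ft t y)"
    "continuous_on E (\<lambda>(t, y). Fy t y)" "continuous_on E (\<lambda>(t, y). Fyy t y)"
    using *(4-7) assms(2) continuous_on_subset by blast+
  show ?thesis
    unfolding C12_on_def
    by (rule exI[of _ Ft], rule exI[of _ Fy], rule exI[of _ Fyy]) (use der cont in auto)
qed

definition C122_on :: "real set \<Rightarrow> (real \<Rightarrow> real \<Rightarrow> real \<Rightarrow> real) \<Rightarrow> bool" where
  "C122_on S F \<longleftrightarrow> (\<exists>Ft Fx Fxx Fy Fyy.
     (\<forall>t>0. \<forall>x\<in>S. \<forall>y\<in>S.
        ((\<lambda>u. F u x y) has_real_derivative Ft t x y) (at t) \<and>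
        ((\<lambda>z. F t z y) has_real_derivative Fx t x y) (at x) \<and>
        ((\<lambda>z. Fx t z y) has_real_derivative Fxx t x y) (at x) \<and>
        ((\<lambda>z. F t x z) has_real_derivative Fy t x y) (at y) \<and>
        ((\<lambda>z. Fy t x z) has_real_derivative Fyy t x y) (at y)) \<and>
     continuous_on ({0<..} \<times> S \<times> S) (\<lambda>(t, x, y). F t x y) \<and>
     continuous_on ({0<..} \<times> S \<times> S) (\<lambda>(t, x, y). Ft t x y) \<and>
     continuous_on ({0<..} \<times> S \<times> S) (\<lambda>(t, x, y). Fx t x y) \<and>
     continuous_on ({0<..} \<times> S \<times> S) (\<lambda>(t, x, y). Fxx t x y) \<and>
     continuous_on ({0<..} \<times> S \<times> S) (\<lambda>(t, x, y). Fy t x y) \<and>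
     continuous_on ({0<..} \<times> S \<times> S) (\<lambda>(t, x, y). Fyy t x y))"

definition left_deriv :: "(real \<Rightarrow> real) \<Rightarrow> real \<Rightarrow> real" where
  "left_deriv F x = (THE d. (F has_real_derivative d) (at_left x))"

lemma left_deriv_eqI:
  assumes "(F has_real_derivative d) (at_left x)"
  shows "left_deriv F x = d"
  unfolding left_deriv_def
proof (rule the_equality)
  fix d' assume d': "(F has_real_derivative d') (at_left x)"
  show "d' = d"
    using tendsto_unique[OF _ d'[unfolded has_field_derivative_iff] assms[unfolded has_field_derivative_iff]]
    by simp
qed fact

lemma left_deriv_eq_deriv:
  assumes "F field_differentiable at x"
  shows "left_deriv F x = deriv F x"
  using assms DERIV_deriv_iff_field_differentiable has_field_derivative_at_within left_deriv_eqI
  by metis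

definition speed_measure :: "ereal \<Rightarrow> (real \<Rightarrow> real) \<Rightarrow> real measure" where
  "speed_measure l rho =
     density lborel (\<lambda>x. indicator (einterval l \<infinity>) x * ennreal (rho x))"

definition generator :: "(real \<Rightarrow> real) \<Rightarrow> (real \<Rightarrow> real) \<Rightarrow> (real \<Rightarrow> real) \<Rightarrow> real \<Rightarrow> real" where
  "generator s rho u x = deriv (\<lambda>z. deriv u z / deriv s z) x / rho x"

text \<open>
  Feller's integrals at the two end points, with \<open>s(da) = s'(a) da\<close>. Whether they are finite does not
  depend on the interior base point \<open>z\<close>.
\<close>

definition exit_left :: "ereal \<Rightarrow> (real \<Rightarrow> real) \<Rightarrow> (real \<Rightarrow> real) \<Rightarrow> bool" where
  "exit_left l s rho \<longleftrightarrow> (\<exists>z \<in> einterval l \<infinity>.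
     (\<integral>\<^sup>+a \<in> einterval l (ereal z).
        emeasure (speed_measure l rho) {a<..<z} * ennreal (deriv s a) \<partial>lborel) < \<infinity>)"

definition entrance_left :: "ereal \<Rightarrow> (real \<Rightarrow> real) \<Rightarrow> (real \<Rightarrow> real) \<Rightarrow> bool" where
  "entrance_left l s rho \<longleftrightarrow> (\<exists>z \<in> einterval l \<infinity>.
     (\<integral>\<^sup>+a \<in> einterval l (ereal z). ennreal (s z - s a) \<partial>speed_measure l rho) < \<infinity>)"

definition exit_right :: "ereal \<Rightarrow> (real \<Rightarrow> real) \<Rightarrow> (real \<Rightarrow> real) \<Rightarrow> bool" where
  "exit_right l s rho \<longleftrightarrow> (\<exists>z \<in> einterval l \<infinity>.
     (\<integral>\<^sup>+a \<in> {z<..}.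
        emeasure (speed_measure l rho) {z<..<a} * ennreal (deriv s a) \<partial>lborel) < \<infinity>)"

definition entrance_right :: "ereal \<Rightarrow> (real \<Rightarrow> real) \<Rightarrow> (real \<Rightarrow> real) \<Rightarrow> bool" where
  "entrance_right l s rho \<longleftrightarrow> (\<exists>z \<in> einterval l \<infinity>.
     (\<integral>\<^sup>+a \<in> {z<..}. ennreal (s a - s z) \<partial>speed_measure l rho) < \<infinity>)"

definition natural_left :: "ereal \<Rightarrow> (real \<Rightarrow> real) \<Rightarrow> (real \<Rightarrow> real) \<Rightarrow> bool" where
  "natural_left l s rho \<longleftrightarrow> \<not> exit_left l s rho \<and> \<not> entrance_left l s rho"

definition natural_right :: "ereal \<Rightarrow> (real \<Rightarrow> real) \<Rightarrow> (real \<Rightarrow> real) \<Rightarrow> bool" where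
  "natural_right l s rho \<longleftrightarrow> \<not> exit_right l s rho \<and> \<not> entrance_right l s rho"

definition entrance_not_exit_left :: "ereal \<Rightarrow> (real \<Rightarrow> real) \<Rightarrow> (real \<Rightarrow> real) \<Rightarrow> bool" where
  "entrance_not_exit_left l s rho \<longleftrightarrow> entrance_left l s rho \<and> \<not> exit_left l s rho"

text \<open>
  \<open>P x\<close> is the law, on canonical path space, of the diffusion started from \<open>x\<close>. The process is
  conservative because every path stays in the state space for all times. The scale function
  and the speed measure are characterised by the exit probabilities and the mean exit times of
  bounded intervals; the Green kernel is normalised (no factor \<open>2\<close>) so that the generator is
  \<open>d/dm d/ds\<close>. The properties \<open>backward\<close> and \<open>flux_at_left_end\<close> are known consequences of the others
  and are part of the standing setting.
\<close>

locale linear_diffusion =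
  fixes l :: ereal
    and s rho :: "real \<Rightarrow> real"
    and q :: "real \<Rightarrow> real \<Rightarrow> real \<Rightarrow> real"
    and P :: "real \<Rightarrow> (real \<Rightarrow> real) measure"
  assumes left_end: "l \<noteq> \<infinity>"
    and kernel: "P \<in> restrict_space borel (einterval l \<infinity>) \<rightarrow>\<^sub>M prob_algebra (path_space l)"
    and start: "\<And>x. x \<in> einterval l \<infinity> \<Longrightarrow> AE \<omega> in P x. \<omega> 0 = x"
    and strong_markov:
      "\<And>x \<tau> A B. x \<in> einterval l \<infinity> \<Longrightarrow> stopping_time (path_filtration l) \<tau> \<Longrightarrow>
         A \<in> sets (filtration.pre_sigma (space (path_space l)) (path_filtration l) \<tau>) \<Longrightarrow>
         B \<in> sets (path_space l) \<Longrightarrow>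
         emeasure (P x) {\<omega> \<in> A. \<tau> \<omega> < \<infinity> \<and> shift_path (enn2real (\<tau> \<omega>)) \<omega> \<in> B} =
         (\<integral>\<^sup>+\<omega> \<in> {\<omega> \<in> A. \<tau> \<omega> < \<infinity>}. emeasure (P (\<omega> (enn2real (\<tau> \<omega>)))) B \<partial>P x)"
    and regular:
      "\<And>x y. x \<in> einterval l \<infinity> \<Longrightarrow> y \<in> einterval l \<infinity> \<Longrightarrow>
         measure (P x) {\<omega> \<in> space (P x). first_passage (\<lambda>_. y) \<omega> < \<infinity>} > 0"
    and scale_C2: "C2_on (einterval l \<infinity>) s"
    and scale_deriv_pos: "\<And>x. x \<in> einterval l \<infinity> \<Longrightarrow> deriv s x > 0"
    and scale:
      "\<And>a x b. a \<in> einterval l \<infinity> \<Longrightarrow> a < x \<Longrightarrow> x < b \<Longrightarrow>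
         measure (P x) {\<omega> \<in> space (P x).
           first_passage (\<lambda>_. b) \<omega> < first_passage (\<lambda>_. a) \<omega>} = (s x - s a) / (s b - s a)"
    and speed_measurable: "set_borel_measurable lborel (einterval l \<infinity>) rho"
    and speed_pos: "\<And>x. x \<in> einterval l \<infinity> \<Longrightarrow> rho x > 0"
    and speed_locally_finite:
      "\<And>a b. a \<in> einterval l \<infinity> \<Longrightarrow> emeasure (speed_measure l rho) {a..b} < \<infinity>"
    and speed:
      "\<And>a x b. a \<in> einterval l \<infinity> \<Longrightarrow> a < x \<Longrightarrow> x < b \<Longrightarrow>
         (\<integral>\<^sup>+\<omega>. min (first_passage (\<lambda>_. a) \<omega>) (first_passage (\<lambda>_. b) \<omega>) \<partial>P x) =
         (\<integral>\<^sup>+y \<in> {a<..<b}. ennreal ((s (min x y) - s a) * (s b - s (max x y)) / (s b - s a))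
            \<partial>speed_measure l rho)"
    and generator:
      "\<And>u a b x. C2_on UNIV u \<Longrightarrow> a \<in> einterval l \<infinity> \<Longrightarrow> (\<And>y. y \<notin> {a..b} \<Longrightarrow> u y = 0) \<Longrightarrow>
         x \<in> einterval l \<infinity> \<Longrightarrow>
         ((\<lambda>t. ((\<integral>\<omega>. u (\<omega> t) \<partial>P x) - u x) / t) \<longlongrightarrow> generator s rho u x) (at_right 0)"
    and natural_right_end: "natural_right l s rho"
    and density_nonneg:
      "\<And>t x y. t > 0 \<Longrightarrow> x \<in> einterval l \<infinity> \<Longrightarrow> y \<in> einterval l \<infinity> \<Longrightarrow> q t x y \<ge> 0"
    and transition_density:
      "\<And>t x B. t > 0 \<Longrightarrow> x \<in> einterval l \<infinity> \<Longrightarrow> B \<in> sets borel \<Longrightarrow>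
         emeasure (P x) {\<omega> \<in> space (P x). \<omega> t \<in> B} =
         (\<integral>\<^sup>+y \<in> B. ennreal (q t x y) \<partial>speed_measure l rho)"
    and density_sym:
      "\<And>t x y. t > 0 \<Longrightarrow> x \<in> einterval l \<infinity> \<Longrightarrow> y \<in> einterval l \<infinity> \<Longrightarrow> q t x y = q t y x"
    and density_C122: "C122_on (einterval l \<infinity>) q"
    and backward:
      "\<And>t x y. t > 0 \<Longrightarrow> x \<in> einterval l \<infinity> \<Longrightarrow> y \<in> einterval l \<infinity> \<Longrightarrow>
         generator s rho (\<lambda>z. q t z y) x = deriv (\<lambda>u. q u x y) t"
    and flux_at_left_end:
      "\<And>t x. t > 0 \<Longrightarrow> x \<in> einterval l \<infinity> \<Longrightarrow>
         (((\<lambda>y. deriv (q t x) y / deriv s y) \<circ> real_of_ereal) \<longlongrightarrow> 0) (at_right l)"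

text \<open>
  The limit is taken in the extended reals: the value \<open>-\<infinity>\<close> is allowed.
\<close>

definition ends_below :: "(real \<Rightarrow> real) \<Rightarrow> (real \<Rightarrow> real) \<Rightarrow> bool" where
  "ends_below f \<omega> \<longleftrightarrow> (\<exists>L::ereal. L < 0 \<and> ((\<lambda>t. ereal (\<omega> t - f t)) \<longlongrightarrow> L) at_top)"

text \<open>
  When the paths end below \<open>f\<close>, a path started above the curve must hit it, so \<open>H t y = 0\<close> for
  \<open>y \<ge> f t\<close>, and in general \<open>H t\<close> has a kink at \<open>f t\<close>: smoothness of \<open>H\<close> can only be asked on the
  following set (up to and including the curve), and the derivative at \<open>f t\<close> is the left one.
  If \<open>H\<close> happens to be of class \<open>C\<^sup>1\<^sup>,\<^sup>2\<close> across the curve, this is covered by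
  \<open>C12_on_subset\<close> and \<open>left_deriv_eq_deriv\<close>.
\<close>

definition below_curve :: "ereal \<Rightarrow> (real \<Rightarrow> real) \<Rightarrow> (real \<times> real) set" where
  "below_curve l f = {(t, y). 0 < t \<and> y \<in> einterval l \<infinity> \<and> y \<le> f t}"

definition has_density_on ::
  "'a measure \<Rightarrow> ('a \<Rightarrow> ennreal) \<Rightarrow> real set \<Rightarrow> (real \<Rightarrow> real) \<Rightarrow> bool" where
  "has_density_on M Y S d \<longleftrightarrow>
     Y \<in> borel_measurable M \<and> set_integrable lborel S d \<and>
     (\<forall>B\<in>sets borel. B \<subseteq> S \<longrightarrow>
        measure M {\<omega> \<in> space M. Y \<omega> \<in> ennreal ` B} = (LINT t:B|lborel. d t))"

end

(*
  Let N(t) = P_x(G_f < t), which by the Markov property and the behaviour of X - f at infinity equals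
  the integral of H(t,y) q(t,x,y) m(dy) over y < f(t).  Only a right derivative of N at a fixed t is
  computed, which keeps everything local around f(t): a level at positive distance is reached within
  time h with probability o(h), so in N(t+h) - N(t) the density q(t,x,.) may be replaced by a
  compactly supported g, and symmetry of q lets the semigroup act on g instead of H.  Dividing by h
  gives in the limit the integral of g dH/dt + H Gg over y < f(t); by Green's formula and
  dH/dt + GH = 0 this is the boundary term at f(t).  Since N is left continuous and the right
  derivative is continuous, N is C1.
*)
theory Submission
  imports Defs
begin

section \<open>Functions of class C2 and one-sided derivatives\<close>

text \<open>H, set to zero above the curve, has in general a kink at f(t), and this kink moves with
  t, so neither the generator nor differentiation under the integral applies to it across the curve.
  Only increments forward in time are accessible: the Markov property at t writes N(t+h) - N(t) as
  the integral against q(t,x,y) m(dy) of U(t,h,y) - H(t,y), where U(t,h,y) is the probability of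
  being below the curve at time t+h and never meeting it again. This difference is at most the
  probability of touching the curve within h.

  The rate o(h) for a distant level comes from the generator. A bump around the level vanishes near
  the starting point, so its expectation at time h is o(h); by the strong Markov property a path
  that reaches the level is still under the bump at time h with probability at least 1/2.

  The backward equation for H is itself derived by such a comparison, at points strictly below the
  curve. The speed density is only assumed measurable; its continuity, on which the integrals near
  f(t) rest, is read off from the forward equation.\<close>

definition C2_with :: "(real \<Rightarrow> real) \<Rightarrow> (real \<Rightarrow> real) \<Rightarrow> (real \<Rightarrow> real) \<Rightarrow> bool" where
  "C2_with u u1 u2 \<longleftrightarrow> (\<forall>x. (u has_real_derivative u1 x) (at x)) \<and>
     (\<forall>x. (u1 has_real_derivative u2 x) (at x)) \<and> continuous_on UNIV u2"

lemma C2_withD: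
  assumes "C2_with u u1 u2"
  shows "(u has_real_derivative u1 x) (at x)" "(u1 has_real_derivative u2 x) (at x)"
    "continuous_on UNIV u" "continuous_on UNIV u1" "continuous_on UNIV u2"
proof -
  show d: "(u has_real_derivative u1 x) (at x)" "(u1 has_real_derivative u2 x) (at x)" for x
    using assms by (auto simp: C2_with_def)
  show "continuous_on UNIV u" "continuous_on UNIV u1"
    using d by (auto intro!: continuous_at_imp_continuous_on DERIV_isCont)
  show "continuous_on UNIV u2" using assms by (auto simp: C2_with_def)
qed

lemma C2_with_imp_C2_on:
  assumes "C2_with u u1 u2"
  shows "C2_on UNIV u" "deriv u = u1" "deriv u1 = u2"
proof -
  note d = C2_withD[OF assms]
  show u1: "deriv u = u1" and "deriv u1 = u2"
    using d by (auto intro!: ext DERIV_imp_deriv)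
  have "u C1_differentiable_on UNIV" "u1 C1_differentiable_on UNIV"
    unfolding C1_differentiable_on_def
    using d by (auto simp: has_real_derivative_iff_has_vector_derivative)
  then show "C2_on UNIV u" by (simp add: C2_on_def u1)
qed

lemma C2_with_mult:
  assumes "C2_with a a1 a2" "C2_with b b1 b2"
  shows "C2_with (\<lambda>x. a x * b x) (\<lambda>x. a1 x * b x + a x * b1 x)
    (\<lambda>x. a2 x * b x + 2 * a1 x * b1 x + a x * b2 x)"
  unfolding C2_with_def using C2_withD[OF assms(1)] C2_withD[OF assms(2)]
  by (auto intro!: derivative_eq_intros continuous_intros)

lemma C2_with_add:
  assumes "C2_with a a1 a2" "C2_with b b1 b2"
  shows "C2_with (\<lambda>x. a x + b x) (\<lambda>x. a1 x + b1 x) (\<lambda>x. a2 x + b2 x)"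
  unfolding C2_with_def using C2_withD[OF assms(1)] C2_withD[OF assms(2)]
  by (auto intro!: derivative_eq_intros continuous_intros)

lemma C2_with_inverse:
  assumes "C2_with a a1 a2" "\<And>x. a x \<noteq> 0"
  shows "C2_with (\<lambda>x. inverse (a x)) (\<lambda>x. - (a1 x) / (a x)^2)
    (\<lambda>x. (2 * (a1 x)^2 - a2 x * a x) / (a x)^3)"
  unfolding C2_with_def
proof (intro conjI allI)
  note d = C2_withD[OF assms(1)]
  fix x
  show "((\<lambda>x. inverse (a x)) has_real_derivative - (a1 x) / (a x)\<^sup>2) (at x)"
    using d assms(2) by (auto intro!: derivative_eq_intros simp: power2_eq_square divide_simps)
  show "((\<lambda>x. - (a1 x) / (a x)\<^sup>2) has_real_derivative (2 * (a1 x)\<^sup>2 - a2 x * a x) / (a x)^3) (at x)"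
    by (rule derivative_eq_intros d refl)+
      (use assms(2) in \<open>auto simp: power2_eq_square power3_eq_cube divide_simps algebra_simps\<close>)
next
  show "continuous_on UNIV (\<lambda>x. (2 * (a1 x)\<^sup>2 - a2 x * a x) / (a x)^3)"
    using C2_withD[OF assms(1)] assms(2) by (auto intro!: continuous_intros)
qed

lemma C2_with_compose:
  assumes "C2_with a a1 a2" "C2_with b b1 b2"
  shows "C2_with (\<lambda>x. a (b x)) (\<lambda>x. a1 (b x) * b1 x) (\<lambda>x. a2 (b x) * (b1 x)^2 + a1 (b x) * b2 x)"
  unfolding C2_with_def
proof (intro conjI allI)
  note d = C2_withD[OF assms(1)] and e = C2_withD[OF assms(2)]
  fix x
  show "((\<lambda>x. a (b x)) has_real_derivative a1 (b x) * b1 x) (at x)"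
    by (rule DERIV_chain2[OF d(1) e(1)])
  show "((\<lambda>x. a1 (b x) * b1 x) has_real_derivative a2 (b x) * (b1 x)^2 + a1 (b x) * b2 x) (at x)"
    by (rule derivative_eq_intros DERIV_chain2[OF d(2) e(1)] e(2) refl)+
      (simp add: power2_eq_square algebra_simps)
next
  note d = C2_withD[OF assms(1)] and e = C2_withD[OF assms(2)]
  show "continuous_on UNIV (\<lambda>x. a2 (b x) * (b1 x)^2 + a1 (b x) * b2 x)"
    using d e by (auto intro!: continuous_intros continuous_on_compose2[OF d(5)] continuous_on_compose2[OF d(4)])
qed

section \<open>Smooth cutoff functions\<close>

lemma DERIV_max_0_power:
  "((\<lambda>u::real. max 0 u ^ Suc (Suc n)) has_real_derivative real (Suc (Suc n)) * max 0 u ^ Suc n) (at u)"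
proof -
  consider "u > 0" | "u < 0" | "u = 0" by linarith
  then show ?thesis
  proof cases
    case 1
    have "((\<lambda>u::real. u ^ Suc (Suc n)) has_real_derivative real (Suc (Suc n)) * max 0 u ^ Suc n) (at u)"
      using 1 DERIV_pow[of "Suc (Suc n)" u UNIV] by (simp add: max_def)
    then show ?thesis
      by (rule has_field_derivative_transform_within_open[of _ _ _ "{0<..}"]) (use 1 in auto)
  next
    case 2
    have "((\<lambda>u::real. 0) has_real_derivative real (Suc (Suc n)) * max 0 u ^ Suc n) (at u)"
      using 2 by (simp add: max_def)
    then show ?thesis
      by (rule has_field_derivative_transform_within_open[of _ _ _ "{..<0}"]) (use 2 in auto)
  next
    case 3
    have "((\<lambda>h::real. max 0 h ^ Suc n) \<longlongrightarrow> max 0 0 ^ Suc n) (at 0)"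
      by (intro tendsto_intros)
    then have lim: "((\<lambda>h::real. max 0 h ^ Suc n) \<longlongrightarrow> 0) (at 0)" by simp
    have "((\<lambda>h::real. max 0 h ^ Suc (Suc n) / h) \<longlongrightarrow> 0) (at 0)"
      by (rule Lim_transform_eventually[OF lim])
        (auto simp: eventually_at_filter max_def)
    then show ?thesis using 3 by (simp add: DERIV_def)
  qed
qed

text \<open>Three is the least exponent for which the truncated power has a continuous second
  derivative; the cutoff functions arise from it by composition and quotients.\<close>

lemma C2_with_max_0_cube:
  "C2_with (\<lambda>u. max 0 u ^ 3) (\<lambda>u. 3 * max 0 u ^ 2) (\<lambda>u. 6 * max 0 u)"
  unfolding C2_with_def
proof (intro conjI allI)
  fix x :: real
  show "((\<lambda>u. max 0 u ^ 3) has_real_derivative 3 * max 0 x ^ 2) (at x)"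
    using DERIV_max_0_power[of 1 x] by (simp add: numeral_3_eq_3 numeral_2_eq_2)
  have "((\<lambda>u. 3 * max 0 u ^ 2) has_real_derivative 3 * (2 * max 0 x)) (at x)"
    using DERIV_cmult[OF DERIV_max_0_power[of 0 x], of 3] by (simp add: numeral_2_eq_2)
  then show "((\<lambda>u. 3 * max 0 u ^ 2) has_real_derivative 6 * max 0 x) (at x)" by simp
qed (intro continuous_intros)

text \<open>Strictly beyond distance r, u agrees with 0 on an open set. At distance exactly r the
  derivatives vanish by continuity, along points approaching from outside.\<close>

lemma C2_with_zero_outside:
  assumes u: "C2_with u u1 u2" and z: "\<And>y. \<bar>y - c\<bar> \<ge> r \<Longrightarrow> u y = 0" and y: "\<bar>y - c\<bar> \<ge> r"
  shows "u1 y = 0" "u2 y = 0"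
proof -
  note d = C2_withD[OF u]
  have op: "open {y. \<bar>y - c\<bar> > r}" by (intro open_Collect_less continuous_intros)
  have 1: "u1 y = 0" if "\<bar>y - c\<bar> > r" for y
  proof (rule DERIV_unique[OF d(1)])
    have "((\<lambda>_. 0) has_real_derivative 0) (at y)" by simp
    then show "(u has_real_derivative 0) (at y)"
      by (rule has_field_derivative_transform_within_open[OF _ op]) (use that z in auto)
  qed
  have 2: "u2 y = 0" if "\<bar>y - c\<bar> > r" for y
  proof (rule DERIV_unique[OF d(2)])
    have "((\<lambda>_. 0) has_real_derivative 0) (at y)" by simp
    then show "(u1 has_real_derivative 0) (at y)"
      by (rule has_field_derivative_transform_within_open[OF _ op]) (use that 1 in auto)
  qed
  \<comment> \<open>The sign \<open>e\<close> points away from c, so that \<open>y + e * h\<close>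
    lies strictly beyond distance r.\<close>
  define e where "e = (if y \<ge> c then 1 else -1 :: real)"
  have far: "\<bar>(y + e * h) - c\<bar> > r" if "h > 0" for h
    using that y by (auto simp: e_def)
  have lim: "((\<lambda>h. y + e * h) \<longlongrightarrow> y) (at_right 0)"
    by (auto intro!: tendsto_eq_intros)
  have conv: "v y = 0" if v: "continuous_on UNIV v" "\<And>z. \<bar>z - c\<bar> > r \<Longrightarrow> v z = 0" for v :: "real \<Rightarrow> real"
  proof -
    have "((\<lambda>h. v (y + e * h)) \<longlongrightarrow> v y) (at_right 0)"
      by (rule continuous_on_tendsto_compose[OF v(1) lim]) auto
    moreover have "((\<lambda>h. v (y + e * h)) \<longlongrightarrow> 0) (at_right 0)"
      by (rule tendsto_eventually) (auto simp: eventually_at_filter far v(2))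
    ultimately show ?thesis by (rule tendsto_unique[rotated]) simp
  qed
  show "u1 y = 0" "u2 y = 0" by (rule conv; use d 1 2 in blast)+
qed

text \<open>The bump is A / (A + B) with two truncated cubes: A is positive exactly within distance
  r2 of c, B exactly beyond r1, and r1 < r2 makes the denominator positive. Taking squares of y - c
  keeps the arguments smooth at c.\<close>

lemma bump_exists:
  assumes r: "0 < r1" "r1 < r2"
  obtains \<phi> \<phi>1 \<phi>2 :: "real \<Rightarrow> real" where "C2_with \<phi> \<phi>1 \<phi>2" "\<And>y. 0 \<le> \<phi> y" "\<And>y. \<phi> y \<le> 1"
    "\<And>y. \<bar>y - c\<bar> \<le> r1 \<Longrightarrow> \<phi> y = 1" "\<And>y. \<bar>y - c\<bar> \<ge> r2 \<Longrightarrow> \<phi> y = 0"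
proof -
  define p where "p = (\<lambda>u::real. max 0 u ^ 3)"
  define A where "A = (\<lambda>y. p (r2\<^sup>2 - (y - c)\<^sup>2))"
  define B where "B = (\<lambda>y. p ((y - c)\<^sup>2 - r1\<^sup>2))"
  have sq: "C2_with (\<lambda>y. r2\<^sup>2 - (y - c)\<^sup>2) (\<lambda>y. - 2 * (y - c)) (\<lambda>y. - 2)"
    "C2_with (\<lambda>y. (y - c)\<^sup>2 - r1\<^sup>2) (\<lambda>y. 2 * (y - c)) (\<lambda>y. 2)"
    unfolding C2_with_def by (auto intro!: derivative_eq_intros)
  note p = C2_with_max_0_cube[folded p_def]
  note AB = C2_with_compose[OF p sq(1), folded A_def] C2_with_compose[OF p sq(2), folded B_def]
  have r12: "r1\<^sup>2 < r2\<^sup>2" using r by (intro power_strict_mono) auto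
  have pos: "A y \<ge> 0" "B y \<ge> 0" for y by (auto simp: A_def B_def p_def)
  have ppos: "p u > 0" if "u > 0" for u using that by (auto simp: p_def)
  have AB0: "A y + B y > 0" for y
  proof (cases "(y - c)\<^sup>2 < r2\<^sup>2")
    case True
    then have "A y > 0" by (simp add: A_def ppos)
    then show ?thesis using pos[of y] by linarith
  next
    case False
    then have "B y > 0" using r12 by (simp add: B_def ppos)
    then show ?thesis using pos[of y] by linarith
  qed
  define \<phi> where "\<phi> = (\<lambda>y. A y * inverse (A y + B y))"
  have nz: "A y + B y \<noteq> 0" for y using AB0[of y] by simp
  from C2_with_mult[OF AB(1) C2_with_inverse[OF C2_with_add[OF AB] nz]]
  obtain \<phi>1 \<phi>2 where C: "C2_with \<phi> \<phi>1 \<phi>2" unfolding \<phi>_def by blast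
  show thesis
  proof (rule that[OF C])
    fix y
    show "0 \<le> \<phi> y" using pos[of y] by (simp add: \<phi>_def)
    show "\<phi> y \<le> 1" using pos[of y] AB0[of y] by (simp add: \<phi>_def field_simps)
    {
      assume "\<bar>y - c\<bar> \<le> r1"
      then have "(y - c)\<^sup>2 \<le> r1\<^sup>2" by (rule power2_le_iff_abs_le[THEN iffD2, rotated]) (use r in auto)
      then have "B y = 0" by (simp add: B_def p_def)
      then show "\<phi> y = 1" using nz[of y] by (simp add: \<phi>_def)
    }
    {
      assume "\<bar>y - c\<bar> \<ge> r2"
      then have "r2\<^sup>2 \<le> (y - c)\<^sup>2" using r by (metis abs_le_square_iff abs_of_pos less_trans)
      then show "\<phi> y = 0" by (simp add: \<phi>_def A_def p_def)
    }
  qed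
qed

text \<open>F need only be smooth on S. There the product rule applies; beyond distance r all terms
  vanish; the two open sets cover the line. This is how \<open>q t x\<close> and \<open>H t\<close>,
  smooth only on part of the line, become test functions for the generator.\<close>

lemma C2_with_mult_compact_support:
  assumes \<phi>: "C2_with \<phi> \<phi>1 \<phi>2" and z: "\<And>y. \<bar>y - c\<bar> \<ge> r \<Longrightarrow> \<phi> y = 0"
    and S: "open S" "{c - r..c + r} \<subseteq> S"
    and F: "\<And>y. y \<in> S \<Longrightarrow> (F has_real_derivative F1 y) (at y)"
      "\<And>y. y \<in> S \<Longrightarrow> (F1 has_real_derivative F2 y) (at y)" "continuous_on S F2"
  shows "C2_with (\<lambda>y. \<phi> y * F y) (\<lambda>y. \<phi>1 y * F y + \<phi> y * F1 y)
    (\<lambda>y. \<phi>2 y * F y + 2 * \<phi>1 y * F1 y + \<phi> y * F2 y)"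
proof -
  define T where "T = {y. \<bar>y - c\<bar> > r}"
  have T: "open T" unfolding T_def by (intro open_Collect_less continuous_intros)
  note d = C2_withD[OF \<phi>]
  have z0: "\<phi> y = 0" "\<phi>1 y = 0" "\<phi>2 y = 0" if "y \<in> T" for y
    using z C2_with_zero_outside[OF \<phi> z, of r] that by (auto simp: T_def)
  have cover: "y \<in> S \<or> y \<in> T" for y using S(2) by (auto simp: T_def subset_iff abs_le_iff) (smt (verit))
  have cF: "continuous_on S F" "continuous_on S F1"
    by (auto intro!: continuous_at_imp_continuous_on DERIV_isCont F)
  show ?thesis
    unfolding C2_with_def
  proof (intro conjI allI)
    fix y
    show "((\<lambda>y. \<phi> y * F y) has_real_derivative \<phi>1 y * F y + \<phi> y * F1 y) (at y)"
    proof (cases "y \<in> T")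
      case True
      have "((\<lambda>y. 0) has_real_derivative \<phi>1 y * F y + \<phi> y * F1 y) (at y)" using z0[OF True] by simp
      then show ?thesis by (rule has_field_derivative_transform_within_open[OF _ T True]) (simp add: z0)
    next
      case False
      then have "y \<in> S" using cover by auto
      then show ?thesis by (auto intro!: derivative_eq_intros d F)
    qed
    show "((\<lambda>y. \<phi>1 y * F y + \<phi> y * F1 y) has_real_derivative
        \<phi>2 y * F y + 2 * \<phi>1 y * F1 y + \<phi> y * F2 y) (at y)"
    proof (cases "y \<in> T")
      case True
      have "((\<lambda>y. 0) has_real_derivative \<phi>2 y * F y + 2 * \<phi>1 y * F1 y + \<phi> y * F2 y) (at y)"
        using z0[OF True] by simp
      then show ?thesis by (rule has_field_derivative_transform_within_open[OF _ T True]) (simp add: z0)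
    next
      case False
      then have "y \<in> S" using cover by auto
      then show ?thesis by (auto intro!: derivative_eq_intros d F)
    qed
  next
    have "continuous_on (S \<union> T) (\<lambda>y. \<phi>2 y * F y + 2 * \<phi>1 y * F1 y + \<phi> y * F2 y)"
    proof (rule continuous_on_open_Un[OF S(1) T])
      show "continuous_on S (\<lambda>y. \<phi>2 y * F y + 2 * \<phi>1 y * F1 y + \<phi> y * F2 y)"
        by (intro continuous_intros cF F(3) continuous_on_subset[OF d(3)]
            continuous_on_subset[OF d(4)] continuous_on_subset[OF d(5)]) auto
      have "continuous_on T (\<lambda>y. 0::real)" by simp
      then show "continuous_on T (\<lambda>y. \<phi>2 y * F y + 2 * \<phi>1 y * F1 y + \<phi> y * F2 y)"
        by (rule continuous_on_eq) (simp add: z0)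
    qed
    moreover have "S \<union> T = UNIV" using cover by auto
    ultimately show "continuous_on UNIV (\<lambda>y. \<phi>2 y * F y + 2 * \<phi>1 y * F1 y + \<phi> y * F2 y)" by simp
  qed
qed

text \<open>For each slope e > 0, the estimate
  \<open>\<bar>Z u - Z a\<bar> \<le> e * (u - a)\<close> holds up to the supremum T of its range, at
  T itself by continuity, and the right derivative at T carries it further unless T = b. Then e is
  made small.\<close>

lemma zero_right_derivative_imp_const:
  fixes Z :: "real \<Rightarrow> real"
  assumes ab: "a \<le> b" and cont: "continuous_on {a..b} Z"
    and der: "\<And>t. a \<le> t \<Longrightarrow> t < b \<Longrightarrow> ((\<lambda>h. (Z (t + h) - Z t) / h) \<longlongrightarrow> 0) (at_right 0)"
  shows "Z b = Z a"
proof -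
  have bound: "\<bar>Z b - Z a\<bar> \<le> e * (b - a)" if e: "e > 0" for e
  proof -
    define A where "A = {t \<in> {a..b}. \<forall>u \<in> {a..t}. \<bar>Z u - Z a\<bar> \<le> e * (u - a)}"
    define T where "T = Sup A"
    have aA: "a \<in> A" using ab by (auto simp: A_def)
    have bdd: "bdd_above A" by (auto simp: A_def bdd_above_def)
    have T: "a \<le> T" "T \<le> b"
      using aA bdd by (auto simp: T_def A_def intro!: cSup_upper cSup_least)
    have below: "\<bar>Z u - Z a\<bar> \<le> e * (u - a)" if "a \<le> u" "u < T" for u
    proof -
      have "\<exists>t\<in>A. u < t" by (rule less_cSupD) (use that aA T_def in auto)
      then obtain t where "t \<in> A" "u < t" by blast
      then show ?thesis using that by (auto simp: A_def)
    qed
    have atT: "\<bar>Z T - Z a\<bar> \<le> e * (T - a)"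
    proof (cases "T = a")
      case False
      then have aT: "a < T" using T by simp
      have "continuous_on {a..T} Z" by (rule continuous_on_subset[OF cont]) (use T in auto)
      then have "continuous (at_left T) Z"
        using aT by (simp add: continuous_on_Icc_at_leftD continuous_within)
      then have "((\<lambda>u. \<bar>Z u - Z a\<bar>) \<longlongrightarrow> \<bar>Z T - Z a\<bar>) (at_left T)"
        by (auto simp: continuous_within intro!: tendsto_intros)
      moreover have "((\<lambda>u. e * (u - a)) \<longlongrightarrow> e * (T - a)) (at_left T)"
        by (intro tendsto_intros)
      moreover have "eventually (\<lambda>u. \<bar>Z u - Z a\<bar> \<le> e * (u - a)) (at_left T)"
        using eventually_at_left_real[OF aT] by eventually_elim (use below in auto)
      ultimately show ?thesis by (intro tendsto_le[OF _ _ _ ]) auto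
    qed simp
    have "T = b"
    proof (rule ccontr)
      assume "T \<noteq> b"
      then have Tb: "T < b" using T by simp
      have "eventually (\<lambda>h. \<bar>(Z (T + h) - Z T) / h\<bar> < e) (at_right 0)"
        using tendstoD[OF der[OF T(1) Tb] e] by (simp add: dist_real_def)
      then obtain d where d: "d > 0" "\<And>h. 0 < h \<Longrightarrow> h < d \<Longrightarrow> \<bar>(Z (T + h) - Z T) / h\<bar> < e"
        by (auto simp: eventually_at_right_field)
      define t where "t = T + min (d / 2) (b - T)"
      have t: "T < t" "t \<le> b" "t - T < d" using d Tb by (auto simp: t_def)
      have "t \<in> A"
        unfolding A_def
      proof (safe)
        show "t \<in> {a..b}" using t T by auto
        fix u assume u: "u \<in> {a..t}"
        show "\<bar>Z u - Z a\<bar> \<le> e * (u - a)"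
        proof (cases "u \<le> T")
          case True then show ?thesis using below[of u] atT u by (cases "u = T") auto
        next
          case False
          then have "\<bar>(Z (T + (u - T)) - Z T) / (u - T)\<bar> < e" using u t by (intro d(2)) auto
          then have "\<bar>Z u - Z T\<bar> \<le> e * (u - T)" using False by (simp add: abs_divide field_simps)
          then show ?thesis using atT by (simp add: algebra_simps)
        qed
      qed
      then have "t \<le> T" unfolding T_def by (rule cSup_upper[OF _ bdd])
      then show False using t by simp
    qed
    then show ?thesis using atT by simp
  qed
  show ?thesis
  proof (rule ccontr)
    assume ne: "Z b \<noteq> Z a"
    then have "a < b" using ab by (cases "a = b") auto
    \<comment> \<open>The slope \<open>e\<close> is chosen so that the bound is half of the assumed
      difference.\<close>
    define Q where "Q = \<bar>Z b - Z a\<bar> / 2"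
    define e where "e = Q / (b - a)"
    have "Q > 0" "b - a > 0" using ne \<open>a < b\<close> by (simp_all add: Q_def)
    then have "e > 0" "e * (b - a) = \<bar>Z b - Z a\<bar> / 2"
      by (simp add: e_def) (use \<open>b - a > 0\<close> in \<open>simp only: e_def nonzero_eq_divide_eq Q_def[symmetric], simp\<close>)
    then have "\<bar>Z b - Z a\<bar> \<le> \<bar>Z b - Z a\<bar> / 2"
      using bound[of e] by simp
    then show False using ne by simp
  qed
qed

text \<open>Compare N with the integral K of D from a point a > 0: N - K is continuous with zero
  right derivative, hence constant, and K has a two-sided derivative because D is
  continuous.\<close>

lemma continuous_right_derivative_imp_derivative:
  fixes N D :: "real \<Rightarrow> real"
  assumes N: "continuous_on {0<..} N" and D: "continuous_on {0<..} D"
    and der: "\<And>t. 0 < t \<Longrightarrow> ((\<lambda>h. (N (t + h) - N t) / h) \<longlongrightarrow> D t) (at_right 0)"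
    and t: "0 < t"
  shows "(N has_real_derivative D t) (at t)"
proof -
  define a b where "a = t / 2" and "b = t + 1"
  have ab: "0 < a" "a < t" "t < b" using t by (auto simp: a_def b_def)
  have cD: "continuous_on {a..b} D" by (rule continuous_on_subset[OF D]) (use ab in auto)
  define K where "K = (\<lambda>u. integral {a..u} D)"
  have K: "(K has_real_derivative D u) (at u within {a..b})" if "u \<in> {a..b}" for u
    unfolding K_def has_real_derivative_iff_has_vector_derivative
    by (rule integral_has_vector_derivative[OF cD that])
  have cK: "continuous_on {a..b} K"
    unfolding continuous_on_eq_continuous_within using K DERIV_continuous by blast
  have NK: "N u - K u = N a - K a" if u: "u \<in> {a..b}" for u
  proof (rule zero_right_derivative_imp_const[of a u "\<lambda>u. N u - K u"])
    show "continuous_on {a..u} (\<lambda>u. N u - K u)"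
      by (intro continuous_intros continuous_on_subset[OF N] continuous_on_subset[OF cK])
        (use ab u in auto)
    fix v assume v: "a \<le> v" "v < u"
    have "(K has_real_derivative D v) (at_right v)"
      using has_field_derivative_subset[OF K[of v], of "{v..b}"] u v
      by (metis (no_types, opaque_lifting) atLeastAtMost_iff at_within_Icc_at_right atLeastatMost_subset_iff less_eq_real_def order_less_le_trans)
    then have "((\<lambda>w. (K w - K v) / (w - v)) \<longlongrightarrow> D v) (at_right v)"
      by (simp add: has_field_derivative_iff)
    then have "((\<lambda>h. (K (v + h) - K v) / h) \<longlongrightarrow> D v) (at_right 0)"
      by (subst (asm) filterlim_at_right_to_0) (simp add: add.commute)
    from tendsto_diff[OF der[of v] this] have
      "((\<lambda>h. (N (v + h) - N v) / h - (K (v + h) - K v) / h) \<longlongrightarrow> 0) (at_right 0)"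
      using ab v by simp
    then show "((\<lambda>h. ((N (v + h) - K (v + h)) - (N v - K v)) / h) \<longlongrightarrow> 0) (at_right 0)"
      by (simp add: diff_divide_distrib add_divide_distrib algebra_simps)
  qed (use u in auto)
  have "(K has_real_derivative D t) (at t)"
    using K[of t] ab at_within_Icc_at[of a t b] by simp
  then have "((\<lambda>u. K u + (N a - K a)) has_real_derivative D t) (at t)"
    by (auto intro!: derivative_eq_intros)
  then show ?thesis
  proof (rule has_field_derivative_transform_within_open[of _ _ _ "{a<..<b}"])
    show "K u + (N a - K a) = N u" if "u \<in> {a<..<b}" for u
      using NK[of u] that by auto
  qed (use ab in auto)
qed

section \<open>Passage times on path space\<close>

lemma path_spaceD:
  assumes "\<omega> \<in> space (path_space l)"
  shows "continuous_on {0..} \<omega>" "0 \<le> t \<Longrightarrow> \<omega> t \<in> einterval l \<infinity>"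
  using assms by (auto simp: path_space_def space_restrict_space space_PiM PiE_def)

lemma path_spaceI:
  assumes "continuous_on {0..} \<omega>" "\<And>t. 0 \<le> t \<Longrightarrow> \<omega> t \<in> einterval l \<infinity>" "\<omega> \<in> extensional {0..}"
  shows "\<omega> \<in> space (path_space l)"
  using assms by (auto simp: path_space_def space_restrict_space space_PiM PiE_def)

lemma measurable_path_eval [measurable (raw)]:
  assumes "0 \<le> t"
  shows "(\<lambda>\<omega>. \<omega> t) \<in> borel_measurable (path_space l)"
  unfolding path_space_def
  by (rule measurable_restrict_space1) (rule measurable_component_singleton, use assms in simp)

lemma shift_path_apply: "0 \<le> u \<Longrightarrow> shift_path t \<omega> u = \<omega> (t + u)"
  by (simp add: shift_path_def)

lemma shift_path_in_space:
  assumes "\<omega> \<in> space (path_space l)" "0 \<le> t"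
  shows "shift_path t \<omega> \<in> space (path_space l)"
proof (rule path_spaceI)
  have "continuous_on {0..} (\<lambda>u. \<omega> (t + u))"
    by (rule continuous_on_compose2[OF path_spaceD(1)[OF assms(1)]])
      (use assms(2) in \<open>auto intro!: continuous_intros\<close>)
  then show "continuous_on {0..} (shift_path t \<omega>)"
    by (rule continuous_on_eq) (simp add: shift_path_def)
  show "shift_path t \<omega> u \<in> einterval l \<infinity>" if "0 \<le> u" for u
    using path_spaceD(2)[OF assms(1), of "t + u"] that assms(2) by (simp add: shift_path_apply)
qed (simp add: shift_path_def)

text \<open>On a compact interval a continuous path meets g iff the infimum of
  \<open>\<bar>\<omega> u - g u\<bar>\<close> is zero, and a countable dense set of times detects
  this. M is left general so that the result serves both path space and the members of its
  filtration.\<close>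

lemma hit_set_measurable:
  fixes g :: "real \<Rightarrow> real" and M :: "(real \<Rightarrow> real) measure"
  assumes cont: "\<And>\<omega>. \<omega> \<in> space M \<Longrightarrow> continuous_on {a..b} \<omega>"
    and meas: "\<And>u. u \<in> {a..b} \<Longrightarrow> (\<lambda>\<omega>. \<omega> u) \<in> borel_measurable M"
    and g: "continuous_on {a..b} g"
  shows "{\<omega> \<in> space M. \<exists>u\<in>{a..b}. \<omega> u = g u} \<in> sets M"
proof -
  obtain D where D: "countable D" "D \<subseteq> {a..b}" "{a..b} \<subseteq> closure D"
    using separable[of "{a..b}"] by blast
  have eq: "(\<exists>u\<in>{a..b}. \<omega> u = g u) \<longleftrightarrow> (\<forall>n::nat. \<exists>u\<in>D. \<bar>\<omega> u - g u\<bar> < 1 / real (Suc n))"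
    if \<omega>: "\<omega> \<in> space M" for \<omega>
  proof
    have c: "continuous_on {a..b} (\<lambda>u. \<bar>\<omega> u - g u\<bar>)"
      by (intro continuous_intros cont[OF \<omega>] g)
    {
      assume "\<exists>u\<in>{a..b}. \<omega> u = g u"
      then obtain u where u: "u \<in> {a..b}" "\<omega> u = g u" by blast
      show "\<forall>n::nat. \<exists>u\<in>D. \<bar>\<omega> u - g u\<bar> < 1 / real (Suc n)"
      proof
        fix n :: nat
        obtain d where d: "d > 0"
          "\<And>v. v \<in> {a..b} \<Longrightarrow> dist v u < d \<Longrightarrow> dist \<bar>\<omega> v - g v\<bar> \<bar>\<omega> u - g u\<bar> < 1 / real (Suc n)"
          using c u(1) unfolding continuous_on_iff
          by (metis of_nat_0_less_iff zero_less_Suc zero_less_divide_1_iff)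
        obtain v where "v \<in> D" "dist v u < d"
          using D(3) u(1) d(1) by (meson closure_approachable subset_iff)
        then show "\<exists>u\<in>D. \<bar>\<omega> u - g u\<bar> < 1 / real (Suc n)"
          using d(2)[of v] D(2) u(2) by (intro bexI[of _ v]) (auto simp: dist_real_def simp del: of_nat_Suc)
      qed
    }
    assume R: "\<forall>n::nat. \<exists>u\<in>D. \<bar>\<omega> u - g u\<bar> < 1 / real (Suc n)"
    then have "{a..b} \<noteq> {}" using D(2) by blast
    then obtain u where u: "u \<in> {a..b}" "\<And>v. v \<in> {a..b} \<Longrightarrow> \<bar>\<omega> u - g u\<bar> \<le> \<bar>\<omega> v - g v\<bar>"
      using continuous_attains_inf[OF compact_Icc _ c] by blast
    have "\<omega> u = g u"
    proof (rule ccontr)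
      assume "\<omega> u \<noteq> g u"
      then obtain n :: nat where "1 / real (Suc n) < \<bar>\<omega> u - g u\<bar>"
        using nat_approx_posE[of "\<bar>\<omega> u - g u\<bar>"] by (metis zero_less_abs_iff right_minus_eq)
      moreover obtain v where "v \<in> D" "\<bar>\<omega> v - g v\<bar> < 1 / real (Suc n)" using R by blast
      ultimately show False using u(2)[of v] D(2) by auto
    qed
    then show "\<exists>u\<in>{a..b}. \<omega> u = g u" using u(1) by blast
  qed
  have "{\<omega> \<in> space M. \<exists>u\<in>{a..b}. \<omega> u = g u} =
      {\<omega> \<in> space M. \<forall>n::nat. \<exists>u\<in>D. \<bar>\<omega> u - g u\<bar> < 1 / real (Suc n)}"
    using eq by blast
  also have "\<dots> \<in> sets M"
  proof (intro sets.sets_Collect_countable_All sets.sets_Collect_countable_Ex' D(1))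
    fix n :: nat and u assume "u \<in> D"
    then have [measurable]: "(\<lambda>\<omega>. \<omega> u) \<in> borel_measurable M" using meas D(2) by blast
    show "{\<omega> \<in> space M. \<bar>\<omega> u - g u\<bar> < 1 / real (Suc n)} \<in> sets M" by measurable
  qed
  finally show ?thesis .
qed

lemma closed_coincidence:
  fixes \<omega> g :: "real \<Rightarrow> real"
  assumes "continuous_on {0..} \<omega>" "continuous_on {0..} g"
  shows "closed {t. 0 \<le> t \<and> \<omega> t = g t}"
proof -
  have "closed {t \<in> {0..}. \<omega> t = g t}"
    by (rule continuous_closed_preimage_constant[of _ "\<lambda>t. \<omega> t - g t" 0, simplified])
      (auto intro!: continuous_intros assms)
  then show ?thesis by simp
qed

text \<open>The coincidence set is closed, so a finite infimum is attained: the path is on the curve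
  at its first passage time.\<close>

lemma first_passage_cases:
  assumes "continuous_on {0..} \<omega>" "continuous_on {0..} g"
  obtains "first_passage g \<omega> = \<infinity>" "\<And>u. 0 \<le> u \<Longrightarrow> \<omega> u \<noteq> g u"
    | z where "0 \<le> z" "\<omega> z = g z" "first_passage g \<omega> = ennreal z"
      "\<And>u. 0 \<le> u \<Longrightarrow> \<omega> u = g u \<Longrightarrow> z \<le> u"
proof -
  define Z where "Z = {t. 0 \<le> t \<and> \<omega> t = g t}"
  have cl: "closed Z" unfolding Z_def by (rule closed_coincidence[OF assms(1,2)])
  show thesis
  proof (cases "Z = {}")
    case True
    show thesis by (rule that(1)) (use True in \<open>auto simp: first_passage_def Z_def[symmetric], auto simp: Z_def\<close>)
  next
    case False
    have bdd: "bdd_below Z" by (auto simp: Z_def bdd_below_def)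
    define z where "z = Inf Z"
    have z: "z \<in> Z" unfolding z_def by (rule closed_contains_Inf[OF False bdd cl])
    have le: "z \<le> u" if "u \<in> Z" for u unfolding z_def by (rule cInf_lower[OF that bdd])
    have "first_passage g \<omega> = ennreal z"
      unfolding first_passage_def Z_def[symmetric]
      by (rule Inf_eqI) (use z le in \<open>auto intro: ennreal_leI\<close>)
    then show thesis using that(2)[of z] z le by (auto simp: Z_def)
  qed
qed

lemma first_passage_le_iff:
  assumes "continuous_on {0..} \<omega>" "continuous_on {0..} g" "0 \<le> t"
  shows "first_passage g \<omega> \<le> ennreal t \<longleftrightarrow> (\<exists>u\<in>{0..t}. \<omega> u = g u)"
proof (rule first_passage_cases[OF assms(1,2)])
  assume "first_passage g \<omega> = \<infinity>" "\<And>u. 0 \<le> u \<Longrightarrow> \<omega> u \<noteq> g u"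
  then show ?thesis by (auto simp: top_unique)
next
  fix z assume "0 \<le> z" "\<omega> z = g z" "first_passage g \<omega> = ennreal z"
    "\<And>u. 0 \<le> u \<Longrightarrow> \<omega> u = g u \<Longrightarrow> z \<le> u"
  then show ?thesis using assms(3) by (auto intro!: bexI[of _ z]) fastforce
qed

lemma first_passage_eq_infinity_iff:
  assumes "continuous_on {0..} \<omega>" "continuous_on {0..} g"
  shows "first_passage g \<omega> = \<infinity> \<longleftrightarrow> (\<forall>u\<ge>0. \<omega> u \<noteq> g u)"
  by (rule first_passage_cases[OF assms]) auto

text \<open>If all coincidences precede t, they form a closed bounded set, so their supremum is
  itself a coincidence and lies strictly before t. The assumption \<open>0 < t\<close> covers the
  empty set, whose supremum is 0.\<close>

lemma last_passage_less_iff: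
  assumes "continuous_on {0..} \<omega>" "continuous_on {0..} g" "0 < t"
  shows "last_passage g \<omega> < ennreal t \<longleftrightarrow> (\<forall>u\<ge>t. \<omega> u \<noteq> g u)"
proof
  assume L: "last_passage g \<omega> < ennreal t"
  show "\<forall>u\<ge>t. \<omega> u \<noteq> g u"
  proof (intro allI impI notI)
    fix u assume u: "t \<le> u" "\<omega> u = g u"
    then have "ennreal u \<le> last_passage g \<omega>"
      unfolding last_passage_def using assms(3) by (intro Sup_upper) auto
    then show False using L u(1) by (meson ennreal_leI leD order_trans)
  qed
next
  assume R: "\<forall>u\<ge>t. \<omega> u \<noteq> g u"
  define Z where "Z = {t. 0 \<le> t \<and> \<omega> t = g t}"
  have cl: "closed Z" unfolding Z_def by (rule closed_coincidence[OF assms(1,2)])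
  show "last_passage g \<omega> < ennreal t"
  proof (cases "Z = {}")
    case True
    then show ?thesis using assms(3) unfolding last_passage_def Z_def[symmetric] by (simp add: bot_ennreal)
  next
    case False
    have lt: "u < t" if "u \<in> Z" for u using R that by (auto simp: Z_def not_le[symmetric])
    then have bdd: "bdd_above Z" unfolding bdd_above_def by (meson less_imp_le)
    define z where "z = Sup Z"
    have z: "z \<in> Z" unfolding z_def by (rule closed_contains_Sup[OF False bdd cl])
    have le: "u \<le> z" if "u \<in> Z" for u unfolding z_def by (rule cSup_upper[OF that bdd])
    have "last_passage g \<omega> = ennreal z"
      unfolding last_passage_def Z_def[symmetric]
      by (rule Sup_eqI) (use z le in \<open>auto intro: ennreal_leI\<close>)
    then show ?thesis using lt[OF z] z by (simp add: Z_def ennreal_lessI)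
  qed
qed

lemma no_hit_after_measurable:
  fixes g :: "real \<Rightarrow> real"
  assumes t: "0 \<le> t" and g: "continuous_on {t..} g"
  shows "{\<omega> \<in> space (path_space l). \<forall>u\<ge>t. \<omega> u \<noteq> g u} \<in> sets (path_space l)"
proof -
  have "{\<omega> \<in> space (path_space l). \<exists>u\<in>{t..t + real n}. \<omega> u = g u} \<in> sets (path_space l)" for n
  proof (rule hit_set_measurable)
    show "continuous_on {t..t + real n} \<omega>" if "\<omega> \<in> space (path_space l)" for \<omega>
      by (rule continuous_on_subset[OF path_spaceD(1)[OF that]]) (use t in auto)
    show "continuous_on {t..t + real n} g"
      by (rule continuous_on_subset[OF g]) auto
  qed (use t measurable_path_eval in auto)
  then have "space (path_space l) - (\<Union>n. {\<omega> \<in> space (path_space l). \<exists>u\<in>{t..t + real n}. \<omega> u = g u})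
      \<in> sets (path_space l)" by blast
  also have "space (path_space l) - (\<Union>n. {\<omega> \<in> space (path_space l). \<exists>u\<in>{t..t + real n}. \<omega> u = g u})
      = {\<omega> \<in> space (path_space l). \<forall>u\<ge>t. \<omega> u \<noteq> g u}"
  proof -
    have "\<exists>n. u \<le> t + real n" for u using real_arch_simple[of "u - t"] by (auto simp: algebra_simps)
    then show ?thesis by fastforce
  qed
  finally show ?thesis .
qed

lemma last_passage_measurable:
  assumes "continuous_on {0..} g"
  shows "last_passage g \<in> borel_measurable (path_space l)"
proof (rule borel_measurableI_less)
  fix y :: ennreal
  have fin: "{\<omega> \<in> space (path_space l). last_passage g \<omega> < ennreal t} \<in> sets (path_space l)" if "0 < t" for t
  proof -
    have "{\<omega> \<in> space (path_space l). last_passage g \<omega> < ennreal t} =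
        {\<omega> \<in> space (path_space l). \<forall>u\<ge>t. \<omega> u \<noteq> g u}"
      using last_passage_less_iff[OF path_spaceD(1) assms that] by blast
    then show ?thesis
      using no_hit_after_measurable[of t g l] that continuous_on_subset[OF assms, of "{t..}"] by auto
  qed
  show "{\<omega> \<in> space (path_space l). last_passage g \<omega> < y} \<in> sets (path_space l)"
  proof (cases y)
    case (real t)
    then show ?thesis using fin[of t] by (cases "t = 0") auto
  next
    case top
    have "{\<omega> \<in> space (path_space l). last_passage g \<omega> < y} =
        (\<Union>n. {\<omega> \<in> space (path_space l). last_passage g \<omega> < ennreal (real (Suc n))})"
    proof -
      have "\<exists>n. z < ennreal (real (Suc n))" if zfin: "z < \<infinity>" for z
      proof -
        obtain r where r: "z = ennreal r" "0 \<le> r" using zfin by (cases z) auto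
        obtain n where "r < real n" using reals_Archimedean2 by blast
        then have "z < ennreal (real (Suc n))" unfolding r(1) by (intro ennreal_lessI) auto
        then show ?thesis by blast
      qed
      moreover have "z < \<infinity>" if "z < ennreal (real (Suc n))" for z n
        using that order.strict_trans[OF that ennreal_less_top] by simp
      ultimately show ?thesis using top by (auto simp del: of_nat_Suc)
    qed
    also have "\<dots> \<in> sets (path_space l)" by (intro sets.countable_UN image_subsetI fin) simp
    finally show ?thesis .
  qed
qed

section \<open>First passage as a stopping time\<close>

lemma path_filtration_eval:
  assumes "0 \<le> u" "ennreal u \<le> t"
  shows "(\<lambda>\<omega>. \<omega> u) \<in> borel_measurable (path_filtration l t)"
proof -
  define J where "J = {u. 0 \<le> u \<and> ennreal u \<le> t}"
  have uJ: "u \<in> J" using assms by (simp add: J_def)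
  have "(\<lambda>\<omega>. restrict \<omega> J) \<in> path_filtration l t \<rightarrow>\<^sub>M PiM J (\<lambda>_. borel :: real measure)"
    unfolding path_filtration_def Let_def J_def
    by (rule measurable_vimage_algebra1) (auto simp: space_PiM)
  from measurable_compose[OF this measurable_component_singleton[OF uJ]]
  show ?thesis using uJ by simp
qed

lemma space_path_filtration: "space (path_filtration l t) = space (path_space l)"
  by (simp add: path_filtration_def Let_def)

text \<open>Since the infimum is attained, the event \<tau> \<le> t says that the curve is met
  during [0, t], which the path up to t decides; the raw filtration is enough.\<close>

lemma stopping_time_first_passage:
  assumes g: "continuous_on {0..} g"
  shows "stopping_time (path_filtration l) (first_passage g)"
  unfolding stopping_time_def
proof
  fix t :: ennreal
  show "Measurable.pred (path_filtration l t) (\<lambda>\<omega>. first_passage g \<omega> \<le> t)"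
  proof (cases t)
    case (real r)
    have "{\<omega> \<in> space (path_filtration l t). \<exists>u\<in>{0..r}. \<omega> u = g u} \<in> sets (path_filtration l t)"
    proof (rule hit_set_measurable)
      show "continuous_on {0..r} \<omega>" if "\<omega> \<in> space (path_filtration l t)" for \<omega>
        by (rule continuous_on_subset[OF path_spaceD(1)[of \<omega> l]])
          (use that in \<open>auto simp: space_path_filtration\<close>)
      show "continuous_on {0..r} g" by (rule continuous_on_subset[OF g]) auto
    qed (use real in \<open>auto intro!: path_filtration_eval ennreal_leI\<close>)
    also have "{\<omega> \<in> space (path_filtration l t). \<exists>u\<in>{0..r}. \<omega> u = g u} =
        {\<omega> \<in> space (path_filtration l t). first_passage g \<omega> \<le> t}"
      using first_passage_le_iff[OF path_spaceD(1) g] real by (auto simp: space_path_filtration)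
    finally show ?thesis by (simp add: pred_def)
  qed simp
qed

section \<open>Markov property and transition density\<close>

context linear_diffusion
begin

abbreviation S :: "real set" where "S \<equiv> einterval l \<infinity>"

abbreviation \<Omega> :: "(real \<Rightarrow> real) set" where "\<Omega> \<equiv> space (path_space l)"

lemma open_S: "open S" by simp

lemma S_ball:
  assumes "y \<in> S"
  obtains r where "r > 0" "{y - r..y + r} \<subseteq> S"
proof -
  obtain e where e: "e > 0" "cball y e \<subseteq> S"
    using open_contains_cball open_S assms by blast
  then show thesis using that[of e] by (simp add: cball_eq_atLeastAtMost)
qed

lemma P_kernel:
  assumes "x \<in> S"
  shows "prob_space (P x)" "sets (P x) = sets (path_space l)" "space (P x) = \<Omega>"
proof -
  have "x \<in> space (restrict_space borel S)" using assms by (simp add: space_restrict_space)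
  from measurable_space[OF kernel this]
  show "prob_space (P x)" "sets (P x) = sets (path_space l)" "space (P x) = \<Omega>"
    by (auto simp: space_prob_algebra dest: sets_eq_imp_space_eq)
qed

lemma measurable_P:
  assumes "x \<in> S"
  shows "measurable (P x) N = measurable (path_space l) N"
  by (rule measurable_cong_sets[OF P_kernel(2)[OF assms] refl])

lemma eval_measurable: "x \<in> S \<Longrightarrow> 0 \<le> t \<Longrightarrow> (\<lambda>\<omega>. \<omega> t) \<in> borel_measurable (P x)"
  by (simp add: measurable_P measurable_path_eval)

lemma P_measure_measurable:
  assumes "B \<in> sets (path_space l)"
  shows "(\<lambda>y. indicator S y * measure (P y) B) \<in> borel_measurable borel"
proof -
  have "(\<lambda>y. measure (P y) B) \<in> borel_measurable (restrict_space borel S)"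
    using measurable_compose[OF measurable_prob_algebraD[OF kernel] measurable_measure_subprob_algebra[OF assms]] .
  then show ?thesis
    by (subst (asm) borel_measurable_restrict_space_iff) (auto simp: mult.commute)
qed

lemma path_in_S: "x \<in> S \<Longrightarrow> \<omega> \<in> space (P x) \<Longrightarrow> 0 \<le> t \<Longrightarrow> \<omega> t \<in> S"
  using P_kernel(3) path_spaceD(2) by blast

text \<open>The strong Markov property at the constant time t. As paths stay in S, the factor
  \<open>indicator S\<close> changes nothing; it makes the integrand a Borel function of the
  position on the whole line, to which the transition density applies.\<close>

lemma markov:
  assumes x: "x \<in> S" and t: "0 \<le> t" and B: "B \<in> sets (path_space l)"
  shows "measure (P x) {\<omega> \<in> \<Omega>. shift_path t \<omega> \<in> B} =
    (\<integral>\<omega>. indicator S (\<omega> t) * measure (P (\<omega> t)) B \<partial>P x)"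
proof -
  interpret prob_space "P x" by (rule P_kernel(1)[OF x])
  interpret F: filtration "space (path_space l)" "path_filtration l"
    by (rule filtration_path_filtration)
  have st: "stopping_time (path_filtration l) (\<lambda>_. ennreal t)" by (rule stopping_time_const)
  have A: "\<Omega> \<in> sets (F.pre_sigma (\<lambda>_. ennreal t))"
    using sets.top[of "F.pre_sigma (\<lambda>_. ennreal t)"] by (simp add: F.space_pre_sigma)
  have "emeasure (P x) {\<omega> \<in> \<Omega>. shift_path t \<omega> \<in> B} =
      (\<integral>\<^sup>+\<omega> \<in> \<Omega>. emeasure (P (\<omega> t)) B \<partial>P x)"
    using strong_markov[OF x st A B] t by simp
  also have "\<dots> = (\<integral>\<^sup>+\<omega>. ennreal (indicator S (\<omega> t) * measure (P (\<omega> t)) B) \<partial>P x)"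
  proof (rule nn_integral_cong)
    fix \<omega> assume w: "\<omega> \<in> space (P x)"
    then have wS: "\<omega> t \<in> S" using path_in_S[OF x w t] by simp
    interpret Q: prob_space "P (\<omega> t)" by (rule P_kernel(1)[OF wS])
    show "emeasure (P (\<omega> t)) B * indicator \<Omega> \<omega> = ennreal (indicator S (\<omega> t) * measure (P (\<omega> t)) B)"
      using w wS P_kernel(3)[OF x] by (simp add: Q.emeasure_eq_measure)
  qed
  also have "\<dots> = ennreal (\<integral>\<omega>. indicator S (\<omega> t) * measure (P (\<omega> t)) B \<partial>P x)"
  proof (rule nn_integral_eq_integral)
    have "(\<lambda>\<omega>. indicator S (\<omega> t) * measure (P (\<omega> t)) B) \<in> borel_measurable (P x)"
      by (rule measurable_compose[OF eval_measurable[OF x t] P_measure_measurable[OF B]])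
    moreover have "AE \<omega> in P x. norm (indicator S (\<omega> t) * measure (P (\<omega> t)) B :: real) \<le> 1"
    proof (rule AE_I2)
      fix \<omega> assume w: "\<omega> \<in> space (P x)"
      show "norm (indicator S (\<omega> t) * measure (P (\<omega> t)) B :: real) \<le> 1"
        using prob_space.prob_le_1[OF P_kernel(1)[OF path_in_S[OF x w t]]] path_in_S[OF x w t] by simp
    qed
    ultimately show "integrable (P x) (\<lambda>\<omega>. indicator S (\<omega> t) * measure (P (\<omega> t)) B)"
      by (rule integrable_const_bound[rotated])
  qed simp
  finally show ?thesis
    by (simp add: measure_def)
qed

section \<open>The transition density relative to Lebesgue measure, with the speed density
  absorbed\<close>

definition pd :: "real \<Rightarrow> real \<Rightarrow> real \<Rightarrow> real" where
  "pd t x y = indicator S y * (q t x y * rho y)"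

lemma pd_nonneg: "t > 0 \<Longrightarrow> x \<in> S \<Longrightarrow> 0 \<le> pd t x y"
  using density_nonneg[of t x y] speed_pos[of y] by (simp add: pd_def indicator_def less_imp_le)

lemma rho_measurable: "(\<lambda>y. indicator S y * rho y) \<in> borel_measurable borel"
  using speed_measurable by (simp add: set_borel_measurable_def)

lemma q_derivs:
  obtains qt qy qyy where
    "\<And>t x y. 0 < t \<Longrightarrow> x \<in> S \<Longrightarrow> y \<in> S \<Longrightarrow> ((\<lambda>u. q u x y) has_real_derivative qt t x y) (at t)"
    "\<And>t x y. 0 < t \<Longrightarrow> x \<in> S \<Longrightarrow> y \<in> S \<Longrightarrow> ((\<lambda>z. q t x z) has_real_derivative qy t x y) (at y)"
    "\<And>t x y. 0 < t \<Longrightarrow> x \<in> S \<Longrightarrow> y \<in> S \<Longrightarrow> ((\<lambda>z. qy t x z) has_real_derivative qyy t x y) (at y)"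
    "continuous_on ({0<..} \<times> S \<times> S) (\<lambda>(t, x, y). q t x y)"
    "continuous_on ({0<..} \<times> S \<times> S) (\<lambda>(t, x, y). qt t x y)"
    "continuous_on ({0<..} \<times> S \<times> S) (\<lambda>(t, x, y). qyy t x y)"
  using density_C122 unfolding C122_on_def by blast

lemma continuous_q: "continuous_on ({0<..} \<times> S \<times> S) (\<lambda>(t, x, y). q t x y)"
  by (rule q_derivs)

lemma continuous_q_compose:
  assumes "continuous_on A a" "continuous_on A b" "continuous_on A c"
    "\<And>z. z \<in> A \<Longrightarrow> 0 < a z" "\<And>z. z \<in> A \<Longrightarrow> b z \<in> S" "\<And>z. z \<in> A \<Longrightarrow> c z \<in> S"
  shows "continuous_on A (\<lambda>z. q (a z) (b z) (c z))"
proof -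
  have "continuous_on A (\<lambda>z. (a z, b z, c z))" by (intro continuous_intros assms)
  from continuous_on_compose2[OF continuous_q this] show ?thesis
    using assms(4-6) by (auto simp: image_subset_iff)
qed

lemma q_measurable:
  assumes "t > 0" "x \<in> S"
  shows "(\<lambda>y. indicator S y * q t x y) \<in> borel_measurable borel"
proof -
  have "continuous_on S (\<lambda>y. q t x y)"
    by (intro continuous_q_compose continuous_intros) (use assms in auto)
  from borel_measurable_continuous_on_indicator[OF _ this] show ?thesis by simp
qed

lemma pd_measurable:
  assumes "t > 0" "x \<in> S"
  shows "pd t x \<in> borel_measurable borel"
proof -
  have "pd t x = (\<lambda>y. (indicator S y * q t x y) * (indicator S y * rho y))"
    by (auto simp: pd_def indicator_def)
  then show ?thesis using q_measurable[OF assms] rho_measurable by simp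
qed

lemma speed_measure_density: "speed_measure l rho = density lborel (\<lambda>y. ennreal (indicator S y * rho y))"
  unfolding speed_measure_def by (rule arg_cong[where f="density lborel"]) (auto simp: indicator_def)

lemma law:
  assumes t: "t > 0" and x: "x \<in> S"
  shows "distr (P x) borel (\<lambda>\<omega>. \<omega> t) = density lborel (\<lambda>y. ennreal (pd t x y))"
proof (rule measure_eqI)
  fix B assume "B \<in> sets (distr (P x) borel (\<lambda>\<omega>. \<omega> t))"
  then have B: "B \<in> sets borel" by simp
  have "emeasure (distr (P x) borel (\<lambda>\<omega>. \<omega> t)) B = emeasure (P x) {\<omega> \<in> space (P x). \<omega> t \<in> B}"
    using B eval_measurable[OF x, of t] t by (auto simp: emeasure_distr intro!: arg_cong[where f="emeasure (P x)"])
  also have "\<dots> = (\<integral>\<^sup>+y \<in> B. ennreal (indicator S y * q t x y) \<partial>speed_measure l rho)"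
    unfolding transition_density[OF t x B]
    unfolding speed_measure_density
    using rho_measurable
    by (intro nn_integral_cong_AE) (auto simp: AE_density indicator_def)
  also have "\<dots> = (\<integral>\<^sup>+y. ennreal (indicator S y * rho y) * (ennreal (indicator S y * q t x y) * indicator B y) \<partial>lborel)"
    unfolding speed_measure_density using rho_measurable q_measurable[OF t x] B
    by (subst nn_integral_density) auto
  also have "\<dots> = (\<integral>\<^sup>+y. ennreal (pd t x y) * indicator B y \<partial>lborel)"
    using speed_pos density_nonneg[OF t x]
    by (intro nn_integral_cong) (auto simp: pd_def indicator_def ennreal_mult'[symmetric] less_imp_le mult.commute)
  also have "\<dots> = emeasure (density lborel (\<lambda>y. ennreal (pd t x y))) B"
    using pd_measurable[OF t x] B by (subst emeasure_density) auto
  finally show "emeasure (distr (P x) borel (\<lambda>\<omega>. \<omega> t)) B = emeasure (density lborel (\<lambda>y. ennreal (pd t x y))) B" .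
qed simp

lemma expectation:
  fixes F :: "real \<Rightarrow> real"
  assumes t: "t > 0" and x: "x \<in> S" and F: "F \<in> borel_measurable borel"
  shows "(\<integral>\<omega>. F (\<omega> t) \<partial>P x) = (\<integral>y. pd t x y * F y \<partial>lborel)"
    and "integrable (P x) (\<lambda>\<omega>. F (\<omega> t)) \<longleftrightarrow> integrable lborel (\<lambda>y. pd t x y * F y)"
proof -
  have "(\<integral>\<omega>. F (\<omega> t) \<partial>P x) = integral\<^sup>L (distr (P x) borel (\<lambda>\<omega>. \<omega> t)) F"
    using eval_measurable[OF x, of t] t F by (subst integral_distr) auto
  also have "\<dots> = (\<integral>y. pd t x y * F y \<partial>lborel)"
    unfolding law[OF t x] using pd_measurable[OF t x] pd_nonneg[OF t x] F
    by (subst integral_density) auto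
  finally show "(\<integral>\<omega>. F (\<omega> t) \<partial>P x) = (\<integral>y. pd t x y * F y \<partial>lborel)" .
  have "integrable (P x) (\<lambda>\<omega>. F (\<omega> t)) \<longleftrightarrow> integrable (distr (P x) borel (\<lambda>\<omega>. \<omega> t)) F"
    using eval_measurable[OF x, of t] t F by (subst integrable_distr_eq) auto
  also have "\<dots> \<longleftrightarrow> integrable lborel (\<lambda>y. pd t x y * F y)"
    unfolding law[OF t x] using pd_measurable[OF t x] pd_nonneg[OF t x] F
    by (subst integrable_density) auto
  finally show "integrable (P x) (\<lambda>\<omega>. F (\<omega> t)) \<longleftrightarrow> integrable lborel (\<lambda>y. pd t x y * F y)" .
qed

lemma pd_integral:
  assumes t: "t > 0" and x: "x \<in> S"
  shows "integrable lborel (pd t x)" "(\<integral>y. pd t x y \<partial>lborel) = 1"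
proof -
  interpret prob_space "P x" by (rule P_kernel(1)[OF x])
  show "integrable lborel (pd t x)" "(\<integral>y. pd t x y \<partial>lborel) = 1"
    using expectation[OF t x, of "\<lambda>_. 1"] by (auto simp: prob_space)
qed

lemma expectation_le:
  fixes F :: "real \<Rightarrow> real"
  assumes t: "t > 0" and x: "x \<in> S" and b: "\<And>y. y \<in> S \<Longrightarrow> \<bar>F y\<bar> \<le> C"
  shows "\<bar>\<integral>y. pd t x y * F y \<partial>lborel\<bar> \<le> C"
proof -
  have "\<bar>\<integral>y. pd t x y * F y \<partial>lborel\<bar> \<le> (\<integral>y. pd t x y * C \<partial>lborel)"
  proof (rule integral_abs_bound[THEN order_trans], rule integral_mono')
    show "integrable lborel (\<lambda>y. pd t x y * C)" using pd_integral(1)[OF t x] by simp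
    fix y
    show "\<bar>pd t x y * F y\<bar> \<le> pd t x y * C"
      using mult_left_mono[OF b[of y] pd_nonneg[OF t x, of y]] pd_nonneg[OF t x, of y]
      by (cases "y \<in> S") (simp_all add: abs_mult, simp add: pd_def)
    have "0 \<le> C" using b[of x] x by (meson abs_ge_zero order_trans)
    then show "0 \<le> pd t x y * C" using pd_nonneg[OF t x] by simp
  qed
  also have "\<dots> = C" using pd_integral(2)[OF t x] by simp
  finally show ?thesis .
qed

end

section \<open>Hitting estimates\<close>

lemma crossing:
  fixes \<omega> :: "real \<Rightarrow> real"
  assumes "continuous_on {0..} \<omega>" "continuous_on {0..} g" "0 \<le> u" "u \<le> v"
    and "\<omega> u \<le> g u \<and> g v \<le> \<omega> v \<or> g u \<le> \<omega> u \<and> \<omega> v \<le> g v"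
  obtains w where "u \<le> w" "w \<le> v" "\<omega> w = g w"
proof -
  have c: "continuous_on {u..v} (\<lambda>w. \<omega> w - g w)"
    by (intro continuous_intros continuous_on_subset[OF assms(1)] continuous_on_subset[OF assms(2)])
      (use assms(3) in auto)
  from assms(5) have "\<exists>w. u \<le> w \<and> w \<le> v \<and> \<omega> w - g w = 0"
  proof
    assume "\<omega> u \<le> g u \<and> g v \<le> \<omega> v"
    then show ?thesis using IVT'[OF _ _ assms(4) c, of 0] by auto
  next
    assume "g u \<le> \<omega> u \<and> \<omega> v \<le> g v"
    then show ?thesis using IVT2'[OF _ _ assms(4) c, of 0] by auto
  qed
  then show thesis using that by auto
qed

text \<open>T is rounded up to multiples of 1/(n+1). The rounded times take countably many values,
  so evaluation at them is measurable, and path continuity passes to the limit.\<close>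

lemma measurable_eval_random_time:
  assumes T: "T \<in> borel_measurable (path_space l)" "\<And>\<omega>. \<omega> \<in> space (path_space l) \<Longrightarrow> 0 \<le> T \<omega>"
  shows "(\<lambda>\<omega>. \<omega> (T \<omega>)) \<in> borel_measurable (path_space l)"
proof (rule borel_measurable_LIMSEQ_real)
  define k where "k = (\<lambda>(n::nat) \<omega>. nat \<lceil>real (Suc n) * T \<omega>\<rceil>)"
  show "(\<lambda>\<omega>. \<omega> (real (k n \<omega>) / real (Suc n))) \<in> borel_measurable (path_space l)" for n
  proof (rule measurable_compose_countable[where f="\<lambda>i \<omega>. \<omega> (real i / real (Suc n))" and g="k n"])
    show "(\<lambda>\<omega>. \<omega> (real i / real (Suc n))) \<in> borel_measurable (path_space l)" for i
      by (rule measurable_path_eval) simp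
    show "k n \<in> path_space l \<rightarrow>\<^sub>M count_space UNIV"
      unfolding k_def using T(1) by measurable
  qed
  fix \<omega> assume w: "\<omega> \<in> space (path_space l)"
  define t where "t = T \<omega>"
  have t: "0 \<le> t" using T(2)[OF w] by (simp add: t_def)
  have "(\<lambda>n. real (k n \<omega>) / real (Suc n)) \<longlonglongrightarrow> t"
  proof (rule tendsto_sandwich)
    show "(\<lambda>n. t) \<longlonglongrightarrow> t" by simp
    show "(\<lambda>n. t + inverse (real (Suc n))) \<longlonglongrightarrow> t"
      using LIMSEQ_inverse_real_of_nat_add[of t] by simp
    have kb: "real (Suc n) * t \<le> real (k n \<omega>)" "real (k n \<omega>) \<le> real (Suc n) * t + 1" for n
    proof -
      have "0 \<le> \<lceil>real (Suc n) * t\<rceil>" using t by (simp add: ceiling_le_iff order.strict_trans2[of "-1" 0])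
      then have "real (k n \<omega>) = of_int \<lceil>real (Suc n) * t\<rceil>"
        unfolding k_def t_def[symmetric] by simp
      then show "real (Suc n) * t \<le> real (k n \<omega>)" "real (k n \<omega>) \<le> real (Suc n) * t + 1"
        by linarith+
    qed
    show "\<forall>\<^sub>F n in sequentially. t \<le> real (k n \<omega>) / real (Suc n)"
      by (rule always_eventually) (use kb(1) in \<open>simp add: field_simps\<close>)
    show "\<forall>\<^sub>F n in sequentially. real (k n \<omega>) / real (Suc n) \<le> t + inverse (real (Suc n))"
    proof (intro always_eventually allI)
      fix n
      have "real (k n \<omega>) / real (Suc n) \<le> (real (Suc n) * t + 1) / real (Suc n)"
        by (rule divide_right_mono[OF kb(2)]) simp
      then show "real (k n \<omega>) / real (Suc n) \<le> t + inverse (real (Suc n))"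
        by (simp add: add_divide_distrib inverse_eq_divide del: of_nat_Suc)
    qed
  qed
  then show "(\<lambda>n. \<omega> (real (k n \<omega>) / real (Suc n))) \<longlonglongrightarrow> \<omega> (T \<omega>)"
    unfolding t_def[symmetric]
    by (rule continuous_on_tendsto_compose[OF path_spaceD(1)[OF w]]) (use t in auto)
qed

lemma measurable_shift_random_time:
  assumes T: "T \<in> borel_measurable (path_space l)" "\<And>\<omega>. \<omega> \<in> space (path_space l) \<Longrightarrow> 0 \<le> T \<omega>"
  shows "(\<lambda>\<omega>. shift_path (T \<omega>) \<omega>) \<in> path_space l \<rightarrow>\<^sub>M path_space l"
proof -
  let ?C = "{\<omega>. continuous_on {0..} \<omega> \<and> (\<forall>t\<ge>0. \<omega> t \<in> einterval l \<infinity>)}"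
  have "(\<lambda>\<omega>. shift_path (T \<omega>) \<omega>) \<in> path_space l \<rightarrow>\<^sub>M restrict_space (Pi\<^sub>M {0..} (\<lambda>_. borel)) ?C"
  proof (rule measurable_restrict_space2)
    show "(\<lambda>\<omega>. shift_path (T \<omega>) \<omega>) \<in> space (path_space l) \<rightarrow> ?C"
      using path_spaceD[OF shift_path_in_space] T(2) by blast
    show "(\<lambda>\<omega>. shift_path (T \<omega>) \<omega>) \<in> path_space l \<rightarrow>\<^sub>M Pi\<^sub>M {0..} (\<lambda>_. borel)"
      unfolding shift_path_def
    proof (rule measurable_restrict)
      fix u :: real assume "u \<in> {0..}"
      then show "(\<lambda>\<omega>. \<omega> (T \<omega> + u)) \<in> borel_measurable (path_space l)"
        using T by (intro measurable_eval_random_time[of "\<lambda>\<omega>. T \<omega> + u"]) auto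
    qed
  qed
  then show ?thesis by (subst (2) path_space_def)
qed

lemma first_passage_measurable:
  assumes "continuous_on {0..} g"
  shows "first_passage g \<in> borel_measurable (path_space l)"
proof (rule borel_measurableI_le)
  fix y :: ennreal
  show "{\<omega> \<in> space (path_space l). first_passage g \<omega> \<le> y} \<in> sets (path_space l)"
  proof (cases y)
    case (real t)
    have "{\<omega> \<in> space (path_space l). \<exists>u\<in>{0..t}. \<omega> u = g u} \<in> sets (path_space l)"
    proof (rule hit_set_measurable)
      show "continuous_on {0..t} \<omega>" if "\<omega> \<in> space (path_space l)" for \<omega>
        by (rule continuous_on_subset[OF path_spaceD(1)[OF that]]) auto
      show "continuous_on {0..t} g" by (rule continuous_on_subset[OF assms]) auto
    qed (auto intro: measurable_path_eval)
    also have "{\<omega> \<in> space (path_space l). \<exists>u\<in>{0..t}. \<omega> u = g u} =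
        {\<omega> \<in> space (path_space l). first_passage g \<omega> \<le> y}"
      using first_passage_le_iff[OF path_spaceD(1) assms real(1)] real by auto
    finally show ?thesis .
  qed simp
qed

section \<open>Reaching a fixed level in short time\<close>

definition hit :: "ereal \<Rightarrow> real \<Rightarrow> real \<Rightarrow> (real \<Rightarrow> real) set" where
  "hit l b h = {\<omega> \<in> space (path_space l). \<exists>u\<in>{0..h}. \<omega> u = b}"

lemma hit_measurable [measurable, simp]: "hit l b h \<in> sets (path_space l)"
  unfolding hit_def
proof (rule hit_set_measurable)
  show "continuous_on {0..h} \<omega>" if "\<omega> \<in> space (path_space l)" for \<omega>
    by (rule continuous_on_subset[OF path_spaceD(1)[OF that]]) auto
qed (auto intro: measurable_path_eval)

context linear_diffusion
begin

lemma AE_start: "x \<in> S \<Longrightarrow> AE \<omega> in P x. \<omega> 0 = x \<and> \<omega> \<in> \<Omega>"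
  using start[of x] AE_space[of "P x"] by (auto simp: P_kernel(3))

text \<open>At its first passage the path is at a, so the law of the future is the fixed measure
  \<open>P a\<close> and comes out of the integral, which leaves a product of probabilities.\<close>

lemma strong_markov_hit:
  assumes x: "x \<in> S" and a: "a \<in> S" and h: "0 \<le> h" and B: "B \<in> sets (path_space l)"
  defines "E \<equiv> {\<omega> \<in> hit l a h. shift_path (enn2real (first_passage (\<lambda>_. a) \<omega>)) \<omega> \<in> B}"
  shows "E \<in> sets (path_space l)" "measure (P x) E = measure (P a) B * measure (P x) (hit l a h)"
proof -
  interpret Px: prob_space "P x" by (rule P_kernel(1)[OF x])
  interpret Pa: prob_space "P a" by (rule P_kernel(1)[OF a])
  interpret F: filtration "space (path_space l)" "path_filtration l"
    by (rule filtration_path_filtration)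
  define \<tau> where "\<tau> = first_passage (\<lambda>_. a)"
  have st: "stopping_time (path_filtration l) \<tau>"
    unfolding \<tau>_def by (rule stopping_time_first_passage) simp
  have \<tau>m: "\<tau> \<in> borel_measurable (path_space l)"
    unfolding \<tau>_def by (rule first_passage_measurable) simp
  have hit_iff: "\<omega> \<in> hit l a h \<longleftrightarrow> \<omega> \<in> \<Omega> \<and> \<tau> \<omega> \<le> ennreal h" for \<omega>
    unfolding hit_def \<tau>_def using first_passage_le_iff[OF path_spaceD(1), of \<omega> l "\<lambda>_. a" h] h by auto
  \<comment> \<open>Reaching a by time h is known at the passage time itself: intersected with
    \<tau> \<le> t it becomes the bound \<tau> \<le> min t h.\<close>
  have A: "hit l a h \<in> sets (F.pre_sigma \<tau>)"
  proof (rule F.sets_pre_sigmaI[OF st])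
    fix t
    have "Measurable.pred (path_filtration l t) (\<lambda>\<omega>. \<tau> \<omega> \<le> min t (ennreal h))"
      by (rule F.stopping_time_le_const[OF st]) simp
    then show "{\<omega> \<in> hit l a h. \<tau> \<omega> \<le> t} \<in> sets (path_filtration l t)"
      by (simp add: pred_def space_path_filtration hit_iff conj_ac)
  qed
  have at: "\<tau> \<omega> < \<infinity>" "\<omega> (enn2real (\<tau> \<omega>)) = a" if "\<omega> \<in> hit l a h" for \<omega>
  proof -
    have w: "\<omega> \<in> \<Omega>" "\<tau> \<omega> \<le> ennreal h" using that hit_iff by auto
    show fin: "\<tau> \<omega> < \<infinity>" using w(2) by (simp add: order.strict_trans1)
    show "\<omega> (enn2real (\<tau> \<omega>)) = a"
      by (rule first_passage_cases[OF path_spaceD(1)[OF w(1)], of "\<lambda>_. a"])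
        (use fin in \<open>auto simp: \<tau>_def\<close>)
  qed
  have E: "E = {\<omega> \<in> hit l a h. \<tau> \<omega> < \<infinity> \<and> shift_path (enn2real (\<tau> \<omega>)) \<omega> \<in> B}"
    using at by (auto simp: E_def \<tau>_def)
  have "emeasure (P x) E = (\<integral>\<^sup>+\<omega> \<in> {\<omega> \<in> hit l a h. \<tau> \<omega> < \<infinity>}. emeasure (P (\<omega> (enn2real (\<tau> \<omega>)))) B \<partial>P x)"
    unfolding E by (rule strong_markov[OF x st A B])
  also have "\<dots> = (\<integral>\<^sup>+\<omega>. emeasure (P a) B * indicator (hit l a h) \<omega> \<partial>P x)"
    by (rule nn_integral_cong) (use at in \<open>auto simp: indicator_def\<close>)
  also have "\<dots> = emeasure (P a) B * emeasure (P x) (hit l a h)"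
    by (rule nn_integral_cmult_indicator) (simp add: P_kernel(2)[OF x])
  finally have "emeasure (P x) E = emeasure (P a) B * emeasure (P x) (hit l a h)" .
  then show "measure (P x) E = measure (P a) B * measure (P x) (hit l a h)"
    by (simp add: Px.emeasure_eq_measure Pa.emeasure_eq_measure ennreal_mult[symmetric])
  have "(\<lambda>\<omega>. shift_path (enn2real (\<tau> \<omega>)) \<omega>) \<in> path_space l \<rightarrow>\<^sub>M path_space l"
    by (rule measurable_shift_random_time) (use \<tau>m in auto)
  from measurable_sets[OF this B] have "hit l a h \<inter> ((\<lambda>\<omega>. shift_path (enn2real (\<tau> \<omega>)) \<omega>) -` B \<inter> \<Omega>) \<in> sets (path_space l)"
    by auto
  also have "hit l a h \<inter> ((\<lambda>\<omega>. shift_path (enn2real (\<tau> \<omega>)) \<omega>) -` B \<inter> \<Omega>) = E"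
    by (auto simp: E_def \<tau>_def hit_def)
  finally show "E \<in> sets (path_space l)" .
qed

lemma first_passage_hit:
  assumes "\<omega> \<in> \<Omega>" "0 \<le> u" "\<omega> u = a"
  obtains z where "first_passage (\<lambda>_. a) \<omega> = ennreal z" "0 \<le> z" "z \<le> u" "\<omega> z = a"
  by (rule first_passage_cases[OF path_spaceD(1)[OF assms(1)], of "\<lambda>_. a"])
    (use assms in auto)

text \<open>A path from y to b passes a first, and then has at most time h left; the product formula
  costs only a factor at most 1. This replaces all starting points beyond a by the single point a
  and so makes hitting estimates uniform.\<close>

lemma hit_through:
  assumes y: "y \<in> S" and a: "a \<in> S" and h: "0 \<le> h"
    and between: "y \<le> a \<and> a \<le> b \<or> b \<le> a \<and> a \<le> y"
  shows "measure (P y) (hit l b h) \<le> measure (P a) (hit l b h)"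
proof -
  interpret Py: prob_space "P y" by (rule P_kernel(1)[OF y])
  interpret Pa: prob_space "P a" by (rule P_kernel(1)[OF a])
  let ?E = "{\<omega> \<in> hit l a h. shift_path (enn2real (first_passage (\<lambda>_. a) \<omega>)) \<omega> \<in> hit l b h}"
  note E = strong_markov_hit[OF y a h hit_measurable[of l b h]]
  have "measure (P y) (hit l b h) \<le> measure (P y) ?E"
  proof (rule Py.finite_measure_mono_AE)
    show "?E \<in> sets (P y)" using E(1) by (simp add: P_kernel(2)[OF y])
    show "AE \<omega> in P y. \<omega> \<in> hit l b h \<longrightarrow> \<omega> \<in> ?E"
      using AE_start[OF y]
    proof eventually_elim
      fix \<omega> assume w: "\<omega> 0 = y \<and> \<omega> \<in> \<Omega>"
      show "\<omega> \<in> hit l b h \<longrightarrow> \<omega> \<in> ?E"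
      proof
        assume "\<omega> \<in> hit l b h"
        then obtain u where u: "0 \<le> u" "u \<le> h" "\<omega> u = b" by (auto simp: hit_def)
        obtain v where v: "0 \<le> v" "v \<le> u" "\<omega> v = a"
          by (rule crossing[OF path_spaceD(1), of \<omega> l "\<lambda>_. a" 0 u]) (use u w between in auto)
        obtain z where z: "first_passage (\<lambda>_. a) \<omega> = ennreal z" "0 \<le> z" "z \<le> v" "\<omega> z = a"
          using first_passage_hit[of \<omega> v a] w v by auto
        have "shift_path z \<omega> (u - z) = b" using u v z by (simp add: shift_path_apply)
        then have "shift_path z \<omega> \<in> hit l b h"
          unfolding hit_def using shift_path_in_space[of \<omega> l z] w z u v
          by (auto intro!: bexI[of _ "u - z"])
        then show "\<omega> \<in> ?E" using z v u w by (auto simp: hit_def)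
      qed
    qed
  qed
  also have "\<dots> = measure (P a) (hit l b h) * measure (P y) (hit l a h)" by (rule E(2))
  also have "\<dots> \<le> measure (P a) (hit l b h)"
    using Py.prob_le_1[of "hit l a h"] by (simp add: mult_left_le)
  finally show ?thesis .
qed

text \<open>The events decrease, and a path in all of them visits b at times tending to 0; by
  continuity it would start at b, while it starts at a.\<close>

lemma hit_tendsto_0:
  assumes a: "a \<in> S" and ab: "a \<noteq> b"
  shows "(\<lambda>n. measure (P a) (hit l b (1 / real (Suc n)))) \<longlonglongrightarrow> 0"
proof -
  interpret prob_space "P a" by (rule P_kernel(1)[OF a])
  have "(\<lambda>n. measure (P a) (hit l b (1 / real (Suc n)))) \<longlonglongrightarrow> measure (P a) (\<Inter>n. hit l b (1 / real (Suc n)))"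
  proof (rule finite_Lim_measure_decseq)
    show "range (\<lambda>n. hit l b (1 / real (Suc n))) \<subseteq> events" by (auto simp: P_kernel(2)[OF a])
    show "decseq (\<lambda>n. hit l b (1 / real (Suc n)))"
    proof (rule antimonoI)
      fix m n :: nat assume "m \<le> n"
      then have "1 / real (Suc n) \<le> 1 / real (Suc m)" by (simp add: field_simps)
      then show "hit l b (1 / real (Suc n)) \<subseteq> hit l b (1 / real (Suc m))" by (fastforce simp: hit_def)
    qed
  qed
  moreover have "AE \<omega> in P a. \<omega> \<notin> (\<Inter>n. hit l b (1 / real (Suc n)))"
    using AE_start[OF a]
  proof eventually_elim
    fix \<omega> assume w: "\<omega> 0 = a \<and> \<omega> \<in> \<Omega>"
    show "\<omega> \<notin> (\<Inter>n. hit l b (1 / real (Suc n)))"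
    proof
      assume "\<omega> \<in> (\<Inter>n. hit l b (1 / real (Suc n)))"
      then have "\<forall>n. \<exists>u. 0 \<le> u \<and> u \<le> 1 / real (Suc n) \<and> \<omega> u = b"
        by (auto simp: hit_def Bex_def simp del: of_nat_Suc)
      then obtain u where u: "\<And>n. 0 \<le> u n" "\<And>n. u n \<le> 1 / real (Suc n)" "\<And>n. \<omega> (u n) = b" by metis
      have "u \<longlonglongrightarrow> 0"
        by (rule tendsto_sandwich[OF _ _ tendsto_const LIMSEQ_inverse_real_of_nat])
          (use u in \<open>auto simp: inverse_eq_divide\<close>)
      then have "(\<lambda>n. \<omega> (u n)) \<longlonglongrightarrow> \<omega> 0"
        by (intro continuous_on_tendsto_compose[OF path_spaceD(1)[of \<omega> l]]) (use w u in auto)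
      then have "\<omega> 0 = b" using u(3) by (simp add: LIMSEQ_const_iff)
      then show False using w ab by simp
    qed
  qed
  then have "measure (P a) (\<Inter>n. hit l b (1 / real (Suc n))) = 0"
    by (subst measure_eq_AE[where B="{}"]) (auto simp: P_kernel(2)[OF a])
  ultimately show ?thesis by simp
qed

text \<open>A path that reaches b by time h stays within r1 of b for the rest of that time with
  probability at least 1/2, and then the bump equals 1 at time h. The expected bump is o(h), because
  the bump vanishes near a and so does its image under the generator.\<close>

lemma hit_decay:
  assumes a: "a \<in> S" and b: "b \<in> S" and ab: "a \<noteq> b"
  shows "((\<lambda>h. measure (P a) (hit l b h) / h) \<longlongrightarrow> 0) (at_right 0)"
proof -
  interpret Pa: prob_space "P a" by (rule P_kernel(1)[OF a])
  interpret Pb: prob_space "P b" by (rule P_kernel(1)[OF b])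
  obtain r0 where r0: "r0 > 0" "{b - r0..b + r0} \<subseteq> S" using S_ball[OF b] by blast
  \<comment> \<open>The radius keeps the support of the bump inside S and away from a.\<close>
  define r2 where "r2 = min r0 (\<bar>a - b\<bar> / 2)"
  define r1 where "r1 = r2 / 2"
  have r: "0 < r1" "r1 < r2" "r2 \<le> r0" "r2 < \<bar>a - b\<bar>"
    using r0 ab by (auto simp: r1_def r2_def min_def)
  obtain \<phi> \<phi>1 \<phi>2 where \<phi>: "C2_with \<phi> \<phi>1 \<phi>2" "\<And>y. 0 \<le> \<phi> y" "\<And>y. \<phi> y \<le> 1"
    "\<And>y. \<bar>y - b\<bar> \<le> r1 \<Longrightarrow> \<phi> y = 1" "\<And>y. \<bar>y - b\<bar> \<ge> r2 \<Longrightarrow> \<phi> y = 0"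
    using bump_exists[OF r(1,2), of b] by metis
  have br: "b - r2 \<in> S" using r0 r by auto
  have "generator s rho \<phi> a = 0"
  proof -
    have "((\<lambda>z. deriv \<phi> z / deriv s z) has_real_derivative 0) (at a)"
    proof (rule has_field_derivative_transform_within_open[of "\<lambda>_. 0" _ _ "{z. r2 < \<bar>z - b\<bar>}"])
      show "open {z. r2 < \<bar>z - b\<bar>}" by (intro open_Collect_less continuous_intros)
      show "0 = deriv \<phi> z / deriv s z" if "z \<in> {z. r2 < \<bar>z - b\<bar>}" for z
        using C2_with_zero_outside(1)[OF \<phi>(1), of r2 b z] \<phi>(5) C2_with_imp_C2_on(2)[OF \<phi>(1)] that by auto
    qed (use r in auto)
    then show ?thesis unfolding generator_def by (simp add: DERIV_imp_deriv)
  qed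
  moreover have "((\<lambda>t. ((\<integral>\<omega>. \<phi> (\<omega> t) \<partial>P a) - \<phi> a) / t) \<longlongrightarrow> generator s rho \<phi> a) (at_right 0)"
    by (rule generator[OF C2_with_imp_C2_on(1)[OF \<phi>(1)] br _ a, of "b + r2"])
      (use \<phi>(5) in \<open>auto simp: abs_le_iff\<close>)
  moreover have "\<phi> a = 0" using \<phi>(5) r by simp
  ultimately have "((\<lambda>t. (\<integral>\<omega>. \<phi> (\<omega> t) \<partial>P a) / t) \<longlongrightarrow> 0) (at_right 0)" by simp
  from tendsto_mult_right_zero[OF this, of 2]
  have lim: "((\<lambda>t. 2 * ((\<integral>\<omega>. \<phi> (\<omega> t) \<partial>P a) / t)) \<longlongrightarrow> 0) (at_right 0)" .
  \<comment> \<open>From b, each of the levels b + r1 and b - r1 is reached by time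
    \<open>1 / (n + 1)\<close> with probability below 1/4; staying strictly between them has
    probability at least 1/2, hence the factor 2 in the bound below.\<close>
  obtain n where n: "measure (P b) (hit l (b + r1) (1 / real (Suc n))) < 1/4"
    "measure (P b) (hit l (b - r1) (1 / real (Suc n))) < 1/4"
  proof -
    have "\<forall>\<^sub>F n in sequentially. measure (P b) (hit l (b + r1) (1 / real (Suc n))) < 1/4"
      "\<forall>\<^sub>F n in sequentially. measure (P b) (hit l (b - r1) (1 / real (Suc n))) < 1/4"
      by (rule order_tendstoD(2)[OF hit_tendsto_0[OF b]]; use r in simp)+
    then have "\<forall>\<^sub>F n in sequentially. measure (P b) (hit l (b + r1) (1 / real (Suc n))) < 1/4 \<and>
      measure (P b) (hit l (b - r1) (1 / real (Suc n))) < 1/4" by (rule eventually_conj)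
    then show thesis using that eventually_happens'[OF sequentially_bot] by blast
  qed
  define h0 where "h0 = 1 / real (Suc n)"
  have h0: "h0 > 0" by (simp add: h0_def)
  define B where "B = \<Omega> - (hit l (b + r1) h0 \<union> hit l (b - r1) h0)"
  have B: "B \<in> sets (path_space l)" by (auto simp: B_def)
  have PB: "measure (P b) B \<ge> 1/2"
  proof -
    have "measure (P b) (hit l (b + r1) h0 \<union> hit l (b - r1) h0) \<le> 1/4 + 1/4"
      using measure_Un_le[of "hit l (b + r1) h0" "P b" "hit l (b - r1) h0"] n
      by (simp add: P_kernel(2)[OF b] h0_def del: of_nat_Suc)
    then show ?thesis
      unfolding B_def using Pb.prob_compl[of "hit l (b + r1) h0 \<union> hit l (b - r1) h0"]
      by (simp add: P_kernel(2,3)[OF b])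
  qed
  have bound: "measure (P a) (hit l b h) \<le> 2 * (\<integral>\<omega>. \<phi> (\<omega> h) \<partial>P a)" if h: "0 < h" "h < h0" for h
  proof -
    let ?E = "{\<omega> \<in> hit l b h. shift_path (enn2real (first_passage (\<lambda>_. b) \<omega>)) \<omega> \<in> B}"
    note E = strong_markov_hit[OF a b less_imp_le[OF h(1)] B]
    have "measure (P a) ?E = (\<integral>\<omega>. indicator ?E \<omega> \<partial>P a)"
      using E(1) by (simp add: P_kernel(2)[OF a])
    also have "\<dots> \<le> (\<integral>\<omega>. \<phi> (\<omega> h) \<partial>P a)"
    proof (rule integral_mono)
      show "integrable (P a) (indicator ?E :: _ \<Rightarrow> real)"
        using E(1) by (simp add: P_kernel(2)[OF a] Pa.emeasure_finite less_top[symmetric])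
      have "(\<lambda>\<omega>. \<phi> (\<omega> h)) \<in> borel_measurable (P a)"
        using borel_measurable_continuous_onI[OF C2_withD(3)[OF \<phi>(1)]] eval_measurable[OF a, of h] h
        by (auto intro: measurable_compose)
      then show "integrable (P a) (\<lambda>\<omega>. \<phi> (\<omega> h))"
        by (rule Pa.integrable_const_bound[where B=1, rotated]) (use \<phi>(2,3) in auto)
      fix \<omega> assume "\<omega> \<in> space (P a)"
      show "indicator ?E \<omega> \<le> \<phi> (\<omega> h)"
      proof (cases "\<omega> \<in> ?E")
        case True
        then obtain u where u: "0 \<le> u" "u \<le> h" "\<omega> u = b" and w: "\<omega> \<in> \<Omega>" by (auto simp: hit_def)
        obtain z where z: "first_passage (\<lambda>_. b) \<omega> = ennreal z" "0 \<le> z" "z \<le> u" "\<omega> z = b"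
          using first_passage_hit[OF w u(1,3)] by auto
        have sB: "shift_path z \<omega> \<in> B" using True z by simp
        have nohit: "\<omega> v \<noteq> b + r1" "\<omega> v \<noteq> b - r1" if "z \<le> v" "v \<le> h" for v
        proof -
          have "shift_path z \<omega> (v - z) = \<omega> v" "v - z \<in> {0..h0}"
            using that z h by (auto simp: shift_path_apply)
          then show "\<omega> v \<noteq> b + r1" "\<omega> v \<noteq> b - r1"
            using sB unfolding B_def hit_def by force+
        qed
        have "\<not> \<omega> h \<ge> b + r1"
        proof
          assume "\<omega> h \<ge> b + r1"
          then obtain v where "z \<le> v" "v \<le> h" "\<omega> v = b + r1"
            using crossing[OF path_spaceD(1)[OF w], of "\<lambda>_. b + r1" z h] z u r by auto
          then show False using nohit by blast
        qed
        moreover have "\<not> \<omega> h \<le> b - r1"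
        proof
          assume "\<omega> h \<le> b - r1"
          then obtain v where "z \<le> v" "v \<le> h" "\<omega> v = b - r1"
            using crossing[OF path_spaceD(1)[OF w], of "\<lambda>_. b - r1" z h] z u r by auto
          then show False using nohit by blast
        qed
        ultimately have "\<phi> (\<omega> h) = 1" by (intro \<phi>(4)) auto
        then show ?thesis by (simp add: indicator_def)
      qed (simp add: \<phi>(2))
    qed
    finally have "measure (P b) B * measure (P a) (hit l b h) \<le> (\<integral>\<omega>. \<phi> (\<omega> h) \<partial>P a)"
      unfolding E(2) .
    moreover have "1/2 * measure (P a) (hit l b h) \<le> measure (P b) B * measure (P a) (hit l b h)"
      by (rule mult_right_mono[OF PB]) simp
    ultimately show ?thesis by simp
  qed
  show ?thesis
  proof (rule tendsto_sandwich[OF _ _ tendsto_const lim])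
    show "\<forall>\<^sub>F h in at_right 0. 0 \<le> measure (P a) (hit l b h) / h"
      by (simp add: eventually_at_filter)
    show "\<forall>\<^sub>F h in at_right 0. measure (P a) (hit l b h) / h \<le> 2 * ((\<integral>\<omega>. \<phi> (\<omega> h) \<partial>P a) / h)"
      using eventually_at_right_real[OF h0]
    proof eventually_elim
      fix h assume "h \<in> {0<..<h0}"
      then show "measure (P a) (hit l b h) / h \<le> 2 * ((\<integral>\<omega>. \<phi> (\<omega> h) \<partial>P a) / h)"
        using divide_right_mono[OF bound[of h], of h] by simp
    qed
  qed
qed

text \<open>By continuity, a path at distance at least r from c at time h has visited c - r or c + r
  by then.\<close>

lemma far_le_hits:
  assumes y: "y \<in> S" "\<bar>y - c\<bar> \<le> r" and h: "0 < h"
  shows "(\<integral>z. pd h y z * indicator {z. \<bar>z - c\<bar> \<ge> r} z \<partial>lborel) \<le>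
    measure (P y) (hit l (c - r) h) + measure (P y) (hit l (c + r) h)"
proof -
  interpret prob_space "P y" by (rule P_kernel(1)[OF y(1)])
  let ?A = "{z. \<bar>z - c\<bar> \<ge> r}"
  have yc: "c - r \<le> y" "y \<le> c + r" using y(2) by auto
  have [measurable]: "?A \<in> sets borel" by measurable
  have "(\<integral>z. pd h y z * indicator ?A z \<partial>lborel) = (\<integral>\<omega>. indicator ?A (\<omega> h) \<partial>P y)"
    using expectation(1)[OF h y(1), of "indicator ?A"] by simp
  also have "\<dots> = (\<integral>\<omega>. indicator {\<omega> \<in> space (P y). \<omega> h \<in> ?A} \<omega> \<partial>P y)"
    by (rule Bochner_Integration.integral_cong) (auto simp: indicator_def)
  also have "\<dots> = prob {\<omega> \<in> space (P y). \<omega> h \<in> ?A}" by simp (auto intro!: arg_cong[where f=prob])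
  also have "\<dots> \<le> prob (hit l (c - r) h \<union> hit l (c + r) h)"
  proof (rule finite_measure_mono_AE)
    show "AE \<omega> in P y. \<omega> \<in> {\<omega> \<in> space (P y). \<omega> h \<in> ?A} \<longrightarrow> \<omega> \<in> hit l (c - r) h \<union> hit l (c + r) h"
      using AE_start[OF y(1)]
    proof eventually_elim
      fix \<omega> assume w: "\<omega> 0 = y \<and> \<omega> \<in> \<Omega>"
      have "\<omega> \<in> hit l (c - r) h \<union> hit l (c + r) h" if A: "\<omega> h \<in> ?A"
      proof -
        have "\<omega> h \<ge> c + r \<or> \<omega> h \<le> c - r" using A by (auto simp: abs_if split: if_splits)
        then obtain b v where "b = c + r \<or> b = c - r" "0 \<le> v" "v \<le> h" "\<omega> v = b"
          using crossing[OF path_spaceD(1), of \<omega> l "\<lambda>_. c + r" 0 h]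
            crossing[OF path_spaceD(1), of \<omega> l "\<lambda>_. c - r" 0 h] w yc h
          by (metis continuous_on_const less_imp_le order_refl)
        then show ?thesis using w by (auto simp: hit_def)
      qed
      then show "\<omega> \<in> {\<omega> \<in> space (P y). \<omega> h \<in> ?A} \<longrightarrow> \<omega> \<in> hit l (c - r) h \<union> hit l (c + r) h" by simp
    qed
  qed (simp add: P_kernel(2)[OF y(1)])
  also have "\<dots> \<le> prob (hit l (c - r) h) + prob (hit l (c + r) h)"
    by (rule measure_Un_le) (simp_all add: P_kernel(2)[OF y(1)])
  finally show ?thesis .
qed

end

section \<open>The forward equation\<close>

lemma lborel_integral_Icc:
  fixes \<phi> :: "real \<Rightarrow> real"
  assumes "continuous_on {a..b} \<phi>"
  shows "integrable lborel (\<lambda>y. indicator {a..b} y * \<phi> y)"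
    "(\<integral>y. indicator {a..b} y * \<phi> y \<partial>lborel) = integral {a..b} \<phi>"
proof -
  have i: "set_integrable lborel {a..b} \<phi>" by (rule borel_integrable_atLeastAtMost'[OF assms])
  then show "integrable lborel (\<lambda>y. indicator {a..b} y * \<phi> y)" by (simp add: set_integrable_def)
  show "(\<integral>y. indicator {a..b} y * \<phi> y \<partial>lborel) = integral {a..b} \<phi>"
    using set_borel_integral_eq_integral(2)[OF i] by (simp add: set_lebesgue_integral_def)
qed

context linear_diffusion
begin

definition s2 :: "real \<Rightarrow> real" where "s2 = deriv (deriv s)"

lemma scale_derivs:
  shows "y \<in> S \<Longrightarrow> (deriv s has_real_derivative s2 y) (at y)"
    and "continuous_on S (deriv s)" and "continuous_on S s2"
proof -
  obtain D where D: "\<And>y. y \<in> S \<Longrightarrow> (deriv s has_real_derivative D y) (at y)" "continuous_on S D"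
    using scale_C2 unfolding C2_on_def C1_differentiable_on_def has_real_derivative_iff_has_vector_derivative by blast
  have eq: "s2 y = D y" if "y \<in> S" for y unfolding s2_def using DERIV_imp_deriv[OF D(1)[OF that]] .
  show "y \<in> S \<Longrightarrow> (deriv s has_real_derivative s2 y) (at y)" using D(1) eq by simp
  show "continuous_on S (deriv s)" by (auto intro!: continuous_at_imp_continuous_on DERIV_isCont D(1))
  show "continuous_on S s2" by (rule continuous_on_eq[OF D(2)]) (simp add: eq)
qed

lemma scale_deriv_nz: "y \<in> S \<Longrightarrow> deriv s y \<noteq> 0"
  using scale_deriv_pos[of y] by simp

text \<open>The derivative of u'/s' by the quotient rule, that is, rho times the generator applied
  to u, when \<open>u1\<close> and \<open>u2\<close> are the first two derivatives of u. Passing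
  them explicitly allows one-sided derivatives at the curve.\<close>

definition flux_deriv :: "(real \<Rightarrow> real) \<Rightarrow> (real \<Rightarrow> real) \<Rightarrow> real \<Rightarrow> real" where
  "flux_deriv u1 u2 y = (u2 y * deriv s y - u1 y * s2 y) / (deriv s y)\<^sup>2"

lemma flux_has_derivative:
  assumes "y \<in> S" "(u1 has_real_derivative u2 y) (at y within A)"
  shows "((\<lambda>z. u1 z / deriv s z) has_real_derivative flux_deriv u1 u2 y) (at y within A)"
  using DERIV_divide[OF assms(2) has_field_derivative_at_within[OF scale_derivs(1)[OF assms(1)]] scale_deriv_nz[OF assms(1)]]
  by (simp add: flux_deriv_def power2_eq_square)

lemma continuous_flux_deriv:
  assumes "A \<subseteq> S" "continuous_on A u1" "continuous_on A u2"
  shows "continuous_on A (flux_deriv u1 u2)"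
  unfolding flux_deriv_def
  by (intro continuous_intros assms continuous_on_subset[OF scale_derivs(2)] continuous_on_subset[OF scale_derivs(3)])
    (use assms(1) scale_deriv_nz in auto)

lemma generator_eq:
  assumes "open T" "y \<in> T" "y \<in> S" "\<And>z. z \<in> T \<Longrightarrow> (u has_real_derivative u1 z) (at z)"
    "(u1 has_real_derivative u2 y) (at y)"
  shows "generator s rho u y = flux_deriv u1 u2 y / rho y"
proof -
  have "((\<lambda>z. deriv u z / deriv s z) has_real_derivative flux_deriv u1 u2 y) (at y)"
    by (rule has_field_derivative_transform_within_open[OF flux_has_derivative[of y u1 u2 UNIV, OF assms(3,5)] assms(1,2)])
      (simp add: DERIV_imp_deriv[OF assms(4)])
  then show ?thesis unfolding generator_def by (simp add: DERIV_imp_deriv)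
qed

text \<open>The Wronskian relative to the scale, W = u v'/s' - v u'/s', has the difference of the
  two integrands as derivative, since the products u' v'/s' cancel. Derivatives are taken within the
  interval because H has only a left derivative at the curve.\<close>

lemma green:
  assumes ab: "a \<le> b" "{a..b} \<subseteq> S"
    and u: "\<And>y. y \<in> {a..b} \<Longrightarrow> (u has_real_derivative u1 y) (at y within {a..b})"
      "\<And>y. y \<in> {a..b} \<Longrightarrow> (u1 has_real_derivative u2 y) (at y within {a..b})" "continuous_on {a..b} u2"
    and v: "\<And>y. y \<in> {a..b} \<Longrightarrow> (v has_real_derivative v1 y) (at y within {a..b})"
      "\<And>y. y \<in> {a..b} \<Longrightarrow> (v1 has_real_derivative v2 y) (at y within {a..b})" "continuous_on {a..b} v2"
  shows "integral {a..b} (\<lambda>y. u y * flux_deriv v1 v2 y) - integral {a..b} (\<lambda>y. v y * flux_deriv u1 u2 y) =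
    (u b * v1 b / deriv s b - v b * u1 b / deriv s b) - (u a * v1 a / deriv s a - v a * u1 a / deriv s a)"
proof -
  define W where "W = (\<lambda>y. u y * (v1 y / deriv s y) - v y * (u1 y / deriv s y))"
  have c: "continuous_on {a..b} u" "continuous_on {a..b} u1" "continuous_on {a..b} v" "continuous_on {a..b} v1"
    by (rule DERIV_continuous_on[OF u(1)] DERIV_continuous_on[OF u(2)] DERIV_continuous_on[OF v(1)]
        DERIV_continuous_on[OF v(2)], assumption)+
  have W: "(W has_vector_derivative (u y * flux_deriv v1 v2 y - v y * flux_deriv u1 u2 y)) (at y within {a..b})"
    if y: "y \<in> {a..b}" for y
  proof -
    have yS: "y \<in> S" using y ab by auto
    show ?thesis
      unfolding W_def has_real_derivative_iff_has_vector_derivative[symmetric]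
      by (rule derivative_eq_intros u(1) v(1) flux_has_derivative[of y u1 u2] flux_has_derivative[of y v1 v2] yS u(2) v(2) y refl)+ simp
  qed
  have "((\<lambda>y. u y * flux_deriv v1 v2 y - v y * flux_deriv u1 u2 y) has_integral (W b - W a)) {a..b}"
    by (rule fundamental_theorem_of_calculus[OF ab(1) W])
  moreover have "(\<lambda>y. u y * flux_deriv v1 v2 y) integrable_on {a..b}" "(\<lambda>y. v y * flux_deriv u1 u2 y) integrable_on {a..b}"
    by (intro integrable_continuous_real continuous_intros continuous_flux_deriv ab c u(3) v(3))+
  ultimately have "integral {a..b} (\<lambda>y. u y * flux_deriv v1 v2 y) - integral {a..b} (\<lambda>y. v y * flux_deriv u1 u2 y) = W b - W a"
    by (subst Henstock_Kurzweil_Integration.integral_diff[symmetric]) (auto simp: integral_unique)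
  then show ?thesis by (simp add: W_def)
qed

section \<open>Derivatives of the transition density and continuity of the speed density\<close>

definition qt :: "real \<Rightarrow> real \<Rightarrow> real \<Rightarrow> real" where "qt t x y = deriv (\<lambda>u. q u x y) t"
definition qy :: "real \<Rightarrow> real \<Rightarrow> real \<Rightarrow> real" where "qy t x y = deriv (q t x) y"
definition qyy :: "real \<Rightarrow> real \<Rightarrow> real \<Rightarrow> real" where "qyy t x y = deriv (qy t x) y"

lemma density_derivs:
  shows "0 < t \<Longrightarrow> x \<in> S \<Longrightarrow> y \<in> S \<Longrightarrow> ((\<lambda>u. q u x y) has_real_derivative qt t x y) (at t)"
    and "0 < t \<Longrightarrow> x \<in> S \<Longrightarrow> y \<in> S \<Longrightarrow> (q t x has_real_derivative qy t x y) (at y)"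
    and "0 < t \<Longrightarrow> x \<in> S \<Longrightarrow> y \<in> S \<Longrightarrow> (qy t x has_real_derivative qyy t x y) (at y)"
    and "continuous_on ({0<..} \<times> S \<times> S) (\<lambda>(t, x, y). qt t x y)"
    and "0 < t \<Longrightarrow> x \<in> S \<Longrightarrow> continuous_on S (qy t x)"
    and "0 < t \<Longrightarrow> x \<in> S \<Longrightarrow> continuous_on S (qyy t x)"
proof -
  obtain Ft Fy Fyy where F:
    "\<And>t x y. 0 < t \<Longrightarrow> x \<in> S \<Longrightarrow> y \<in> S \<Longrightarrow> ((\<lambda>u. q u x y) has_real_derivative Ft t x y) (at t)"
    "\<And>t x y. 0 < t \<Longrightarrow> x \<in> S \<Longrightarrow> y \<in> S \<Longrightarrow> ((\<lambda>z. q t x z) has_real_derivative Fy t x y) (at y)"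
    "\<And>t x y. 0 < t \<Longrightarrow> x \<in> S \<Longrightarrow> y \<in> S \<Longrightarrow> ((\<lambda>z. Fy t x z) has_real_derivative Fyy t x y) (at y)"
    "continuous_on ({0<..} \<times> S \<times> S) (\<lambda>(t, x, y). q t x y)"
    "continuous_on ({0<..} \<times> S \<times> S) (\<lambda>(t, x, y). Ft t x y)"
    "continuous_on ({0<..} \<times> S \<times> S) (\<lambda>(t, x, y). Fyy t x y)"
    by (rule q_derivs) (rule that)
  have eq: "qt t x y = Ft t x y" "qy t x y = Fy t x y" if "0 < t" "x \<in> S" "y \<in> S" for t x y
    unfolding qt_def qy_def using F(1,2) that by (auto intro!: DERIV_imp_deriv)
  show "0 < t \<Longrightarrow> x \<in> S \<Longrightarrow> y \<in> S \<Longrightarrow> ((\<lambda>u. q u x y) has_real_derivative qt t x y) (at t)" for t x y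
    using F(1) eq by simp
  show "0 < t \<Longrightarrow> x \<in> S \<Longrightarrow> y \<in> S \<Longrightarrow> (q t x has_real_derivative qy t x y) (at y)" for t x y
    using F(2)[of t x y] eq by simp
  have qyF: "(qy t x has_real_derivative Fyy t x y) (at y)" if "0 < t" "x \<in> S" "y \<in> S" for t x y
    by (rule has_field_derivative_transform_within_open[OF F(3)[OF that] open_S that(3)]) (use eq that in simp)
  then have eq3: "qyy t x y = Fyy t x y" if "0 < t" "x \<in> S" "y \<in> S" for t x y
    unfolding qyy_def using that by (auto intro!: DERIV_imp_deriv)
  show d3: "0 < t \<Longrightarrow> x \<in> S \<Longrightarrow> y \<in> S \<Longrightarrow> (qy t x has_real_derivative qyy t x y) (at y)" for t x y
    using qyF eq3 by simp
  show "continuous_on ({0<..} \<times> S \<times> S) (\<lambda>(t, x, y). qt t x y)"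
    by (rule continuous_on_eq[OF F(5)]) (use eq in auto)
  show "0 < t \<Longrightarrow> x \<in> S \<Longrightarrow> continuous_on S (qy t x)" for t x
    by (auto intro!: continuous_at_imp_continuous_on DERIV_isCont d3)
  show "continuous_on S (qyy t x)" if "0 < t" "x \<in> S"
  proof (rule continuous_on_eq)
    show "continuous_on S (\<lambda>y. case (t, x, y) of (t, x, y) \<Rightarrow> Fyy t x y)"
      by (rule continuous_on_compose2[OF F(6)]) (use that in \<open>auto intro!: continuous_intros\<close>)
  qed (use eq3 that in auto)
qed

lemma continuous_qt_compose:
  assumes "continuous_on A a" "continuous_on A b" "continuous_on A c"
    "\<And>z. z \<in> A \<Longrightarrow> 0 < a z" "\<And>z. z \<in> A \<Longrightarrow> b z \<in> S" "\<And>z. z \<in> A \<Longrightarrow> c z \<in> S"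
  shows "continuous_on A (\<lambda>z. qt (a z) (b z) (c z))"
proof -
  have "continuous_on A (\<lambda>z. (a z, b z, c z))" by (intro continuous_intros assms)
  from continuous_on_compose2[OF density_derivs(4) this] show ?thesis
    using assms(4-6) by (auto simp: image_subset_iff)
qed

text \<open>Symmetry of q turns the backward equation in the first space variable into one in the
  second. Written as a product with rho, it relates rho to two functions already known to be
  continuous.\<close>

lemma forward_equation:
  assumes t: "0 < t" and x: "x \<in> S" and y: "y \<in> S"
  shows "rho y * qt t x y = flux_deriv (qy t x) (qyy t x) y"
proof -
  have sym: "q u z x = q u x z" if "u > 0" "z \<in> S" for u z using density_sym that x by auto
  have "generator s rho (\<lambda>z. q t z x) y = flux_deriv (qy t x) (qyy t x) y / rho y"
  proof (rule generator_eq[OF open_S y y])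
    fix z assume z: "z \<in> S"
    show "((\<lambda>z. q t z x) has_real_derivative qy t x z) (at z)"
      by (rule has_field_derivative_transform_within_open[OF density_derivs(2)[OF t x z] open_S z]) (simp add: sym t)
  qed (rule density_derivs(3)[OF t x y])
  moreover have "deriv (\<lambda>u. q u y x) t = qt t x y"
    by (rule DERIV_imp_deriv, rule has_field_derivative_transform_within_open[OF density_derivs(1)[OF t x y], of "{0<..}"])
      (use t y sym in auto)
  ultimately have "flux_deriv (qy t x) (qyy t x) y / rho y = qt t x y"
    using backward[OF t y x] by simp
  then show ?thesis using speed_pos[OF y] by (simp add: field_simps)
qed

text \<open>
  Where the time derivative of the density does not vanish identically, the forward equation exhibits
  the speed density as a quotient of continuous functions. A point where it vanishes for all times
  would be a starting point from which the law does not change with time, hence equals its limit at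
  time 0, a Dirac mass; but the law has a density.
\<close>

lemma qt_nonzero:
  assumes y: "y \<in> S"
  obtains t x where "0 < t" "x \<in> S" "qt t x y \<noteq> 0"
proof (rule ccontr)
  assume "\<not> thesis"
  then have "\<forall>t x. 0 < t \<longrightarrow> x \<in> S \<longrightarrow> qt t x y = 0" using that by blast
  then have z: "qt t x y = 0" if "0 < t" "x \<in> S" for t x using that by blast
  have const: "q t y x = q 1 y x" if "0 < t" "x \<in> S" for t x
  proof -
    have "\<exists>c. \<forall>u\<in>{0<..}. q u x y = c"
    proof (rule has_field_derivative_zero_constant)
      fix u :: real assume "u \<in> {0<..}"
      then show "((\<lambda>u. q u x y) has_real_derivative 0) (at u within {0<..})"
        using density_derivs(1)[of u x y] z[of u x] that(2) y by (auto intro: has_field_derivative_at_within)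
    qed simp
    then obtain c where "\<And>u. 0 < u \<Longrightarrow> q u x y = c" by auto
    then show ?thesis using density_sym[of t x y] density_sym[of 1 x y] that y by simp
  qed
  have pd_const: "pd t y = pd 1 y" if "0 < t" for t
    by (rule ext) (simp add: pd_def indicator_def const[OF that])
  interpret prob_space "P y" by (rule P_kernel(1)[OF y])
  define A where "A = (\<lambda>n. {z. \<bar>z - y\<bar> \<ge> 1 / real (Suc n)})"
  have A[measurable]: "A n \<in> sets borel" for n unfolding A_def by measurable
  \<comment> \<open>As \<open>pd t y\<close> does not depend on t, the mass away from y at time 1 is
    also the mass at time \<open>1 / (k + 1)\<close> for every k, and the latter tends to
    zero.\<close>
  have "(\<integral>z. pd 1 y z * indicator (A n) z \<partial>lborel) = 0" for n
  proof (rule antisym)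
    let ?r = "1 / real (Suc n)"
    have "(\<integral>z. pd 1 y z * indicator (A n) z \<partial>lborel) \<le>
        prob (hit l (y - ?r) (1 / real (Suc k))) + prob (hit l (y + ?r) (1 / real (Suc k)))" for k
      using far_le_hits[of y y ?r "1 / real (Suc k)"] y pd_const[of "1 / real (Suc k)"]
      by (simp add: A_def del: of_nat_Suc)
    moreover have "(\<lambda>k. prob (hit l (y - ?r) (1 / real (Suc k))) + prob (hit l (y + ?r) (1 / real (Suc k)))) \<longlonglongrightarrow> 0 + 0"
      by (intro tendsto_add hit_tendsto_0 y) (simp_all del: of_nat_Suc)
    ultimately show "(\<integral>z. pd 1 y z * indicator (A n) z \<partial>lborel) \<le> 0"
      by (intro LIMSEQ_le_const) auto
    show "0 \<le> (\<integral>z. pd 1 y z * indicator (A n) z \<partial>lborel)"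
      using pd_nonneg[OF zero_less_one y] by (intro integral_nonneg_AE) auto
  qed
  then have "AE z in lborel. pd 1 y z * indicator (A n) z = 0" for n
  proof (subst integral_nonneg_eq_0_iff_AE[symmetric])
    show "integrable lborel (\<lambda>z. pd 1 y z * indicator (A n) z)"
      using pd_integral(1)[OF zero_less_one y] by (rule integrable_real_mult_indicator[rotated]) simp
  qed (use pd_nonneg[OF zero_less_one y] in auto)
  then have "AE z in lborel. \<forall>n. pd 1 y z * indicator (A n) z = 0" unfolding AE_all_countable by blast
  moreover have "AE z in lborel. z \<noteq> y" by (rule AE_lborel_singleton)
  ultimately have "AE z in lborel. pd 1 y z = 0"
  proof eventually_elim
    fix z assume z: "\<forall>n. pd 1 y z * indicator (A n) z = 0" "z \<noteq> y"
    obtain n where "1 / real (Suc n) < \<bar>z - y\<bar>"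
      using nat_approx_posE[of "\<bar>z - y\<bar>"] z(2) by (metis zero_less_abs_iff right_minus_eq)
    then have "z \<in> A n" by (simp add: A_def)
    then show "pd 1 y z = 0" using z(1)[rule_format, of n] by simp
  qed
  then have "(\<integral>z. pd 1 y z \<partial>lborel) = 0" by (rule integral_eq_zero_AE)
  then show False using pd_integral(2)[OF zero_less_one y] by simp
qed

text \<open>Continuity bounds the generator of a test function on its support and turns the
  integrals over compact intervals into integrals of continuous functions.\<close>

lemma continuous_rho: "continuous_on S rho"
proof (rule continuous_at_imp_continuous_on, rule ballI)
  fix y assume y: "y \<in> S"
  obtain t x where tx: "0 < t" "x \<in> S" "qt t x y \<noteq> 0" using qt_nonzero[OF y] .
  have c: "continuous_on S (\<lambda>z. qt t x z)"
    by (intro continuous_qt_compose continuous_intros) (use tx in auto)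
  have "continuous_on S (flux_deriv (qy t x) (qyy t x))"
    by (intro continuous_flux_deriv density_derivs tx) auto
  then have F: "isCont (flux_deriv (qy t x) (qyy t x)) y" and Q: "isCont (\<lambda>z. qt t x z) y"
    using c y by (auto simp: continuous_on_eq_continuous_at[OF open_S])
  have lim: "isCont (\<lambda>z. flux_deriv (qy t x) (qyy t x) z / qt t x z) y"
    using F Q tx(3) by (intro continuous_intros)
  have "eventually (\<lambda>z. qt t x z \<noteq> 0) (nhds y)"
    using Q tx(3) unfolding isCont_def tendsto_at_iff_tendsto_nhds by (intro tendsto_imp_eventually_ne)
  moreover have "eventually (\<lambda>z. z \<in> S) (nhds y)" using y open_S eventually_nhds by blast
  ultimately have "eventually (\<lambda>z. flux_deriv (qy t x) (qyy t x) z / qt t x z = rho z) (nhds y)"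
    by eventually_elim (use forward_equation[OF tx(1,2)] in \<open>auto simp: field_simps\<close>)
  then show "isCont rho y" using lim by (simp add: isCont_cong)
qed

end

section \<open>Expectations of smooth functions\<close>

context linear_diffusion
begin

lemma expectation_compact_support:
  assumes t: "0 < t" and z: "z \<in> S" and sub: "{a..b} \<subseteq> S"
    and g: "continuous_on {a..b} g" "\<And>y. y \<notin> {a..b} \<Longrightarrow> g y = 0"
  shows "(\<integral>y. pd t z y * g y \<partial>lborel) = integral {a..b} (\<lambda>y. q t z y * rho y * g y)"
proof -
  have "(\<integral>y. pd t z y * g y \<partial>lborel) = (\<integral>y. indicator {a..b} y * (q t z y * rho y * g y) \<partial>lborel)"
    using sub g(2) by (intro Bochner_Integration.integral_cong) (auto simp: pd_def indicator_def)
  also have "\<dots> = integral {a..b} (\<lambda>y. q t z y * rho y * g y)"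
    by (intro lborel_integral_Icc continuous_intros continuous_q_compose g continuous_on_subset[OF continuous_rho sub])
      (use t z sub in auto)
  finally show ?thesis .
qed

lemma generator_limit:
  assumes g: "C2_with g g1 g2" "\<And>y. \<bar>y - c\<bar> \<ge> r \<Longrightarrow> g y = 0" and sub: "{c - r..c + r} \<subseteq> S" "0 < r"
    and z: "z \<in> S"
  shows "((\<lambda>h. ((\<integral>y. pd h z y * g y \<partial>lborel) - g z) / h) \<longlongrightarrow> flux_deriv g1 g2 z / rho z) (at_right 0)"
proof -
  have lim: "((\<lambda>t. ((\<integral>\<omega>. g (\<omega> t) \<partial>P z) - g z) / t) \<longlongrightarrow> generator s rho g z) (at_right 0)"
    by (rule generator[OF C2_with_imp_C2_on(1)[OF g(1)] _ _ z, of "c - r" "c + r"])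
      (use g(2) sub in \<open>auto simp: abs_le_iff\<close>)
  have eq: "generator s rho g z = flux_deriv g1 g2 z / rho z"
    by (rule generator_eq[OF open_UNIV _ z]) (use C2_withD[OF g(1)] in auto)
  have "\<forall>\<^sub>F t in at_right 0. ((\<integral>\<omega>. g (\<omega> t) \<partial>P z) - g z) / t = ((\<integral>y. pd t z y * g y \<partial>lborel) - g z) / t"
    using eventually_at_right_less[of 0]
    by eventually_elim (use z borel_measurable_continuous_onI[OF C2_withD(3)[OF g(1)]] in \<open>simp add: expectation\<close>)
  from Lim_transform_eventually[OF lim this] show ?thesis by (simp only: eq)
qed

text \<open>Dynkin's formula in differentiated form. The time derivative falls on q, becomes a space
  derivative by the forward equation, and is moved onto g by Green's formula; the boundary terms
  vanish because g and its derivative do.\<close>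

lemma expectation_derivative:
  assumes g: "C2_with g g1 g2" "\<And>y. \<bar>y - c\<bar> \<ge> r \<Longrightarrow> g y = 0" and sub: "{c - r..c + r} \<subseteq> S" "0 < r"
    and z: "z \<in> S" and t: "0 < t"
  shows "((\<lambda>t. \<integral>y. pd t z y * g y \<partial>lborel) has_real_derivative
    (\<integral>y. pd t z y * (flux_deriv g1 g2 y / rho y) \<partial>lborel)) (at t)"
proof -
  let ?I = "{c - r..c + r}"
  note gd = C2_withD[OF g(1)]
  have out: "g y = 0" "g1 y = 0" "g2 y = 0" if "y \<notin> {c - r<..<c + r}" for y
    using g(2)[of y] C2_with_zero_outside[OF g(1), of r c y] g(2) that by (auto simp: abs_le_iff not_less)
  have cg: "continuous_on A g" "continuous_on A g1" "continuous_on A g2" for A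
    using gd by (auto intro: continuous_on_subset)
  have crho: "continuous_on ?I rho" by (rule continuous_on_subset[OF continuous_rho sub(1)])
  have ic: "c - r \<le> c + r" using sub(2) by simp
  have "((\<lambda>t. integral (cbox (c - r) (c + r)) (\<lambda>y. q t z y * rho y * g y)) has_field_derivative
      integral (cbox (c - r) (c + r)) (\<lambda>y. qt t z y * rho y * g y)) (at t within {0<..})"
  proof (rule leibniz_rule_field_derivative)
    fix u y :: real assume uy: "u \<in> {0<..}" "y \<in> cbox (c - r) (c + r)"
    then have y: "y \<in> S" using sub by auto
    have "((\<lambda>u. q u z y) has_real_derivative qt u z y) (at u within {0<..})"
      using density_derivs(1)[of u z y] uy z y by (auto intro: has_field_derivative_at_within)
    then show "((\<lambda>u. q u z y * rho y * g y) has_real_derivative qt u z y * rho y * g y) (at u within {0<..})"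
      by (intro DERIV_cmult_right)
  next
    fix u :: real assume "u \<in> {0<..}"
    then have "continuous_on ?I (\<lambda>y. q u z y * rho y * g y)"
      by (intro continuous_intros continuous_q_compose crho cg) (use z sub in auto)
    then show "(\<lambda>y. q u z y * rho y * g y) integrable_on cbox (c - r) (c + r)"
      by (simp add: integrable_continuous_real)
  next
    have "continuous_on ({0<..} \<times> ?I) (\<lambda>p. qt (fst p) z (snd p))"
      by (rule continuous_qt_compose) (use z sub in \<open>auto intro!: continuous_intros\<close>)
    moreover have "continuous_on ({0<..} \<times> ?I) (\<lambda>p::real \<times> real. rho (snd p))"
      by (rule continuous_on_compose2[OF crho]) (auto intro!: continuous_intros)
    moreover have "continuous_on ({0<..} \<times> ?I) (\<lambda>p::real \<times> real. g (snd p))"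
      by (rule continuous_on_compose2[OF cg(1)[of UNIV]]) (auto intro!: continuous_intros)
    ultimately have "continuous_on ({0<..} \<times> ?I) (\<lambda>p. qt (fst p) z (snd p) * rho (snd p) * g (snd p))"
      by (rule continuous_on_mult[OF continuous_on_mult])
    then show "continuous_on ({0<..} \<times> cbox (c - r) (c + r)) (\<lambda>(u, y). qt u z y * rho y * g y)"
      by (simp add: case_prod_beta)
  qed (use t in auto)
  moreover have "(at t within {0<..}) = at t" by (rule at_within_open) (use t in auto)
  ultimately have D: "((\<lambda>t. integral ?I (\<lambda>y. q t z y * rho y * g y)) has_real_derivative
      integral ?I (\<lambda>y. qt t z y * rho y * g y)) (at t)" by simp
  have "integral ?I (\<lambda>y. qt t z y * rho y * g y) = integral ?I (\<lambda>y. g y * flux_deriv (qy t z) (qyy t z) y)"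
  proof (rule integral_cong)
    fix y assume "y \<in> ?I"
    then have "y \<in> S" using sub by auto
    from forward_equation[OF t z this] show "qt t z y * rho y * g y = g y * flux_deriv (qy t z) (qyy t z) y"
      by (simp add: mult_ac)
  qed
  also have "\<dots> = integral ?I (\<lambda>y. q t z y * flux_deriv g1 g2 y)"
  proof -
    have "integral ?I (\<lambda>y. g y * flux_deriv (qy t z) (qyy t z) y) - integral ?I (\<lambda>y. q t z y * flux_deriv g1 g2 y) =
      (g (c + r) * qy t z (c + r) / deriv s (c + r) - q t z (c + r) * g1 (c + r) / deriv s (c + r)) -
      (g (c - r) * qy t z (c - r) / deriv s (c - r) - q t z (c - r) * g1 (c - r) / deriv s (c - r))"
    proof (rule green[OF ic sub(1)])
      show "continuous_on ?I g2" by (rule cg)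
      show "continuous_on ?I (qyy t z)" by (rule continuous_on_subset[OF density_derivs(6)[OF t z] sub(1)])
      fix y assume "y \<in> ?I"
      then have y: "y \<in> S" using sub(1) by blast
      show "(g has_real_derivative g1 y) (at y within ?I)" "(g1 has_real_derivative g2 y) (at y within ?I)"
        by (rule has_field_derivative_at_within, rule gd)+
      show "(q t z has_real_derivative qy t z y) (at y within ?I)"
        "(qy t z has_real_derivative qyy t z y) (at y within ?I)"
        by (rule has_field_derivative_at_within, rule density_derivs(2,3)[OF t z y])+
    qed
    then show ?thesis using out by simp
  qed
  also have "\<dots> = integral ?I (\<lambda>y. q t z y * rho y * (flux_deriv g1 g2 y / rho y))"
    by (rule integral_cong) (use sub speed_pos in force)
  also have "\<dots> = (\<integral>y. pd t z y * (flux_deriv g1 g2 y / rho y) \<partial>lborel)"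
  proof (rule expectation_compact_support[OF t z sub(1), symmetric])
    show "continuous_on ?I (\<lambda>y. flux_deriv g1 g2 y / rho y)"
      by (intro continuous_on_divide continuous_flux_deriv crho cg sub) (use sub speed_pos in force)
    show "flux_deriv g1 g2 y / rho y = 0" if "y \<notin> ?I" for y
      using out[of y] that by (auto simp: flux_deriv_def)
  qed
  finally have E: "integral ?I (\<lambda>y. qt t z y * rho y * g y) = (\<integral>y. pd t z y * (flux_deriv g1 g2 y / rho y) \<partial>lborel)" .
  show ?thesis
    unfolding E[symmetric]
  proof (rule has_field_derivative_transform_within_open[OF D, of "{0<..}"])
    show "integral ?I (\<lambda>y. q u z y * rho y * g y) = (\<integral>y. pd u z y * g y \<partial>lborel)" if "u \<in> {0<..}" for u
      by (rule expectation_compact_support[symmetric, OF _ z sub(1) cg(1)]) (use that out(1) in auto)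
  qed (use t in auto)
qed

text \<open>The limit defining the generator is only pointwise in z. Uniformity comes from the time
  derivative: it is the expectation of the generator applied to g, hence bounded by a supremum that
  depends on neither z nor t.\<close>

lemma dynkin_bound:
  assumes g: "C2_with g g1 g2" "\<And>y. \<bar>y - c\<bar> \<ge> r \<Longrightarrow> g y = 0" and sub: "{c - r..c + r} \<subseteq> S" "0 < r"
  obtains C where "0 \<le> C" "\<And>z h. z \<in> S \<Longrightarrow> 0 < h \<Longrightarrow> \<bar>(\<integral>y. pd h z y * g y \<partial>lborel) - g z\<bar> \<le> C * h"
proof -
  let ?I = "{c - r..c + r}" and ?\<kappa> = "\<lambda>y. flux_deriv g1 g2 y / rho y"
  have "continuous_on ?I ?\<kappa>"
    by (intro continuous_on_divide continuous_flux_deriv continuous_on_subset[OF continuous_rho] sub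
        continuous_on_subset[OF C2_withD(4)[OF g(1)]] continuous_on_subset[OF C2_withD(5)[OF g(1)]])
      (use sub speed_pos in force)+
  then have "bounded (?\<kappa> ` ?I)" by (intro compact_imp_bounded compact_continuous_image) auto
  then obtain C where C: "0 < C" "\<And>y. y \<in> ?I \<Longrightarrow> \<bar>?\<kappa> y\<bar> \<le> C"
    unfolding bounded_pos by auto
  have C': "\<bar>?\<kappa> y\<bar> \<le> C" for y
  proof (cases "y \<in> ?I")
    case False
    then have "g1 y = 0" "g2 y = 0" using C2_with_zero_outside[OF g(1), of r c y] g(2) by (auto simp: abs_le_iff not_le)
    then show ?thesis using C(1) by (simp add: flux_deriv_def)
  qed (rule C(2))
  have "\<bar>(\<integral>y. pd h z y * g y \<partial>lborel) - g z\<bar> \<le> C * h" if z: "z \<in> S" and h: "0 < h" for z h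
  proof -
    define \<Psi> where "\<Psi> = (\<lambda>t. \<integral>y. pd t z y * g y \<partial>lborel)"
    \<comment> \<open>A convergent difference quotient forces \<open>\<Psi> t\<close> to tend to
      \<open>g z\<close>. This supplies the initial value: \<open>\<Psi>\<close> is differentiated
      at positive times only, so the mean value inequality is used from \<open>e > 0\<close> on, and
      then e tends to 0.\<close>
    have "((\<lambda>t. (\<Psi> t - g z) / t * t) \<longlongrightarrow> ?\<kappa> z * 0) (at_right 0)"
      unfolding \<Psi>_def by (intro tendsto_mult generator_limit[OF g sub z] tendsto_ident_at)
    then have "((\<lambda>t. (\<Psi> t - g z) / t * t) \<longlongrightarrow> 0) (at_right 0)" by simp
    then have "((\<lambda>t. \<Psi> t - g z) \<longlongrightarrow> 0) (at_right 0)"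
      by (rule Lim_transform_eventually) (auto simp: eventually_at_filter)
    then have lim: "(\<Psi> \<longlongrightarrow> g z) (at_right 0)" by (simp add: LIM_zero_cancel)
    have "\<bar>\<Psi> h - g z\<bar> \<le> C * (h - 0)"
    proof (rule tendsto_le[OF _ _ _ ])
      show "((\<lambda>e. C * (h - e)) \<longlongrightarrow> C * (h - 0)) (at_right 0)" by (intro tendsto_intros)
      show "((\<lambda>e. \<bar>\<Psi> h - \<Psi> e\<bar>) \<longlongrightarrow> \<bar>\<Psi> h - g z\<bar>) (at_right 0)" by (intro tendsto_intros lim)
      show "\<forall>\<^sub>F e in at_right 0. \<bar>\<Psi> h - \<Psi> e\<bar> \<le> C * (h - e)"
        using eventually_at_right_real[OF h]
      proof eventually_elim
        fix e assume e: "e \<in> {0<..<h}"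
        have "norm (\<Psi> h - \<Psi> e) \<le> C * norm (h - e)"
        proof (rule field_differentiable_bound[of "{0<..}"])
          fix t :: real assume "t \<in> {0<..}"
          then have t: "0 < t" by simp
          show "(\<Psi> has_field_derivative (\<integral>y. pd t z y * ?\<kappa> y \<partial>lborel)) (at t within {0<..})"
            unfolding \<Psi>_def using expectation_derivative[OF g sub z t] by (rule has_field_derivative_at_within)
          show "norm (\<integral>y. pd t z y * ?\<kappa> y \<partial>lborel) \<le> C"
            unfolding real_norm_def by (rule expectation_le[OF t z C'])
        qed (use e h in auto)
        then show "\<bar>\<Psi> h - \<Psi> e\<bar> \<le> C * (h - e)" using e by simp
      qed
    qed simp
    then show ?thesis by (simp add: \<Psi>_def)
  qed
  then show thesis using that[of C] C(1) by auto
qed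

text \<open>The semigroup is symmetric with respect to the speed measure. Compact supports make the
  kernel bounded on a bounded rectangle, so that Fubini applies. F is only bounded and measurable,
  as it will be a truncation of H.\<close>

lemma symmetric_integral:
  assumes h: "0 < h" and sub: "{a..b} \<subseteq> S" "{a'..b'} \<subseteq> S"
    and g: "continuous_on UNIV g" "\<And>y. y \<notin> {a..b} \<Longrightarrow> g y = 0"
    and F: "F \<in> borel_measurable borel" "\<And>y. \<bar>F y\<bar> \<le> M" "\<And>y. y \<notin> {a'..b'} \<Longrightarrow> F y = 0"
  shows "(\<integral>y. indicator S y * rho y * g y * (\<integral>z. pd h y z * F z \<partial>lborel) \<partial>lborel) =
    (\<integral>z. indicator S z * rho z * F z * (\<integral>y. pd h z y * g y \<partial>lborel) \<partial>lborel)"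
proof -
  let ?A = "{a..b} :: real set" and ?B = "{a'..b'} :: real set"
  define K where "K = (\<lambda>y z. indicator S y * rho y * g y * (pd h y z * F z))"
  have Keq: "K y z = indicator (?A \<times> ?B) (y, z) * q h y z * (indicator S y * rho y) * g y * (indicator S z * rho z) * F z" for y z
    using g(2)[of y] F(3)[of z] sub by (auto simp: K_def pd_def indicator_def)
  have "continuous_on (?A \<times> ?B) (\<lambda>p. q h (fst p) (snd p))"
    by (intro continuous_q_compose continuous_intros) (use h sub in auto)
  from borel_measurable_continuous_on_indicator[OF _ this]
  have qm: "(\<lambda>p. indicator (?A \<times> ?B) p * q h (fst p) (snd p)) \<in> borel_measurable borel"
    by (simp add: borel_closed closed_Times)
  have bq: "bounded ((\<lambda>p. q h (fst p) (snd p)) ` (?A \<times> ?B))"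
    using \<open>continuous_on (?A \<times> ?B) (\<lambda>p. q h (fst p) (snd p))\<close>
    by (intro compact_imp_bounded compact_continuous_image compact_Times) auto
  then obtain C1 where C1: "0 < C1" "\<And>y z. y \<in> ?A \<Longrightarrow> z \<in> ?B \<Longrightarrow> \<bar>q h y z\<bar> \<le> C1"
    unfolding bounded_pos by force
  have "bounded ((\<lambda>y. rho y * g y) ` ?A)"
    by (intro compact_imp_bounded compact_continuous_image continuous_intros
        continuous_on_subset[OF continuous_rho] continuous_on_subset[OF g(1)] sub) auto
  then obtain C2 where C2: "0 < C2" "\<And>y. y \<in> ?A \<Longrightarrow> \<bar>rho y * g y\<bar> \<le> C2"
    unfolding bounded_pos by force
  have "bounded (rho ` ?B)"
    by (intro compact_imp_bounded compact_continuous_image continuous_on_subset[OF continuous_rho] sub) auto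
  then obtain C3 where C3: "0 < C3" "\<And>z. z \<in> ?B \<Longrightarrow> \<bar>rho z\<bar> \<le> C3"
    unfolding bounded_pos by force
  have gm: "g \<in> borel_measurable borel" by (rule borel_measurable_continuous_onI[OF g(1)])
  have int: "integrable (lborel \<Otimes>\<^sub>M lborel) (case_prod K)"
    unfolding lborel_prod
  proof (rule integrableI_bounded_set[where A="?A \<times> ?B" and B="C1 * C2 * (C3 * M)"])
    show "?A \<times> ?B \<in> sets lborel" by (simp add: borel_closed closed_Times)
    show "emeasure lborel (?A \<times> ?B) < \<infinity>"
      by (intro emeasure_bounded_finite bounded_Times) auto
    have "case_prod K = (\<lambda>p. (indicator (?A \<times> ?B) p * q h (fst p) (snd p)) *
        (indicator S (fst p) * rho (fst p)) * g (fst p) * (indicator S (snd p) * rho (snd p)) * F (snd p))"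
      by (auto simp: Keq fun_eq_iff)
    also have "\<dots> \<in> borel_measurable borel"
      by (intro borel_measurable_times qm measurable_compose[OF _ rho_measurable]
          measurable_compose[OF _ gm] measurable_compose[OF _ F(1)] borel_measurable_continuous_onI continuous_intros)
    finally show "case_prod K \<in> borel_measurable lborel" by simp
    show "AE p in lborel. p \<in> ?A \<times> ?B \<longrightarrow> norm (case_prod K p) \<le> C1 * C2 * (C3 * M)"
    proof (intro AE_I2 impI)
      fix p assume "p \<in> ?A \<times> ?B"
      then obtain y z where p: "p = (y, z)" "y \<in> ?A" "z \<in> ?B" by auto
      have "norm (K y z) = \<bar>q h y z\<bar> * \<bar>rho y * g y\<bar> * (\<bar>rho z\<bar> * \<bar>F z\<bar>)"
        using p subsetD[OF sub(1), of y] subsetD[OF sub(2), of z] by (simp add: Keq abs_mult)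
      also have "\<dots> \<le> C1 * C2 * (C3 * M)"
        using C1 C2 C3 F(2)[of z] p by (intro mult_mono) auto
      finally show "norm (case_prod K p) \<le> C1 * C2 * (C3 * M)" using p by simp
    qed
    show "AE p in lborel. p \<notin> ?A \<times> ?B \<longrightarrow> case_prod K p = 0"
      by (intro AE_I2 impI) (auto simp: Keq indicator_def split: prod.splits)
  qed
  have "(\<integral>y. indicator S y * rho y * g y * (\<integral>z. pd h y z * F z \<partial>lborel) \<partial>lborel) = (\<integral>y. \<integral>z. K y z \<partial>lborel \<partial>lborel)"
    by (simp add: K_def)
  also have "\<dots> = (\<integral>z. \<integral>y. K y z \<partial>lborel \<partial>lborel)"
    using lborel_pair.Fubini_integral[OF int] by simp
  also have "\<dots> = (\<integral>z. indicator S z * rho z * F z * (\<integral>y. pd h z y * g y \<partial>lborel) \<partial>lborel)"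
  proof (rule Bochner_Integration.integral_cong[OF refl])
    fix z
    have "(\<integral>y. K y z \<partial>lborel) = (\<integral>y. indicator S z * rho z * F z * (pd h z y * g y) \<partial>lborel)"
      by (rule Bochner_Integration.integral_cong[OF refl])
        (use density_sym[OF h] in \<open>auto simp: K_def pd_def indicator_def\<close>)
    then show "(\<integral>y. K y z \<partial>lborel) = indicator S z * rho z * F z * (\<integral>y. pd h z y * g y \<partial>lborel)" by simp
  qed
  finally show ?thesis .
qed

end

section \<open>Passage below a moving curve\<close>

lemma C2_with_locally_const:
  assumes u: "C2_with u u1 u2" and T: "open T" "y \<in> T" and const: "\<And>z. z \<in> T \<Longrightarrow> u z = k"
  shows "u1 y = 0" "u2 y = 0"
proof -
  note d = C2_withD[OF u]
  have 1: "u1 z = 0" if "z \<in> T" for z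
  proof (rule DERIV_unique[OF d(1)])
    show "(u has_real_derivative 0) (at z)"
      by (rule has_field_derivative_transform_within_open[of "\<lambda>_. k" _ _ T]) (use that T const in auto)
  qed
  then show "u1 y = 0" using T by blast
  show "u2 y = 0"
  proof (rule DERIV_unique[OF d(2)])
    show "(u1 has_real_derivative 0) (at y)"
      by (rule has_field_derivative_transform_within_open[of "\<lambda>_. 0" _ _ T]) (use T 1 in auto)
  qed
qed

lemma dominated_convergence_at_right:
  fixes s :: "real \<Rightarrow> 'a \<Rightarrow> real"
  assumes b: "0 < b" and f: "f \<in> borel_measurable M" and s: "\<And>h. 0 < h \<Longrightarrow> h < b \<Longrightarrow> s h \<in> borel_measurable M"
    and w: "integrable M w" and lim: "AE x in M. ((\<lambda>h. s h x) \<longlongrightarrow> f x) (at_right 0)"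
    and bound: "\<And>h. 0 < h \<Longrightarrow> h < b \<Longrightarrow> AE x in M. \<bar>s h x\<bar> \<le> w x"
  shows "((\<lambda>h. integral\<^sup>L M (s h)) \<longlongrightarrow> integral\<^sup>L M f) (at_right 0)"
proof (rule tendsto_at_right_sequentially[OF b])
  fix X :: "nat \<Rightarrow> real"
  assume X: "\<And>n. 0 < X n" "\<And>n. X n < b" "decseq X" "X \<longlonglongrightarrow> 0"
  have X0: "filterlim X (at_right 0) sequentially"
    unfolding filterlim_at using X(4) X(1) by (auto simp: less_imp_neq[THEN not_sym])
  show "(\<lambda>n. integral\<^sup>L M (s (X n))) \<longlonglongrightarrow> integral\<^sup>L M f"
  proof (rule integral_dominated_convergence[OF f _ w])
    show "AE x in M. (\<lambda>n. s (X n) x) \<longlonglongrightarrow> f x"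
      using lim by eventually_elim (rule filterlim_compose[OF _ X0])
  qed (use X s bound in auto)
qed

context linear_diffusion
begin

lemma integrable_pd:
  fixes F :: "real \<Rightarrow> real"
  assumes t: "0 < t" and x: "x \<in> S" and F: "F \<in> borel_measurable borel" "\<And>y. \<bar>F y\<bar> \<le> C"
  shows "integrable lborel (\<lambda>y. pd t x y * F y)"
proof -
  interpret prob_space "P x" by (rule P_kernel(1)[OF x])
  have "integrable (P x) (\<lambda>\<omega>. F (\<omega> t))"
  proof (rule integrable_const_bound)
    show "(\<lambda>\<omega>. F (\<omega> t)) \<in> borel_measurable (P x)"
      by (rule measurable_compose[OF eval_measurable[OF x less_imp_le[OF t]] F(1)])
  qed (use F(2) in auto)
  then show ?thesis using expectation(2)[OF t x F(1)] by simp
qed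

text \<open>On its way from the inner interval to distance r2, a path crosses the inner end point on
  that side before the outer one. The two inner end points are therefore the worst starting points,
  and the bound is uniform in y.\<close>

lemma escape_bound:
  assumes r: "0 < r1" "r1 < r2" and sub: "{c - r2..c + r2} \<subseteq> S"
  obtains K where "((\<lambda>h. K h / h) \<longlongrightarrow> 0) (at_right 0)"
    "\<And>y h. y \<in> S \<Longrightarrow> \<bar>y - c\<bar> \<le> r1 \<Longrightarrow> 0 < h \<Longrightarrow> (\<integral>z. pd h y z * indicator {z. \<bar>z - c\<bar> \<ge> r2} z \<partial>lborel) \<le> K h"
proof -
  define K where "K = (\<lambda>h. measure (P (c - r1)) (hit l (c - r2) h) + measure (P (c + r1)) (hit l (c + r2) h))"
  have inS: "c - r1 \<in> S" "c + r1 \<in> S" "c - r2 \<in> S" "c + r2 \<in> S" using r sub by auto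
  have "((\<lambda>h. measure (P (c - r1)) (hit l (c - r2) h) / h + measure (P (c + r1)) (hit l (c + r2) h) / h) \<longlongrightarrow> 0 + 0) (at_right 0)"
    by (intro tendsto_add hit_decay inS) (use r in auto)
  then have 1: "((\<lambda>h. K h / h) \<longlongrightarrow> 0) (at_right 0)" by (simp add: K_def add_divide_distrib)
  have 2: "(\<integral>z. pd h y z * indicator {z. \<bar>z - c\<bar> \<ge> r2} z \<partial>lborel) \<le> K h"
    if y: "y \<in> S" "\<bar>y - c\<bar> \<le> r1" and h: "0 < h" for y h
  proof -
    have yc: "c - r1 \<le> y" "y \<le> c + r1" using y(2) by auto
    have "(\<integral>z. pd h y z * indicator {z. \<bar>z - c\<bar> \<ge> r2} z \<partial>lborel) \<le>
        measure (P y) (hit l (c - r2) h) + measure (P y) (hit l (c + r2) h)"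
      by (rule far_le_hits) (use y h r in auto)
    also have "\<dots> \<le> K h"
      unfolding K_def using y(1) yc h r inS by (intro add_mono hit_through) auto
    finally show ?thesis .
  qed
  show thesis by (rule that[OF 1 2])
qed

end

text \<open>
  The witnesses \<open>Ht\<close>, \<open>Hy\<close>, \<open>Hyy\<close> of \<^const>\<open>C12_on\<close> are parameters: on the curve itself they
  are one-sided, so they cannot be written as \<^const>\<open>deriv\<close> of \<open>H\<close>.
\<close>

locale curve_passage = linear_diffusion +
  fixes f :: "real \<Rightarrow> real" and H Ht Hy Hyy :: "real \<Rightarrow> real \<Rightarrow> real"
  assumes f_range: "\<And>t. t \<ge> 0 \<Longrightarrow> f t \<in> einterval l \<infinity>"
    and f_cont: "continuous_on {0..} f"
    and f_below: "\<And>x. x \<in> einterval l \<infinity> \<Longrightarrow> AE \<omega> in P x. ends_below f \<omega>"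
    and H_def: "H = (\<lambda>t y. measure (P y)
      {\<omega> \<in> space (P y). first_passage (\<lambda>u. f (t + u)) \<omega> = \<infinity>})"
    and Ht: "\<And>t y. (t, y) \<in> below_curve l f \<Longrightarrow>
      ((\<lambda>u. H u y) has_real_derivative Ht t y) (at t within {u. (u, y) \<in> below_curve l f})"
    and Hy: "\<And>t y. (t, y) \<in> below_curve l f \<Longrightarrow>
      (H t has_real_derivative Hy t y) (at y within {z. (t, z) \<in> below_curve l f})"
    and Hyy: "\<And>t y. (t, y) \<in> below_curve l f \<Longrightarrow>
      (Hy t has_real_derivative Hyy t y) (at y within {z. (t, z) \<in> below_curve l f})"
    and continuous_Ht: "continuous_on (below_curve l f) (\<lambda>(t, y). Ht t y)"
    and continuous_Hy: "continuous_on (below_curve l f) (\<lambda>(t, y). Hy t y)"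
    and continuous_Hyy: "continuous_on (below_curve l f) (\<lambda>(t, y). Hyy t y)"
begin

section \<open>The probability of remaining below the curve\<close>

lemma in_below_curve: "(t, y) \<in> below_curve l f \<longleftrightarrow> 0 < t \<and> y \<in> S \<and> y \<le> f t"
  by (simp add: below_curve_def)

lemma f_shift_cont:
  assumes "0 \<le> t"
  shows "continuous_on {0..} (\<lambda>u. f (t + u))"
  by (rule continuous_on_compose2[OF f_cont]) (use assms in \<open>auto intro!: continuous_intros\<close>)

text \<open>The clock of the path starts when the curve is at time t. Before the elapsed time h the
  path is unrestricted and may cross the curve; from h on it must avoid it.\<close>

definition below_after :: "real \<Rightarrow> real \<Rightarrow> (real \<Rightarrow> real) set" where
  "below_after t h = {\<omega> \<in> \<Omega>. \<omega> h < f (t + h) \<and> (\<forall>u\<ge>h. \<omega> u \<noteq> f (t + u))}"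

definition U :: "real \<Rightarrow> real \<Rightarrow> real \<Rightarrow> real" where
  "U t h y = indicator S y * measure (P y) (below_after t h)"

text \<open>The probability of staying strictly below the curve for ever. It agrees with H in S up
  to and including the curve, where H vanishes.\<close>

definition H0 :: "real \<Rightarrow> real \<Rightarrow> real" where
  "H0 t y = (if y \<in> S \<and> y < f t then H t y else 0)"

definition hit_curve :: "real \<Rightarrow> real \<Rightarrow> (real \<Rightarrow> real) set" where
  "hit_curve t h = {\<omega> \<in> \<Omega>. \<exists>u\<in>{0..h}. \<omega> u = f (t + u)}"

lemma below_after_measurable:
  assumes "0 \<le> t" "0 \<le> h"
  shows "below_after t h \<in> sets (path_space l)"
proof -
  have [measurable]: "(\<lambda>\<omega>. \<omega> h) \<in> borel_measurable (path_space l)" by (rule measurable_path_eval[OF assms(2)])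
  have "{\<omega> \<in> \<Omega>. \<omega> h < f (t + h)} \<in> sets (path_space l)" by measurable
  moreover have "{\<omega> \<in> \<Omega>. \<forall>u\<ge>h. \<omega> u \<noteq> f (t + u)} \<in> sets (path_space l)"
    by (rule no_hit_after_measurable[OF assms(2)], rule continuous_on_subset[OF f_shift_cont[OF assms(1)]])
      (use assms in auto)
  ultimately have "{\<omega> \<in> \<Omega>. \<omega> h < f (t + h)} \<inter> {\<omega> \<in> \<Omega>. \<forall>u\<ge>h. \<omega> u \<noteq> f (t + u)} \<in> sets (path_space l)" by blast
  also have "{\<omega> \<in> \<Omega>. \<omega> h < f (t + h)} \<inter> {\<omega> \<in> \<Omega>. \<forall>u\<ge>h. \<omega> u \<noteq> f (t + u)} = below_after t h"
    by (auto simp: below_after_def)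
  finally show ?thesis .
qed

lemma hit_curve_measurable:
  assumes "0 \<le> t"
  shows "hit_curve t h \<in> sets (path_space l)"
  unfolding hit_curve_def
proof (rule hit_set_measurable)
  show "continuous_on {0..h} \<omega>" if "\<omega> \<in> \<Omega>" for \<omega>
    by (rule continuous_on_subset[OF path_spaceD(1)[OF that]]) auto
  show "continuous_on {0..h} (\<lambda>u. f (t + u))"
    by (rule continuous_on_subset[OF f_shift_cont[OF assms]]) auto
qed (auto intro: measurable_path_eval)

lemma U_measurable: "0 \<le> t \<Longrightarrow> 0 \<le> h \<Longrightarrow> U t h \<in> borel_measurable borel"
  unfolding U_def by (rule P_measure_measurable[OF below_after_measurable])

lemma U_bounds: "0 \<le> U t h y" "U t h y \<le> 1"
  using prob_space.prob_le_1[OF P_kernel(1)] by (auto simp: U_def indicator_def)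

lemma H_eq:
  assumes "0 \<le> t" "y \<in> S"
  shows "H t y = measure (P y) {\<omega> \<in> \<Omega>. \<forall>u\<ge>0. \<omega> u \<noteq> f (t + u)}"
  unfolding H_def P_kernel(3)[OF assms(2)]
  using first_passage_eq_infinity_iff[OF path_spaceD(1) f_shift_cont[OF assms(1)]]
  by (intro arg_cong[where f="measure (P y)"]) auto

lemma U_zero:
  assumes t: "0 \<le> t"
  shows "U t 0 y = H0 t y"
proof (cases "y \<in> S")
  case y: True
  interpret prob_space "P y" by (rule P_kernel(1)[OF y])
  have m: "{\<omega> \<in> \<Omega>. \<forall>u\<ge>0. \<omega> u \<noteq> f (t + u)} \<in> sets (path_space l)"
    by (rule no_hit_after_measurable[OF _ f_shift_cont[OF t]]) simp
  show ?thesis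
  proof (cases "y < f t")
    case True
    have "measure (P y) (below_after t 0) = measure (P y) {\<omega> \<in> \<Omega>. \<forall>u\<ge>0. \<omega> u \<noteq> f (t + u)}"
    proof (rule measure_eq_AE)
      show "AE \<omega> in P y. \<omega> \<in> below_after t 0 \<longleftrightarrow> \<omega> \<in> {\<omega> \<in> \<Omega>. \<forall>u\<ge>0. \<omega> u \<noteq> f (t + u)}"
        using AE_start[OF y] by eventually_elim (use True in \<open>auto simp: below_after_def\<close>)
    qed (use m below_after_measurable t in \<open>auto simp: P_kernel(2)[OF y]\<close>)
    then show ?thesis using True y H_eq[OF t y] by (simp add: U_def H0_def)
  next
    case False
    have "measure (P y) (below_after t 0) = measure (P y) {}"
    proof (rule measure_eq_AE)
      show "AE \<omega> in P y. \<omega> \<in> below_after t 0 \<longleftrightarrow> \<omega> \<in> {}"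
        using AE_start[OF y] by eventually_elim (use False in \<open>auto simp: below_after_def\<close>)
    qed (use below_after_measurable t in \<open>auto simp: P_kernel(2)[OF y]\<close>)
    then show ?thesis using False by (simp add: U_def H0_def)
  qed
qed (simp add: U_def H0_def)

lemma H0_measurable: "0 \<le> t \<Longrightarrow> H0 t \<in> borel_measurable borel"
  using U_measurable[of t 0] U_zero[of t] by (simp cong: measurable_cong)

lemma H0_bounds: "0 \<le> t \<Longrightarrow> 0 \<le> H0 t y" "0 \<le> t \<Longrightarrow> H0 t y \<le> 1"
  using U_bounds[of t 0 y] U_zero[of t y] by auto

lemma H_on_curve:
  assumes t: "0 \<le> t"
  shows "H t (f t) = 0"
proof -
  have y: "f t \<in> S" by (rule f_range[OF t])
  interpret prob_space "P (f t)" by (rule P_kernel(1)[OF y])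
  have m: "{\<omega> \<in> \<Omega>. \<forall>u\<ge>0. \<omega> u \<noteq> f (t + u)} \<in> sets (path_space l)"
    by (rule no_hit_after_measurable[OF _ f_shift_cont[OF t]]) simp
  have "measure (P (f t)) {\<omega> \<in> \<Omega>. \<forall>u\<ge>0. \<omega> u \<noteq> f (t + u)} = measure (P (f t)) {}"
  proof (rule measure_eq_AE)
    show "AE \<omega> in P (f t). \<omega> \<in> {\<omega> \<in> \<Omega>. \<forall>u\<ge>0. \<omega> u \<noteq> f (t + u)} \<longleftrightarrow> \<omega> \<in> {}"
      using AE_start[OF y] by eventually_elim (auto intro!: exI[of _ 0])
  qed (use m in \<open>auto simp: P_kernel(2)[OF y]\<close>)
  then show ?thesis using H_eq[OF t y] by simp
qed

lemma H0_eq_H: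
  assumes "0 \<le> t" "y \<in> S" "y \<le> f t"
  shows "H0 t y = H t y"
  using assms H_on_curve[of t] by (cases "y = f t") (auto simp: H0_def)

text \<open>A Chapman-Kolmogorov relation: a shift by a moves the reference time to t + a and leaves
  the delay h. For h = 0 it represents U as an integral of \<open>H0\<close>; for t = 0 it freezes
  the density at time a while only the delay varies.\<close>

lemma U_markov:
  assumes y: "y \<in> S" and a: "0 < a" and t: "0 \<le> t" and h: "0 \<le> h"
  shows "U t (a + h) y = (\<integral>z. pd a y z * U (t + a) h z \<partial>lborel)"
proof -
  have "{\<omega> \<in> \<Omega>. shift_path a \<omega> \<in> below_after (t + a) h} = below_after t (a + h)"
  proof -
    have "(\<forall>u\<ge>h. \<omega> (a + u) \<noteq> f (t + a + u)) \<longleftrightarrow> (\<forall>u\<ge>a + h. \<omega> u \<noteq> f (t + u))" for \<omega>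
    proof safe
      fix u assume L: "\<forall>u\<ge>h. \<omega> (a + u) \<noteq> f (t + a + u)" "a + h \<le> u" "\<omega> u = f (t + u)"
      then show False using L(1)[rule_format, of "u - a"] by (auto simp: algebra_simps)
    next
      fix u assume L: "\<forall>u\<ge>a + h. \<omega> u \<noteq> f (t + u)" "h \<le> u" "\<omega> (a + u) = f (t + a + u)"
      then show False using L(1)[rule_format, of "a + u"] by (auto simp: algebra_simps)
    qed
    then show ?thesis
      using shift_path_in_space[of _ l a] a h
      by (auto simp: below_after_def shift_path_apply add.assoc)
  qed
  then have "U t (a + h) y = (\<integral>\<omega>. indicator S (\<omega> a) * measure (P (\<omega> a)) (below_after (t + a) h) \<partial>P y)"
    using markov[OF y less_imp_le[OF a] below_after_measurable[of "t + a" h]] a t h y by (simp add: U_def)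
  also have "\<dots> = (\<integral>\<omega>. U (t + a) h (\<omega> a) \<partial>P y)" by (simp add: U_def)
  also have "\<dots> = (\<integral>z. pd a y z * U (t + a) h z \<partial>lborel)"
    by (rule expectation(1)[OF a y U_measurable]) (use a t h in auto)
  finally show ?thesis .
qed

text \<open>A path with no contact during [0, h] is below the curve at h iff it was below at 0.
  Hence the events increase with h, and they differ only by paths that touch the curve by time
  h.\<close>

lemma U_increment:
  assumes t: "0 \<le> t" and h: "0 \<le> h" and y: "y \<in> S"
  shows "0 \<le> U t h y - U t 0 y" "U t h y - U t 0 y \<le> measure (P y) (hit_curve t h)"
proof -
  interpret prob_space "P y" by (rule P_kernel(1)[OF y])
  note m = below_after_measurable[OF t] hit_curve_measurable[OF t]
  note fc = f_shift_cont[OF t]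
  have 1: "below_after t 0 \<subseteq> below_after t h"
  proof
    fix \<omega> assume w: "\<omega> \<in> below_after t 0"
    then have w\<Omega>: "\<omega> \<in> \<Omega>" by (simp add: below_after_def)
    have "\<omega> h < f (t + h)"
    proof (rule ccontr)
      assume "\<not> \<omega> h < f (t + h)"
      then obtain v where "0 \<le> v" "v \<le> h" "\<omega> v = f (t + v)"
        using crossing[OF path_spaceD(1)[OF w\<Omega>] fc, of 0 h] w h by (auto simp: below_after_def)
      then show False using w by (auto simp: below_after_def)
    qed
    then show "\<omega> \<in> below_after t h" using w h by (auto simp: below_after_def)
  qed
  have 2: "below_after t h \<subseteq> below_after t 0 \<union> hit_curve t h"
  proof
    fix \<omega> assume w: "\<omega> \<in> below_after t h"
    then have w\<Omega>: "\<omega> \<in> \<Omega>" by (simp add: below_after_def)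
    show "\<omega> \<in> below_after t 0 \<union> hit_curve t h"
    proof (cases "\<omega> \<in> hit_curve t h")
      case False
      then have nh: "\<omega> u \<noteq> f (t + u)" if "0 \<le> u" for u
        using that w w\<Omega> by (cases "u \<le> h") (auto simp: hit_curve_def below_after_def)
      have "\<omega> 0 < f (t + 0)"
      proof (rule ccontr)
        assume "\<not> \<omega> 0 < f (t + 0)"
        then obtain v where "0 \<le> v" "v \<le> h" "\<omega> v = f (t + v)"
          using crossing[OF path_spaceD(1)[OF w\<Omega>] fc, of 0 h] w h by (auto simp: below_after_def)
        then show False using nh by blast
      qed
      then show ?thesis using nh w\<Omega> by (auto simp: below_after_def)
    qed simp
  qed
  show "0 \<le> U t h y - U t 0 y"
    using finite_measure_mono[OF 1] m h y by (simp add: U_def P_kernel(2)[OF y])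
  have "prob (below_after t h) \<le> prob (below_after t 0 \<union> hit_curve t h)"
    by (rule finite_measure_mono[OF 2]) (use m h in \<open>auto simp: P_kernel(2)[OF y]\<close>)
  also have "\<dots> \<le> prob (below_after t 0) + prob (hit_curve t h)"
    by (rule measure_Un_le) (use m h in \<open>auto simp: P_kernel(2)[OF y]\<close>)
  finally show "U t h y - U t 0 y \<le> measure (P y) (hit_curve t h)" using y by (simp add: U_def)
qed

lemma hit_curve_le_hit:
  assumes t: "0 \<le> t" and y: "y \<in> S"
    and between: "\<And>u. 0 \<le> u \<Longrightarrow> u \<le> h \<Longrightarrow> y \<le> b \<and> b \<le> f (t + u) \<or> f (t + u) \<le> b \<and> b \<le> y"
  shows "measure (P y) (hit_curve t h) \<le> measure (P y) (hit l b h)"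
proof -
  interpret prob_space "P y" by (rule P_kernel(1)[OF y])
  show ?thesis
  proof (rule finite_measure_mono_AE)
    show "AE \<omega> in P y. \<omega> \<in> hit_curve t h \<longrightarrow> \<omega> \<in> hit l b h"
      using AE_start[OF y]
    proof eventually_elim
      fix \<omega> assume w: "\<omega> 0 = y \<and> \<omega> \<in> \<Omega>"
      show "\<omega> \<in> hit_curve t h \<longrightarrow> \<omega> \<in> hit l b h"
      proof
        assume "\<omega> \<in> hit_curve t h"
        then obtain u where u: "0 \<le> u" "u \<le> h" "\<omega> u = f (t + u)" by (auto simp: hit_curve_def)
        obtain v where "0 \<le> v" "v \<le> u" "\<omega> v = b"
          by (rule crossing[OF path_spaceD(1), of \<omega> l "\<lambda>_. b" 0 u]) (use between[OF u(1,2)] w u in auto)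
        then show "\<omega> \<in> hit l b h" using w u by (auto simp: hit_def)
      qed
    qed
  qed (simp add: P_kernel(2)[OF y])
qed

text \<open>For short times the curve stays within r/2 of \<open>f t\<close>. A path starting at
  distance at least r must pass the fixed level at distance r and then the one at distance r/2
  before it can touch the curve, so fixed-level estimates give a bound uniform in y.\<close>

lemma hit_curve_bound:
  assumes t: "0 \<le> t" and r: "0 < r" and sub: "{f t - r..f t + r} \<subseteq> S"
  obtains K where "((\<lambda>h. K h / h) \<longlongrightarrow> 0) (at_right 0)"
    "\<forall>\<^sub>F h in at_right 0. \<forall>y\<in>S. \<bar>y - f t\<bar> \<ge> r \<longrightarrow> measure (P y) (hit_curve t h) \<le> K h"
proof -
  define c where "c = f t"
  define K where "K = (\<lambda>h. measure (P (c - r)) (hit l (c - r / 2) h) + measure (P (c + r)) (hit l (c + r / 2) h))"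
  have inS: "c - r \<in> S" "c + r \<in> S" "c - r / 2 \<in> S" "c + r / 2 \<in> S" using r sub by (auto simp: c_def)
  have "((\<lambda>h. measure (P (c - r)) (hit l (c - r / 2) h) / h + measure (P (c + r)) (hit l (c + r / 2) h) / h) \<longlongrightarrow> 0 + 0) (at_right 0)"
    by (intro tendsto_add hit_decay inS) (use r in auto)
  then have 1: "((\<lambda>h. K h / h) \<longlongrightarrow> 0) (at_right 0)" by (simp add: K_def add_divide_distrib)
  obtain d where d: "d > 0" "\<And>u. u \<ge> 0 \<Longrightarrow> \<bar>u - t\<bar> < d \<Longrightarrow> \<bar>f u - c\<bar> < r / 2"
    using f_cont t r unfolding continuous_on_iff c_def dist_real_def
    by (metis atLeast_iff half_gt_zero)
  have "\<forall>\<^sub>F h in at_right 0. \<forall>y\<in>S. \<bar>y - f t\<bar> \<ge> r \<longrightarrow> measure (P y) (hit_curve t h) \<le> K h"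
    using eventually_at_right_real[OF d(1)]
  proof eventually_elim
    fix h assume h: "h \<in> {0<..<d}"
    show "\<forall>y\<in>S. \<bar>y - f t\<bar> \<ge> r \<longrightarrow> measure (P y) (hit_curve t h) \<le> K h"
    proof (intro ballI impI)
      fix y assume y: "y \<in> S" "\<bar>y - f t\<bar> \<ge> r"
      interpret prob_space "P y" by (rule P_kernel(1)[OF y(1)])
      have fu: "\<bar>f (t + u) - c\<bar> < r / 2" if "0 \<le> u" "u \<le> h" for u
        using d(2)[of "t + u"] that h t by auto
      have "y \<le> c - r \<or> y \<ge> c + r" using y(2) by (auto simp: c_def abs_if split: if_splits)
      then show "measure (P y) (hit_curve t h) \<le> K h"
      proof
        assume yc: "y \<le> c - r"
        have "prob (hit_curve t h) \<le> prob (hit l (c - r / 2) h)"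
        proof (rule hit_curve_le_hit[OF t y(1)])
          show "y \<le> c - r / 2 \<and> c - r / 2 \<le> f (t + u) \<or> f (t + u) \<le> c - r / 2 \<and> c - r / 2 \<le> y"
            if "0 \<le> u" "u \<le> h" for u
            using fu[OF that] yc r by linarith
        qed
        also have "\<dots> \<le> measure (P (c - r)) (hit l (c - r / 2) h)"
          by (rule hit_through) (use y inS h r yc in auto)
        finally show ?thesis by (simp add: K_def add_increasing2)
      next
        assume yc: "y \<ge> c + r"
        have "prob (hit_curve t h) \<le> prob (hit l (c + r / 2) h)"
        proof (rule hit_curve_le_hit[OF t y(1)])
          show "y \<le> c + r / 2 \<and> c + r / 2 \<le> f (t + u) \<or> f (t + u) \<le> c + r / 2 \<and> c + r / 2 \<le> y"
            if "0 \<le> u" "u \<le> h" for u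
            using fu[OF that] yc r by linarith
        qed
        also have "\<dots> \<le> measure (P (c + r)) (hit l (c + r / 2) h)"
          by (rule hit_through) (use y inS h r yc in auto)
        finally show ?thesis by (simp add: K_def add_increasing)
      qed
    qed
  qed
  then show thesis by (rule that[OF 1])
qed

section \<open>Regularity of H strictly below the curve and its backward equation\<close>

lemma open_below_time: "open {u. 0 < u \<and> z < f u}"
proof -
  have "open ({0<..} \<inter> f -` {z<..})"
    by (rule continuous_open_preimage) (auto intro: continuous_on_subset[OF f_cont])
  moreover have "{0<..} \<inter> f -` {z<..} = {u. 0 < u \<and> z < f u}" by auto
  ultimately show ?thesis by simp
qed

text \<open>Strictly below the curve the sections of the domain contain open neighbourhoods, in time
  by continuity of f, so derivatives along the sections are ordinary derivatives.\<close>

lemma H_derivs_below: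
  assumes "0 < t" "z \<in> S" "z < f t"
  shows "((\<lambda>u. H u z) has_real_derivative Ht t z) (at t)"
    and "(H t has_real_derivative Hy t z) (at z)"
    and "(Hy t has_real_derivative Hyy t z) (at z)"
proof -
  have D: "(t, z) \<in> below_curve l f" using assms by (simp add: in_below_curve)
  have "at t within {u. (u, z) \<in> below_curve l f} = at t"
    by (rule at_within_open_subset[OF _ open_below_time[of z]]) (use assms in \<open>auto simp: in_below_curve\<close>)
  then show "((\<lambda>u. H u z) has_real_derivative Ht t z) (at t)" using Ht[OF D] by simp
  have "at z within {z. (t, z) \<in> below_curve l f} = at z"
    by (rule at_within_open_subset[of _ "S \<inter> {..<f t}"]) (use assms in \<open>auto simp: in_below_curve\<close>)
  then show "(H t has_real_derivative Hy t z) (at z)" "(Hy t has_real_derivative Hyy t z) (at z)"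
    using Hy[OF D] Hyy[OF D] by simp_all
qed

lemma continuous_section:
  assumes "continuous_on (below_curve l f) (\<lambda>(t, y). F t y)" "0 < t"
  shows "continuous_on (S \<inter> {..f t}) (F t)"
proof -
  have "continuous_on (S \<inter> {..f t}) (\<lambda>y. case (t, y) of (t, y) \<Rightarrow> F t y)"
    by (rule continuous_on_compose2[OF assms(1)])
      (use assms(2) in \<open>auto simp: in_below_curve intro!: continuous_intros\<close>)
  then show ?thesis by simp
qed

lemma below_rectangle:
  assumes t: "0 < t" and y: "y \<in> S" "y < f t" and e: "0 < e"
  obtains r d where "0 < r" "0 < d" "{y - r..y + r} \<subseteq> S"
    "\<And>u. t \<le> u \<Longrightarrow> u \<le> t + d \<Longrightarrow> y + r < f u"
    "\<And>u z. t \<le> u \<Longrightarrow> u \<le> t + d \<Longrightarrow> \<bar>z - y\<bar> \<le> r \<Longrightarrow> \<bar>Ht u z - Ht t y\<bar> \<le> e"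
proof -
  have D: "(t, y) \<in> below_curve l f" using t y by (simp add: in_below_curve)
  have "\<exists>\<eta>>0. \<forall>p\<in>below_curve l f. dist p (t, y) < \<eta> \<longrightarrow> dist (case p of (t, y) \<Rightarrow> Ht t y) (Ht t y) < e"
    using continuous_Ht[unfolded continuous_on_iff, rule_format, OF D e] by simp
  then obtain \<eta> where \<eta>: "\<eta> > 0"
    "\<And>p. p \<in> below_curve l f \<Longrightarrow> dist p (t, y) < \<eta> \<Longrightarrow> dist (case p of (t, y) \<Rightarrow> Ht t y) (Ht t y) < e"
    by blast
  obtain r0 where r0: "r0 > 0" "{y - r0..y + r0} \<subseteq> S" using S_ball[OF y(1)] .
  define e0 where "e0 = (f t - y) / 2"
  have e0: "e0 > 0" using y by (simp add: e0_def)
  have "\<exists>d>0. \<forall>u\<in>{0..}. dist u t < d \<longrightarrow> dist (f u) (f t) < e0"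
    using f_cont[unfolded continuous_on_iff, rule_format, of t e0] t e0 by auto
  then obtain d1 where d1: "d1 > 0" "\<And>u. u \<ge> 0 \<Longrightarrow> \<bar>u - t\<bar> < d1 \<Longrightarrow> \<bar>f u - f t\<bar> < e0"
    by (auto simp: dist_real_def)
  \<comment> \<open>The curve moves by less than \<open>e0\<close>, half of the gap above y, and
    \<open>r\<close> is at most \<open>e0 / 2\<close>, so the box stays under the curve. The
    quarters of \<open>\<eta>\<close> keep both coordinates jointly within the continuity radius of
    \<open>Ht\<close>.\<close>
  define r where "r = min r0 (min (e0 / 2) (\<eta> / 4))"
  define d where "d = min (d1 / 2) (\<eta> / 4)"
  have rd: "0 < r" "0 < d" "r \<le> r0" "r \<le> e0 / 2" "r \<le> \<eta> / 4" "d \<le> d1 / 2" "d \<le> \<eta> / 4"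
    using r0 e0 \<eta> d1 by (auto simp: r_def d_def)
  have fu: "y + r < f u" if "t \<le> u" "u \<le> t + d" for u
  proof -
    have "\<bar>f u - f t\<bar> < e0" using that t rd d1(1) by (intro d1(2)) auto
    then have "f t - e0 < f u" by (simp add: abs_less_iff)
    moreover have "f t = y + 2 * e0" by (simp add: e0_def field_simps)
    ultimately show ?thesis using rd(4) e0 by linarith
  qed
  have sub: "{y - r..y + r} \<subseteq> S" using r0(2) rd(3) by auto
  show thesis
  proof (rule that[OF rd(1,2) sub fu])
    fix u z assume uz: "t \<le> u" "u \<le> t + d" "\<bar>z - y\<bar> \<le> r"
    have "z \<in> S" using sub uz(3) by (auto simp: abs_le_iff subset_iff)
    then have "(u, z) \<in> below_curve l f" using uz fu[of u] t by (auto simp: in_below_curve)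
    moreover have "dist (u, z) (t, y) \<le> \<bar>u - t\<bar> + \<bar>z - y\<bar>"
      unfolding dist_Pair_Pair dist_real_def using sqrt_sum_squares_le_sum_abs[of "u - t" "z - y"] by simp
    then have "dist (u, z) (t, y) < \<eta>" using uz rd \<eta>(1) by auto
    ultimately show "\<bar>Ht u z - Ht t y\<bar> \<le> e" using \<eta>(2)[of "(u, z)"] by (simp add: dist_real_def)
  qed
qed

text \<open>
  \<open>H (t + h) (\<omega> h)\<close> has expectation \<open>H t y + o(h)\<close>, since the curve is reached before \<open>h\<close> with
  probability \<open>o(h)\<close>; a cutoff makes the generator applicable.
\<close>

lemma backward_equation_H:
  assumes t: "0 < t" and y: "y \<in> S" "y < f t"
  shows "rho y * Ht t y + flux_deriv (Hy t) (Hyy t) y = 0"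
proof -
  let ?G = "flux_deriv (Hy t) (Hyy t) y / rho y"
  have t0: "0 \<le> t" using t by simp
  have "\<bar>?G + Ht t y\<bar> \<le> e" if e: "0 < e" for e
  proof -
    obtain r d where rd: "0 < r" "0 < d" "{y - r..y + r} \<subseteq> S"
      "\<And>u. t \<le> u \<Longrightarrow> u \<le> t + d \<Longrightarrow> y + r < f u"
      "\<And>u z. t \<le> u \<Longrightarrow> u \<le> t + d \<Longrightarrow> \<bar>z - y\<bar> \<le> r \<Longrightarrow> \<bar>Ht u z - Ht t y\<bar> \<le> e"
      using below_rectangle[OF t y e] by metis
    \<comment> \<open>The cutoff \<psi> is 1 within r/4 and vanishes beyond r/2, well inside the
      box. The error of the cutoff is the probability of getting from y to distance r/4 within time
      h.\<close>
    have r4: "0 < r / 4" "r / 4 < r / 2" using rd(1) by auto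
    obtain \<psi> \<psi>1 \<psi>2 where \<psi>: "C2_with \<psi> \<psi>1 \<psi>2" "\<And>z. 0 \<le> \<psi> z" "\<And>z. \<psi> z \<le> 1"
      "\<And>z. \<bar>z - y\<bar> \<le> r / 4 \<Longrightarrow> \<psi> z = 1" "\<And>z. \<bar>z - y\<bar> \<ge> r / 2 \<Longrightarrow> \<psi> z = 0"
      using bump_exists[OF r4, of y] by metis
    have \<psi>m: "\<psi> \<in> borel_measurable borel" by (rule borel_measurable_continuous_onI[OF C2_withD(3)[OF \<psi>(1)]])
    have zS: "z \<in> S" "z < f t" if "\<bar>z - y\<bar> \<le> r" for z
      using that rd(3) rd(4)[of t] rd(2) by (auto simp: abs_le_iff subset_iff)
    have \<psi>y: "\<psi> y = 1" "\<psi>1 y = 0" "\<psi>2 y = 0"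
    proof -
      have op: "open {z. \<bar>z - y\<bar> < r / 4}" by (intro open_Collect_less continuous_intros)
      show "\<psi> y = 1" by (rule \<psi>(4)) (use rd in simp)
      show "\<psi>1 y = 0" "\<psi>2 y = 0"
        by (rule C2_with_locally_const[OF \<psi>(1) op, of y 1]; use \<psi>(4) rd in simp)+
    qed
    define u where "u = (\<lambda>z. \<psi> z * H t z)"
    define u1 where "u1 = (\<lambda>z. \<psi>1 z * H t z + \<psi> z * Hy t z)"
    define u2 where "u2 = (\<lambda>z. \<psi>2 z * H t z + 2 * \<psi>1 z * Hy t z + \<psi> z * Hyy t z)"
    have u: "C2_with u u1 u2"
      unfolding u_def u1_def u2_def
    proof (rule C2_with_mult_compact_support[where S="{y - r<..<y + r}" and c=y and r="r / 2", OF \<psi>(1) \<psi>(5)])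
      fix z assume "z \<in> {y - r<..<y + r}"
      then have z: "\<bar>z - y\<bar> \<le> r" by (auto simp: abs_le_iff)
      show "(H t has_real_derivative Hy t z) (at z)" "(Hy t has_real_derivative Hyy t z) (at z)"
        by (rule H_derivs_below[OF t zS[OF z]])+
    next
      show "continuous_on {y - r<..<y + r} (Hyy t)"
      proof (rule continuous_on_subset[OF continuous_section[OF continuous_Hyy t]], rule subsetI)
        fix z assume "z \<in> {y - r<..<y + r}"
        then have "\<bar>z - y\<bar> \<le> r" by (auto simp: abs_le_iff)
        then show "z \<in> S \<inter> {..f t}" using zS by (auto intro: less_imp_le)
      qed
    qed (use rd in auto)
    have u0: "u z = 0" if "\<bar>z - y\<bar> \<ge> r / 2" for z using \<psi>(5)[OF that] by (simp add: u_def)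
    have uH0: "u z = \<psi> z * H0 t z" for z
      using zS[of z] \<psi>(5)[of z] rd(1) by (cases "\<bar>z - y\<bar> \<le> r / 2") (auto simp: u_def H0_def)
    have sub2: "{y - r / 2..y + r / 2} \<subseteq> S" "0 < r / 2" using rd by auto
    define a where "a = (\<lambda>h. (\<integral>z. pd h y z * u z \<partial>lborel) - u y)"
    define m where "m = (\<lambda>h. \<integral>z. pd h y z * \<psi> z \<partial>lborel)"
    have "flux_deriv u1 u2 y = flux_deriv (Hy t) (Hyy t) y"
      by (simp add: flux_deriv_def u1_def u2_def \<psi>y)
    then have alim: "((\<lambda>h. a h / h) \<longlongrightarrow> ?G) (at_right 0)"
      using generator_limit[OF u u0 sub2 y(1)] unfolding a_def by simp
    obtain C where C: "0 \<le> C" "\<And>h. 0 < h \<Longrightarrow> \<bar>m h - 1\<bar> \<le> C * h"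
      using dynkin_bound[OF \<psi>(1,5) sub2] y(1) \<psi>y(1) unfolding m_def by metis
    obtain K1 where K1: "((\<lambda>h. K1 h / h) \<longlongrightarrow> 0) (at_right 0)"
      "\<And>z h. z \<in> S \<Longrightarrow> \<bar>z - y\<bar> \<le> r / 8 \<Longrightarrow> 0 < h \<Longrightarrow>
        (\<integral>w. pd h z w * indicator {w. \<bar>w - y\<bar> \<ge> r / 4} w \<partial>lborel) \<le> K1 h"
    proof (rule escape_bound[of "r / 8" "r / 4" y])
      show "{y - r / 4..y + r / 4} \<subseteq> S" using rd(1) by (intro subset_trans[OF _ rd(3)]) auto
    qed (use rd in auto)
    define K2 where "K2 = (\<lambda>h. measure (P y) (hit l (y + r) h))"
    have yr: "y + r \<in> S" using rd by auto
    have K2: "((\<lambda>h. K2 h / h) \<longlongrightarrow> 0) (at_right 0)"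
      unfolding K2_def by (rule hit_decay[OF y(1) yr]) (use rd in simp)
    \<comment> \<open>\<open>U t h y - H t y\<close> splits as b + a + c: b is the loss from the
      cutoff, a the expected change of \<psi> H in space with t fixed, c the change of H in time
      under the cutoff. Both the whole and b are o(h), so a and c cancel to first order.\<close>
    have bound: "\<bar>a h / h + Ht t y\<bar> \<le> e + K1 h / h + K2 h / h + \<bar>Ht t y\<bar> * (C * h)" if h: "0 < h" "h < d" for h
    proof -
      have H0m: "H0 (t + h) \<in> borel_measurable borel" "H0 t \<in> borel_measurable borel"
        using t h by (auto intro: H0_measurable)
      have H0b: "0 \<le> H0 (t + h) z" "H0 (t + h) z \<le> 1" "0 \<le> H0 t z" "H0 t z \<le> 1" for z
        using t h by (auto intro: H0_bounds)
      have \<psi>H: "0 \<le> \<psi> z * H0 (t + h) z" "\<psi> z * H0 (t + h) z \<le> 1" "0 \<le> \<psi> z * H0 t z" "\<psi> z * H0 t z \<le> 1" for z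
        using \<psi>(2,3)[of z] H0b[of z] by (auto intro: mult_nonneg_nonneg mult_le_one)
      have i1: "integrable lborel (\<lambda>z. pd h y z * (\<psi> z * H0 (t + h) z))"
        by (rule integrable_pd[OF h(1) y(1), of _ 1]) (use \<psi>m H0m \<psi>H in auto)
      have i2: "integrable lborel (\<lambda>z. pd h y z * (\<psi> z * H0 t z))"
        by (rule integrable_pd[OF h(1) y(1), of _ 1]) (use \<psi>m H0m \<psi>H in auto)
      have i3: "integrable lborel (\<lambda>z. pd h y z * H0 (t + h) z)"
        by (rule integrable_pd[OF h(1) y(1), of _ 1]) (use H0m H0b in auto)
      have i4: "integrable lborel (\<lambda>z. pd h y z * \<psi> z)"
        by (rule integrable_pd[OF h(1) y(1), of _ 1]) (use \<psi>m \<psi>(2,3) in auto)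
      have i5: "integrable lborel (\<lambda>z. pd h y z * indicator {w. \<bar>w - y\<bar> \<ge> r / 4} z)"
        by (rule integrable_pd[OF h(1) y(1), of _ 1]) (auto simp: indicator_def)
      define c where "c = (\<integral>z. pd h y z * (\<psi> z * H0 (t + h) z) \<partial>lborel) - (\<integral>z. pd h y z * (\<psi> z * H0 t z) \<partial>lborel)"
      have c: "\<bar>c - h * Ht t y * m h\<bar> \<le> e * h"
      proof -
        have "c - h * Ht t y * m h = (\<integral>z. pd h y z * (\<psi> z * (H0 (t + h) z - H0 t z - h * Ht t y)) \<partial>lborel)"
        proof -
          have "(\<integral>z. pd h y z * (\<psi> z * (H0 (t + h) z - H0 t z - h * Ht t y)) \<partial>lborel) =
              (\<integral>z. pd h y z * (\<psi> z * H0 (t + h) z) - pd h y z * (\<psi> z * H0 t z) - (h * Ht t y) * (pd h y z * \<psi> z) \<partial>lborel)"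
            by (rule Bochner_Integration.integral_cong) (simp_all add: algebra_simps)
          then show ?thesis using i1 i2 i4 by (simp add: c_def m_def)
        qed
        also have "\<bar>\<dots>\<bar> \<le> e * h"
        proof (rule expectation_le[OF h(1) y(1)])
          fix z
          show "\<bar>\<psi> z * (H0 (t + h) z - H0 t z - h * Ht t y)\<bar> \<le> e * h"
          proof (cases "\<bar>z - y\<bar> \<le> r / 2")
            case True
            then have z: "\<bar>z - y\<bar> \<le> r" using rd(1) by linarith
            have zf: "z < f v" if "t \<le> v" "v \<le> t + h" for v
              using rd(4)[of v] that h z by auto
            \<comment> \<open>Mean value inequality for \<open>H v z - v * Ht t y\<close>, whose
              derivative in v is at most e in absolute value on the box.\<close>
            have "norm ((H (t + h) z - (t + h) * Ht t y) - (H t z - t * Ht t y)) \<le> e * norm ((t + h) - t)"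
            proof (rule field_differentiable_bound[of "{t..t + h}"])
              fix v assume v: "v \<in> {t..t + h}"
              have "((\<lambda>v. H v z) has_real_derivative Ht v z) (at v within {t..t + h})"
                by (rule has_field_derivative_at_within, rule H_derivs_below)
                  (use v t zS(1)[OF z] zf in auto)
              then show "((\<lambda>v. H v z - v * Ht t y) has_real_derivative (Ht v z - Ht t y)) (at v within {t..t + h})"
                by (auto intro!: derivative_eq_intros)
              show "norm (Ht v z - Ht t y) \<le> e" using rd(5)[of v z] v h z by simp
            qed (use h in auto)
            moreover have "H0 (t + h) z = H (t + h) z" "H0 t z = H t z"
              using zf[of "t + h"] zf[of t] h zS(1)[OF z] by (auto simp: H0_def)
            ultimately have "\<bar>H0 (t + h) z - H0 t z - h * Ht t y\<bar> \<le> e * h"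
              using h by (simp add: algebra_simps)
            moreover have "\<bar>\<psi> z\<bar> \<le> 1" using \<psi>(2,3)[of z] by simp
            ultimately show ?thesis
              unfolding abs_mult using mult_mono[of "\<bar>\<psi> z\<bar>" 1 "\<bar>H0 (t + h) z - H0 t z - h * Ht t y\<bar>" "e * h"] by simp
          next
            case False
            then show ?thesis using \<psi>(5)[of z] e h by simp
          qed
        qed
        finally show ?thesis .
      qed
      have Uh: "U t h y = (\<integral>z. pd h y z * H0 (t + h) z \<partial>lborel)"
        using U_markov[OF y(1) h(1) t0, of 0] U_zero[of "t + h"] t h by simp
      define b where "b = U t h y - (\<integral>z. pd h y z * (\<psi> z * H0 (t + h) z) \<partial>lborel)"
      have b: "0 \<le> b" "b \<le> K1 h"
      proof -
        have beq: "b = (\<integral>z. pd h y z * ((1 - \<psi> z) * H0 (t + h) z) \<partial>lborel)"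
          unfolding b_def Uh using i1 i3 by (simp add: algebra_simps flip: Bochner_Integration.integral_diff)
        show "0 \<le> b"
          unfolding beq using pd_nonneg[OF h(1) y(1)] \<psi>(3) H0b by (intro integral_nonneg_AE AE_I2) auto
        have "b \<le> (\<integral>z. pd h y z * indicator {w. \<bar>w - y\<bar> \<ge> r / 4} z \<partial>lborel)"
          unfolding beq
        proof (rule integral_mono'[OF i5])
          fix z
          have "(1 - \<psi> z) * H0 (t + h) z \<le> indicator {w. \<bar>w - y\<bar> \<ge> r / 4} z"
          proof (cases "\<bar>z - y\<bar> \<ge> r / 4")
            case True
            then show ?thesis using mult_le_one[of "1 - \<psi> z" "H0 (t + h) z"] \<psi>(2,3)[of z] H0b[of z] by simp
          next
            case False then show ?thesis using \<psi>(4)[of z] by simp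
          qed
          then show "pd h y z * ((1 - \<psi> z) * H0 (t + h) z) \<le> pd h y z * indicator {w. \<bar>w - y\<bar> \<ge> r / 4} z"
            by (rule mult_left_mono) (rule pd_nonneg[OF h(1) y(1)])
          show "0 \<le> pd h y z * indicator {w. \<bar>w - y\<bar> \<ge> r / 4} z" using pd_nonneg[OF h(1) y(1)] by simp
        qed
        also have "\<dots> \<le> K1 h" by (rule K1(2)) (use y h rd in auto)
        finally show "b \<le> K1 h" .
      qed
      have g: "0 \<le> U t h y - H t y" "U t h y - H t y \<le> K2 h"
      proof -
        interpret prob_space "P y" by (rule P_kernel(1)[OF y(1)])
        have "prob (hit_curve t h) \<le> K2 h"
          unfolding K2_def using rd(1,4) h by (intro hit_curve_le_hit[OF t0 y(1)]) (auto simp: less_imp_le)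
        moreover have "U t 0 y = H t y" using U_zero[OF t0, of y] y by (simp add: H0_def)
        ultimately show "0 \<le> U t h y - H t y" "U t h y - H t y \<le> K2 h"
          using U_increment[OF t0 less_imp_le[OF h(1)] y(1)] by auto
      qed
      have "U t h y - H t y = b + a h + c"
        unfolding b_def a_def c_def uH0 using uH0[of y] y by (simp add: \<psi>y H0_def)
      then have ac: "\<bar>a h + c\<bar> \<le> K1 h + K2 h" using b g by linarith
      \<comment> \<open>The expected cutoff \<open>m h\<close> differs from 1 by at most
        \<open>C * h\<close>, so replacing it by 1 changes the time increment by a term of order
        \<open>h * h\<close> only.\<close>
      have "a h + h * Ht t y = (a h + c) - (c - h * Ht t y * m h) - h * Ht t y * (m h - 1)"
        by (simp add: algebra_simps)
      then have "\<bar>a h + h * Ht t y\<bar> \<le> (K1 h + K2 h) + e * h + \<bar>h * Ht t y * (m h - 1)\<bar>"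
        using ac c by linarith
      also have "\<bar>h * Ht t y * (m h - 1)\<bar> \<le> h * \<bar>Ht t y\<bar> * (C * h)"
        unfolding abs_mult using C(2)[OF h(1)] h by (intro mult_mono) auto
      finally have "\<bar>a h + h * Ht t y\<bar> / h \<le> ((K1 h + K2 h) + e * h + h * \<bar>Ht t y\<bar> * (C * h)) / h"
        using h by (intro divide_right_mono) auto
      moreover have "\<bar>a h + h * Ht t y\<bar> / h = \<bar>a h / h + Ht t y\<bar>"
      proof -
        have "a h / h + Ht t y = (a h + h * Ht t y) / h" using h by (simp add: field_simps)
        then show ?thesis using h by (simp add: abs_divide)
      qed
      ultimately show ?thesis using h by (simp add: add_divide_distrib)
    qed
    have "\<bar>?G + Ht t y\<bar> \<le> e + 0 + 0 + \<bar>Ht t y\<bar> * (C * 0)"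
    proof (rule tendsto_le[OF _ _ _ ])
      show "((\<lambda>h. e + K1 h / h + K2 h / h + \<bar>Ht t y\<bar> * (C * h)) \<longlongrightarrow> e + 0 + 0 + \<bar>Ht t y\<bar> * (C * 0)) (at_right 0)"
        by (intro tendsto_intros K1 K2)
      show "((\<lambda>h. \<bar>a h / h + Ht t y\<bar>) \<longlongrightarrow> \<bar>?G + Ht t y\<bar>) (at_right 0)"
        by (intro tendsto_intros alim)
      show "\<forall>\<^sub>F h in at_right 0. \<bar>a h / h + Ht t y\<bar> \<le> e + K1 h / h + K2 h / h + \<bar>Ht t y\<bar> * (C * h)"
        using eventually_at_right_real[OF rd(2)] by eventually_elim (use bound in auto)
    qed simp
    then show ?thesis by simp
  qed
  then have "\<bar>?G + Ht t y\<bar> \<le> 0" by (rule field_le_epsilon[of _ 0, simplified])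
  then have "?G + Ht t y = 0" by simp
  then show ?thesis using speed_pos[OF y(1)] by (simp add: field_simps)
qed

end

section \<open>The right derivative of the survival function\<close>

context curve_passage
begin

text \<open>Lipschitz continuity in time survives the moving kink. \<open>Ht\<close> is bounded on
  the compact piece up to and including the curve. If z is not below the curve throughout, let p and
  q' be the first and last times with f \<le> z: \<open>H0\<close> vanishes at both, so only the
  outer time intervals contribute.\<close>

lemma H0_increment_bound:
  assumes t: "0 < t" and sub: "{a..b} \<subseteq> S"
  obtains M where "0 < M"
    "\<And>h z. 0 < h \<Longrightarrow> h < 1 \<Longrightarrow> z \<in> {a..b} \<Longrightarrow> \<bar>H0 (t + h) z - H0 t z\<bar> \<le> M * h"
proof -
  define K where "K = {p \<in> {t..t + 1} \<times> {a..b}. snd p \<le> f (fst p)}"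
  have "compact K"
  proof -
    have "continuous_on ({t..t + 1} \<times> {a..b}) (\<lambda>p. f (fst p))"
      by (rule continuous_on_compose2[OF f_cont]) (use t in \<open>auto intro!: continuous_intros\<close>)
    then have "closed {p \<in> {t..t + 1} \<times> {a..b}. snd p \<le> f (fst p)}"
      by (intro continuous_on_closed_Collect_le continuous_intros closed_Times) auto
    moreover have "bounded K"
      by (rule bounded_subset[of "{t..t + 1} \<times> {a..b}"]) (auto simp: K_def intro: bounded_Times)
    ultimately show ?thesis by (simp add: K_def compact_eq_bounded_closed)
  qed
  moreover have KD: "K \<subseteq> below_curve l f"
    using sub t by (auto simp: K_def in_below_curve)
  ultimately have "bounded ((\<lambda>(t, y). Ht t y) ` K)"
    by (intro compact_imp_bounded compact_continuous_image continuous_on_subset[OF continuous_Ht])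
  then obtain M where M: "0 < M" "\<And>p. p \<in> K \<Longrightarrow> \<bar>case p of (t, y) \<Rightarrow> Ht t y\<bar> \<le> M"
    unfolding bounded_pos by force
  have below: "\<bar>H0 q' z - H0 p z\<bar> \<le> M * (q' - p)"
    if pq: "t \<le> p" "p \<le> q'" "q' \<le> t + 1" and z: "z \<in> {a..b}" and zf: "\<And>u. p \<le> u \<Longrightarrow> u \<le> q' \<Longrightarrow> z \<le> f u"
    for p q' z
  proof -
    have zS: "z \<in> S" using z sub by auto
    have "norm (H q' z - H p z) \<le> M * norm (q' - p)"
    proof (rule field_differentiable_bound[of "{p..q'}"])
      fix u assume u: "u \<in> {p..q'}"
      have D: "{p..q'} \<subseteq> {u. (u, z) \<in> below_curve l f}" using pq t zS zf by (auto simp: in_below_curve)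
      then have "(u, z) \<in> below_curve l f" using u by auto
      from Ht[OF this] show "((\<lambda>u. H u z) has_field_derivative Ht u z) (at u within {p..q'})"
        by (rule has_field_derivative_subset[OF _ D])
      have "(u, z) \<in> K" using u pq z zf by (auto simp: K_def)
      then show "norm (Ht u z) \<le> M" using M(2)[of "(u, z)"] by simp
    qed (use pq in auto)
    moreover have "H0 q' z = H q' z" "H0 p z = H p z"
      using H0_eq_H[OF _ zS zf] pq t by auto
    ultimately show ?thesis using pq by simp
  qed
  have "\<bar>H0 (t + h) z - H0 t z\<bar> \<le> M * h" if h: "0 < h" "h < 1" and z: "z \<in> {a..b}" for h z
  proof -
    define Z where "Z = {u \<in> {t..t + h}. f u \<le> z}"
    have cf: "continuous_on {t..t + h} f" by (rule continuous_on_subset[OF f_cont]) (use t in auto)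
    show ?thesis
    proof (cases "Z = {}")
      case True
      then have "z \<le> f u" if "t \<le> u" "u \<le> t + h" for u using that by (force simp: Z_def)
      then show ?thesis using below[of t "t + h" z] h z by simp
    next
      case False
      have cl: "closed Z" unfolding Z_def by (intro continuous_on_closed_Collect_le cf continuous_intros)
      have bdd: "bdd_below Z" "bdd_above Z" by (auto simp: Z_def bdd_below_def bdd_above_def)
      define p where "p = Inf Z"
      define q' where "q' = Sup Z"
      have pZ: "p \<in> Z" unfolding p_def by (rule closed_contains_Inf[OF False bdd(1) cl])
      have qZ: "q' \<in> Z" unfolding q'_def by (rule closed_contains_Sup[OF False bdd(2) cl])
      have low: "p \<le> u" "u \<le> q'" if "u \<in> Z" for u
        unfolding p_def q'_def using that bdd by (auto intro: cInf_lower cSup_upper)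
      have zero: "H0 p z = 0" "H0 q' z = 0" using pZ qZ by (auto simp: H0_def Z_def)
      have p: "t \<le> p" "p \<le> t + h" "f p \<le> z" and q': "t \<le> q'" "q' \<le> t + h" "f q' \<le> z"
        using pZ qZ by (auto simp: Z_def)
      have 1: "\<bar>H0 p z - H0 t z\<bar> \<le> M * (p - t)"
      proof (cases "p = t")
        case False
        have above: "z < f u" if "t \<le> u" "u < p" for u
          using low(1)[of u] that p by (force simp: Z_def)
        \<comment> \<open>At the first time with f \<le> z the curve is exactly at z, unless this is
          the initial time. Thus z \<le> f on the closed interval [t, p], and the bound reaches p
          itself.\<close>
        have "f p = z"
        proof (rule ccontr)
          assume "f p \<noteq> z"
          then have "f p < z" using p by simp
          moreover have "z < f t" using above[of t] False p by simp
          moreover have "continuous_on {t..p} f" by (rule continuous_on_subset[OF cf]) (use p in auto)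
          ultimately obtain v where "t \<le> v" "v \<le> p" "f v = z"
            using IVT2'[of f p z t] p by auto
          then show False using above[of v] \<open>f p \<noteq> z\<close> by (cases "v = p") auto
        qed
        then have "z \<le> f u" if "t \<le> u" "u \<le> p" for u
          using above[of u] that by (cases "u = p") auto
        then show ?thesis using below[of t p z] p h z by simp
      qed simp
      have 2: "\<bar>H0 (t + h) z - H0 q' z\<bar> \<le> M * (t + h - q')"
      proof (cases "q' = t + h")
        case False
        have above: "z < f u" if "q' < u" "u \<le> t + h" for u
          using low(2)[of u] that q' by (force simp: Z_def)
        have "f q' = z"
        proof (rule ccontr)
          assume "f q' \<noteq> z"
          then have "f q' < z" using q' by simp
          moreover have "z < f (t + h)" using above[of "t + h"] False q' by simp
          moreover have "continuous_on {q'..t + h} f" by (rule continuous_on_subset[OF cf]) (use q' in auto)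
          ultimately obtain v where "q' \<le> v" "v \<le> t + h" "f v = z"
            using IVT'[of f q' z "t + h"] q' by auto
          then show False using above[of v] \<open>f q' \<noteq> z\<close> by (cases "v = q'") auto
        qed
        then have "z \<le> f u" if "q' \<le> u" "u \<le> t + h" for u
          using above[of u] that by (cases "u = q'") auto
        then show ?thesis using below[of q' "t + h" z] q' h z by simp
      qed simp
      have "\<bar>H0 (t + h) z - H0 t z\<bar> \<le> M * (p - t) + M * (t + h - q')" using 1 2 zero by linarith
      also have "\<dots> \<le> M * h" using low(2)[OF pZ] M(1) by (simp add: algebra_simps)
      finally show ?thesis .
    qed
  qed
  then show thesis by (rule that[OF M(1)])
qed

definition last_passage_density :: "real \<Rightarrow> real \<Rightarrow> real" where
  "last_passage_density x t = - (q t x (f t) / deriv s (f t)) * Hy t (f t)"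

lemma expectation_measurable:
  assumes h: "0 < h" and g: "g \<in> borel_measurable borel"
  shows "(\<lambda>z. indicator S z * (\<integral>y. pd h z y * g y \<partial>lborel)) \<in> borel_measurable borel"
proof -
  have "continuous_on (S \<times> S) (\<lambda>p. q h (fst p) (snd p))"
    by (intro continuous_q_compose continuous_intros) (use h in auto)
  from borel_measurable_continuous_on_indicator[OF _ this]
  have qm: "(\<lambda>p. indicator (S \<times> S) p * q h (fst p) (snd p)) \<in> borel_measurable borel"
    by (simp add: borel_open open_Times)
  have "(\<lambda>p. (indicator (S \<times> S) p * q h (fst p) (snd p)) * (indicator S (snd p) * rho (snd p)) * g (snd p)) \<in> borel_measurable borel"
    by (intro borel_measurable_times qm measurable_compose[OF _ rho_measurable]
        measurable_compose[OF _ g] borel_measurable_continuous_onI continuous_intros)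
  then have "(\<lambda>(z, y). (indicator (S \<times> S) (z, y) * q h z y) * (indicator S y * rho y) * g y) \<in> borel_measurable (lborel \<Otimes>\<^sub>M lborel)"
    by (simp add: lborel_prod case_prod_unfold)
  from lborel.borel_measurable_lebesgue_integral[OF this]
  have "(\<lambda>z. \<integral>y. (indicator (S \<times> S) (z, y) * q h z y) * (indicator S y * rho y) * g y \<partial>lborel) \<in> borel_measurable borel"
    by simp
  moreover have "(\<integral>y. (indicator (S \<times> S) (z, y) * q h z y) * (indicator S y * rho y) * g y \<partial>lborel) =
      indicator S z * (\<integral>y. pd h z y * g y \<partial>lborel)" for z
  proof -
    have "(\<integral>y. (indicator (S \<times> S) (z, y) * q h z y) * (indicator S y * rho y) * g y \<partial>lborel) =
        (\<integral>y. indicator S z * (pd h z y * g y) \<partial>lborel)"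
      by (rule Bochner_Integration.integral_cong) (auto simp: pd_def indicator_def)
    then show ?thesis by simp
  qed
  ultimately show ?thesis by simp
qed

text \<open>
  By symmetry of the density the increment over \<open>h\<close> can be moved from \<open>H\<close>, which has a kink on the
  curve, to the smooth function \<open>g = \<phi> q(t, x, \<cdot>)\<close>. Green's formula below the curve and the backward
  equation for \<open>H\<close> leave the boundary term at \<open>f t\<close> only.
\<close>

lemma U_right_derivative:
  assumes x: "x \<in> S" and t: "0 < t"
  shows "((\<lambda>h. (U 0 (t + h) x - U 0 t x) / h) \<longlongrightarrow> last_passage_density x t) (at_right 0)"
proof -
  define c where "c = f t"
  have t0: "0 \<le> t" using t by simp
  have cS: "c \<in> S" using f_range[OF t0] by (simp add: c_def)
  obtain r0 where r0: "r0 > 0" "{c - r0..c + r0} \<subseteq> S" using S_ball[OF cS] .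
  \<comment> \<open>Three radii: \<phi> is 1 within r of the curve, it vanishes beyond 2 r, and H is
    truncated at 3 r. Each gap between consecutive tasks turns the corresponding error into a
    passage over positive distance, hence into o(h).\<close>
  define r where "r = r0 / 3"
  have r: "0 < r" "r < 2 * r" "2 * r < 3 * r" using r0 by (auto simp: r_def)
  have sub3: "{c - 3 * r..c + 3 * r} \<subseteq> S" using r0 by (simp add: r_def)
  have sub2: "{c - 2 * r..c + 2 * r} \<subseteq> S" by (rule subset_trans[OF _ sub3]) (use r in auto)
  have sub1: "{c - r..c + r} \<subseteq> S" by (rule subset_trans[OF _ sub3]) (use r in auto)
  obtain \<phi> \<phi>1 \<phi>2 where \<phi>: "C2_with \<phi> \<phi>1 \<phi>2" "\<And>y. 0 \<le> \<phi> y" "\<And>y. \<phi> y \<le> 1"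
    "\<And>y. \<bar>y - c\<bar> \<le> r \<Longrightarrow> \<phi> y = 1" "\<And>y. \<bar>y - c\<bar> \<ge> 2 * r \<Longrightarrow> \<phi> y = 0"
    using bump_exists[OF r(1,2), of c] by metis
  have \<phi>m: "\<phi> \<in> borel_measurable borel" by (rule borel_measurable_continuous_onI[OF C2_withD(3)[OF \<phi>(1)]])
  define g where "g = (\<lambda>y. \<phi> y * q t x y)"
  define g1 where "g1 = (\<lambda>y. \<phi>1 y * q t x y + \<phi> y * qy t x y)"
  define g2 where "g2 = (\<lambda>y. \<phi>2 y * q t x y + 2 * \<phi>1 y * qy t x y + \<phi> y * qyy t x y)"
  have g: "C2_with g g1 g2"
    unfolding g_def g1_def g2_def
    by (rule C2_with_mult_compact_support[where S=S and c=c and r="2 * r", OF \<phi>(1,5) open_S sub2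
          density_derivs(2,3,6)[OF t x]])
  note gd = C2_withD[OF g]
  have g0: "g y = 0" if "\<bar>y - c\<bar> \<ge> 2 * r" for y using \<phi>(5)[OF that] by (simp add: g_def)
  have gm: "g \<in> borel_measurable borel" by (rule borel_measurable_continuous_onI[OF gd(3)])
  have gc: "g c = q t x c" using \<phi>(4)[of c] r by (simp add: g_def)
  have r2: "0 < 2 * r" using r by simp
  obtain C where C: "0 \<le> C"
    "\<And>z h. z \<in> S \<Longrightarrow> 0 < h \<Longrightarrow> \<bar>(\<integral>y. pd h z y * g y \<partial>lborel) - g z\<bar> \<le> C * h"
    using dynkin_bound[OF g g0 sub2 r2] by blast
  obtain M where M: "0 < M"
    "\<And>h z. 0 < h \<Longrightarrow> h < 1 \<Longrightarrow> z \<in> {c - 3 * r..c + 3 * r} \<Longrightarrow> \<bar>H0 (t + h) z - H0 t z\<bar> \<le> M * h"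
    using H0_increment_bound[OF t sub3] by blast
  obtain K1 where K1: "((\<lambda>h. K1 h / h) \<longlongrightarrow> 0) (at_right 0)"
    "\<forall>\<^sub>F h in at_right 0. \<forall>y\<in>S. \<bar>y - f t\<bar> \<ge> r \<longrightarrow> measure (P y) (hit_curve t h) \<le> K1 h"
    using hit_curve_bound[OF t0 r(1)] sub1 unfolding c_def by blast
  obtain K2 where K2: "((\<lambda>h. K2 h / h) \<longlongrightarrow> 0) (at_right 0)"
    "\<And>y h. y \<in> S \<Longrightarrow> \<bar>y - c\<bar> \<le> 2 * r \<Longrightarrow> 0 < h \<Longrightarrow> (\<integral>z. pd h y z * indicator {z. \<bar>z - c\<bar> \<ge> 3 * r} z \<partial>lborel) \<le> K2 h"
    using escape_bound[OF r2 r(3) sub3] by blast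
  let ?I = "{c - 3 * r..c + 3 * r}" and ?J = "{c - 3 * r..c}"
  have JS: "?J \<subseteq> S" by (rule subset_trans[OF _ sub3]) (use r in auto)
  define F where "F = (\<lambda>h z. indicator ?I z * H0 (t + h) z)"
  \<comment> \<open>The increment splits into two difference quotients: T1 lets the semigroup act on
    the smooth g, T2 moves H in time. No space derivative of H enters before the limit.\<close>
  define T1 where "T1 = (\<lambda>h z. indicator S z * rho z * F h z * (((\<integral>y. pd h z y * g y \<partial>lborel) - g z) / h))"
  define T2 where "T2 = (\<lambda>h z. indicator S z * rho z * g z * ((H0 (t + h) z - H0 t z) / h))"
  have rhoI: "continuous_on ?I rho" by (rule continuous_on_subset[OF continuous_rho sub3])
  have rho_pos: "0 \<le> rho z" if "z \<in> ?I" for z using speed_pos[of z] sub3 that by auto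
  have H0m: "H0 (t + h) \<in> borel_measurable borel" if "0 \<le> h" for h using t that by (auto intro: H0_measurable)
  have H0b: "0 \<le> H0 (t + h) z" "H0 (t + h) z \<le> 1" if "0 \<le> h" for h z using t that by (auto intro: H0_bounds)
  have Fm: "F h \<in> borel_measurable borel" if "0 \<le> h" for h unfolding F_def using H0m[OF that] by simp
  have Fb: "\<bar>F h z\<bar> \<le> 1" if "0 \<le> h" for h z using H0b[OF that, of z] by (auto simp: F_def indicator_def)
  have F0: "F h z = 0" if "z \<notin> ?I" for h z using that by (simp add: F_def)
  have Vm: "(\<lambda>z. indicator S z * (\<integral>y. pd h z y * g y \<partial>lborel)) \<in> borel_measurable borel" if "0 < h" for h
    by (rule expectation_measurable[OF that gm])
  have T1m: "T1 h \<in> borel_measurable borel" if "0 < h" for h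
  proof -
    have "T1 h = (\<lambda>z. (indicator S z * rho z) * F h z * ((indicator S z * (\<integral>y. pd h z y * g y \<partial>lborel) - g z) / h))"
      by (auto simp: T1_def indicator_def)
    then show ?thesis using Vm[OF that] rho_measurable Fm[of h] that gm by simp
  qed
  have T2m: "T2 h \<in> borel_measurable borel" if "0 < h" for h
    unfolding T2_def using rho_measurable gm H0m[of h] H0m[of 0] that by simp
  have w1: "integrable lborel (\<lambda>z. indicator ?I z * (rho z * C))"
    by (intro lborel_integral_Icc continuous_intros rhoI)
  have w2: "integrable lborel (\<lambda>z. indicator ?I z * (rho z * \<bar>g z\<bar> * M))"
    by (intro lborel_integral_Icc continuous_intros rhoI continuous_on_subset[OF gd(3)]) auto
  have T1b: "\<bar>T1 h z\<bar> \<le> indicator ?I z * (rho z * C)" if h: "0 < h" for h z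
  proof (cases "z \<in> ?I")
    case True
    then have zS: "z \<in> S" using sub3 by auto
    have "\<bar>((\<integral>y. pd h z y * g y \<partial>lborel) - g z) / h\<bar> \<le> C"
      using C(2)[OF zS h] h by (simp add: abs_divide field_simps)
    then have "\<bar>F h z\<bar> * \<bar>((\<integral>y. pd h z y * g y \<partial>lborel) - g z) / h\<bar> \<le> 1 * C"
      using Fb[of h z] h by (intro mult_mono) auto
    then have "rho z * (\<bar>F h z\<bar> * \<bar>((\<integral>y. pd h z y * g y \<partial>lborel) - g z) / h\<bar>) \<le> rho z * C"
      using rho_pos[OF True] by (intro mult_left_mono) auto
    then show ?thesis using True zS rho_pos[OF True] by (simp add: T1_def abs_mult mult.assoc)
  qed (simp add: T1_def F0)
  have T2b: "\<bar>T2 h z\<bar> \<le> indicator ?I z * (rho z * \<bar>g z\<bar> * M)" if h: "0 < h" "h < 1" for h z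
  proof (cases "z \<in> ?I")
    case True
    then have zS: "z \<in> S" using sub3 by auto
    have "\<bar>(H0 (t + h) z - H0 t z) / h\<bar> \<le> M"
      using M(2)[OF h True] h by (simp add: abs_divide field_simps)
    then have "rho z * \<bar>g z\<bar> * \<bar>(H0 (t + h) z - H0 t z) / h\<bar> \<le> rho z * \<bar>g z\<bar> * M"
      using rho_pos[OF True] by (intro mult_left_mono) auto
    then show ?thesis using True zS rho_pos[OF True] by (simp add: T2_def abs_mult)
  next
    case False
    then have "g z = 0" using r by (intro g0) (auto simp: abs_if split: if_splits)
    then show ?thesis by (simp add: T2_def False)
  qed
  have HcJ: "continuous_on ?J (Ht t)" "continuous_on ?J (Hyy t)"
  proof -
    have sub: "?J \<subseteq> S \<inter> {..f t}" using JS by (auto simp: c_def)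
    show "continuous_on ?J (Ht t)" by (rule continuous_on_subset[OF continuous_section[OF continuous_Ht t] sub])
    show "continuous_on ?J (Hyy t)" by (rule continuous_on_subset[OF continuous_section[OF continuous_Hyy t] sub])
  qed
  have HdJ: "(H t has_real_derivative Hy t z) (at z within ?J)" "(Hy t has_real_derivative Hyy t z) (at z within ?J)"
    if z: "z \<in> ?J" for z
  proof -
    have D: "(t, z) \<in> below_curve l f" using z t JS by (auto simp: in_below_curve c_def)
    have sub: "?J \<subseteq> {z. (t, z) \<in> below_curve l f}" using t JS by (auto simp: in_below_curve c_def)
    show "(H t has_real_derivative Hy t z) (at z within ?J)" "(Hy t has_real_derivative Hyy t z) (at z within ?J)"
      by (rule has_field_derivative_subset[OF _ sub], rule Hy[OF D] Hyy[OF D])+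
  qed
  have HJ: "continuous_on ?J (H t)" by (rule DERIV_continuous_on[OF HdJ(1)])
  have gJ: "continuous_on ?J g" "continuous_on ?J g1" "continuous_on ?J g2"
    using gd(3-5) by (auto intro: continuous_on_subset)
  have rhoJ: "continuous_on ?J rho" by (rule continuous_on_subset[OF continuous_rho JS])
  have gout: "g z = 0" "g1 z = 0" "g2 z = 0" if "\<bar>z - c\<bar> \<ge> 2 * r" for z
    using g0[OF that] C2_with_zero_outside[OF g g0 that] by auto
  define L1 where "L1 = (\<lambda>z. indicator ?J z * (H t z * flux_deriv g1 g2 z))"
  define L2 where "L2 = (\<lambda>z. indicator ?J z * (rho z * g z * Ht t z))"
  have c1: "continuous_on ?J (\<lambda>z. H t z * flux_deriv g1 g2 z)"
    by (intro continuous_intros HJ continuous_flux_deriv JS gJ)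
  have c2: "continuous_on ?J (\<lambda>z. rho z * g z * Ht t z)"
    by (intro continuous_intros rhoJ gJ HcJ)
  note L1i = lborel_integral_Icc[OF c1, folded L1_def] and L2i = lborel_integral_Icc[OF c2, folded L2_def]
  have lim1: "((\<lambda>h. T1 h z) \<longlongrightarrow> L1 z) (at_right 0)" for z
  proof (cases "z \<in> ?I")
    case True
    then have zS: "z \<in> S" using sub3 by auto
    have "((\<lambda>h. H0 (t + h) z - H0 t z) \<longlongrightarrow> 0) (at_right 0)"
    proof (rule Lim_null_comparison)
      show "\<forall>\<^sub>F h in at_right 0. norm (H0 (t + h) z - H0 t z) \<le> M * h"
        using eventually_at_right_real[OF zero_less_one] by eventually_elim (use M(2) True in auto)
      show "((\<lambda>h. M * h) \<longlongrightarrow> 0) (at_right 0)" by (auto intro!: tendsto_eq_intros)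
    qed
    then have "((\<lambda>h. H0 (t + h) z) \<longlongrightarrow> H0 t z) (at_right 0)" by (rule LIM_zero_cancel)
    then have "((\<lambda>h. T1 h z) \<longlongrightarrow> indicator S z * rho z * (indicator ?I z * H0 t z) * (flux_deriv g1 g2 z / rho z)) (at_right 0)"
      unfolding T1_def F_def by (intro tendsto_intros generator_limit[OF g g0 sub2 r2 zS])
    moreover have "indicator S z * rho z * (indicator ?I z * H0 t z) * (flux_deriv g1 g2 z / rho z) = L1 z"
    proof (cases "z \<le> c")
      case zc: True
      then show ?thesis using True zS speed_pos[OF zS] H0_eq_H[OF t0 zS] by (simp add: L1_def c_def)
    next
      case False
      then show ?thesis by (simp add: L1_def c_def H0_def)
    qed
    ultimately show ?thesis by simp
  next
    case False
    then have "z \<notin> ?J" using r by auto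
    then have "L1 z = 0" by (simp add: L1_def)
    then show ?thesis using False by (simp add: T1_def F0)
  qed
  \<comment> \<open>The point c is excluded: there the curve may move to either side of z. A single
    point does not affect the integral.\<close>
  have lim2: "((\<lambda>h. T2 h z) \<longlongrightarrow> L2 z) (at_right 0)" if zc: "z \<noteq> c" for z
  proof -
    consider "z \<notin> ?I" | "z \<in> ?I" "z < c" | "z \<in> ?I" "c < z" using zc by linarith
    then show ?thesis
    proof cases
      case 1
      then have "g z = 0" using r by (intro g0) (auto simp: abs_if split: if_splits)
      then show ?thesis by (simp add: T2_def L2_def)
    next
      case 2
      then have zS: "z \<in> S" and zf: "z < f t" using sub3 by (auto simp: c_def)
      have op: "\<forall>\<^sub>F h in at_right 0. 0 < t + h \<and> z < f (t + h)"
      proof -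
        have "\<forall>\<^sub>F u in nhds t. 0 < u \<and> z < f u"
          using open_below_time[of z] t zf by (auto simp: eventually_nhds)
        moreover have "filterlim (\<lambda>h. t + h) (nhds t) (at_right 0)" by (auto intro!: tendsto_eq_intros)
        ultimately show ?thesis by (rule eventually_compose_filterlim)
      qed
      have "((\<lambda>h. (H (t + h) z - H t z) / h) \<longlongrightarrow> Ht t z) (at_right 0)"
        using H_derivs_below(1)[OF t zS zf] unfolding DERIV_def by (rule tendsto_mono[OF at_le, rotated]) simp
      moreover have "\<forall>\<^sub>F h in at_right 0. (H (t + h) z - H t z) / h = (H0 (t + h) z - H0 t z) / h"
        using op by eventually_elim (use zS zf in \<open>simp add: H0_def\<close>)
      ultimately have "((\<lambda>h. (H0 (t + h) z - H0 t z) / h) \<longlongrightarrow> Ht t z) (at_right 0)"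
        by (rule Lim_transform_eventually)
      then have "((\<lambda>h. T2 h z) \<longlongrightarrow> indicator S z * rho z * g z * Ht t z) (at_right 0)"
        unfolding T2_def by (intro tendsto_intros)
      then show ?thesis using 2 zS by (simp add: L2_def)
    next
      case 3
      have "continuous_on {0<..} f" by (rule continuous_on_subset[OF f_cont]) auto
      then have "isCont f t" using t by (simp add: continuous_on_eq_continuous_at)
      then have "(f \<longlongrightarrow> f t) (nhds t)" by (simp add: isCont_def tendsto_at_iff_tendsto_nhds)
      then have "\<forall>\<^sub>F u in nhds t. f u < z" by (rule order_tendstoD(2)) (use 3 in \<open>simp add: c_def\<close>)
      moreover have "filterlim (\<lambda>h. t + h) (nhds t) (at_right 0)" by (auto intro!: tendsto_eq_intros)
      ultimately have "\<forall>\<^sub>F h in at_right 0. f (t + h) < z" by (rule eventually_compose_filterlim)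
      then have "\<forall>\<^sub>F h in at_right 0. T2 h z = 0"
        by eventually_elim (use 3 in \<open>auto simp: T2_def H0_def c_def\<close>)
      then show ?thesis using 3 by (simp add: L2_def tendsto_eventually)
    qed
  qed
  have int1: "((\<lambda>h. \<integral>z. T1 h z \<partial>lborel) \<longlongrightarrow> (\<integral>z. L1 z \<partial>lborel)) (at_right 0)"
    by (rule dominated_convergence_at_right[OF zero_less_one _ _ w1])
      (use L1i(1) T1m T1b lim1 in \<open>auto dest: borel_measurable_integrable\<close>)
  have int2: "((\<lambda>h. \<integral>z. T2 h z \<partial>lborel) \<longlongrightarrow> (\<integral>z. L2 z \<partial>lborel)) (at_right 0)"
  proof (rule dominated_convergence_at_right[OF zero_less_one _ _ w2])
    show "AE z in lborel. ((\<lambda>h. T2 h z) \<longlongrightarrow> L2 z) (at_right 0)"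
      using AE_lborel_singleton[of c] by eventually_elim (rule lim2)
  qed (use L2i(1) T2m T2b in \<open>auto dest: borel_measurable_integrable\<close>)
  have green: "(\<integral>z. L1 z \<partial>lborel) + (\<integral>z. L2 z \<partial>lborel) = last_passage_density x t"
  proof -
    \<comment> \<open>The backward equation is available strictly below the curve, so the integrands
      are compared off the single point c.\<close>
    have "integral ?J (\<lambda>z. rho z * g z * Ht t z) = integral ?J (\<lambda>z. - (g z * flux_deriv (Hy t) (Hyy t) z))"
    proof (rule integral_spike[of "{c}"])
      fix z assume z: "z \<in> ?J - {c}"
      then have "z \<in> S" "z < f t" using JS by (auto simp: c_def)
      from backward_equation_H[OF t this]
      have "rho z * Ht t z = - flux_deriv (Hy t) (Hyy t) z" by simp
      then have "g z * (rho z * Ht t z) = g z * (- flux_deriv (Hy t) (Hyy t) z)" by (rule arg_cong)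
      then show "- (g z * flux_deriv (Hy t) (Hyy t) z) = rho z * g z * Ht t z" by (simp add: mult_ac)
    qed simp
    \<comment> \<open>At c - 3 r the cutoff kills both boundary terms. At c the function H vanishes,
      so the only survivor is the product of g with the one-sided derivative of H.\<close>
    moreover have "integral ?J (\<lambda>z. H t z * flux_deriv g1 g2 z) - integral ?J (\<lambda>z. g z * flux_deriv (Hy t) (Hyy t) z) =
      (H t c * g1 c / deriv s c - g c * Hy t c / deriv s c) -
      (H t (c - 3 * r) * g1 (c - 3 * r) / deriv s (c - 3 * r) - g (c - 3 * r) * Hy t (c - 3 * r) / deriv s (c - 3 * r))"
    proof (rule green[OF _ JS])
      fix z assume z: "z \<in> ?J"
      show "(H t has_real_derivative Hy t z) (at z within ?J)" "(Hy t has_real_derivative Hyy t z) (at z within ?J)"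
        by (rule HdJ[OF z])+
      show "(g has_real_derivative g1 z) (at z within ?J)" "(g1 has_real_derivative g2 z) (at z within ?J)"
        by (rule has_field_derivative_at_within, rule gd)+
    qed (use r gJ HcJ in auto)
    moreover have "H t c = 0" unfolding c_def by (rule H_on_curve[OF t0])
    moreover have "g (c - 3 * r) = 0" "g1 (c - 3 * r) = 0" using gout[of "c - 3 * r"] r by auto
    ultimately show ?thesis
      unfolding L1i(2) L2i(2) last_passage_density_def by (simp add: gc flip: c_def)
  qed
  have main: "\<bar>(U 0 (t + h) x - U 0 t x) / h - ((\<integral>z. T1 h z \<partial>lborel) + (\<integral>z. T2 h z \<partial>lborel))\<bar> \<le> K1 h / h + K2 h / h"
    if h: "0 < h" "h < 1" and K1h: "\<forall>y\<in>S. \<bar>y - f t\<bar> \<ge> r \<longrightarrow> measure (P y) (hit_curve t h) \<le> K1 h" for h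
  proof -
    have h0: "0 \<le> h" using h by simp
    \<comment> \<open>V is \<open>U t h\<close> with the position at time h confined to
      \<open>?I\<close>, which gives the compact support that the symmetry argument
      requires.\<close>
    define V where "V = (\<lambda>y. indicator S y * (\<integral>z. pd h y z * F h z \<partial>lborel))"
    have Vmeas: "V \<in> borel_measurable borel" unfolding V_def by (rule expectation_measurable[OF h(1) Fm[OF h0]])
    have Vb: "\<bar>V y\<bar> \<le> 1" for y
      using expectation_le[OF h(1), of y "F h" 1] Fb[OF h0] by (cases "y \<in> S") (auto simp: V_def)
    have Um: "U t h \<in> borel_measurable borel" "H0 t \<in> borel_measurable borel"
      using U_measurable[OF t0 h0] H0_measurable[OF t0] by auto
    have e1: "U 0 (t + h) x = (\<integral>y. pd t x y * U t h y \<partial>lborel)" using U_markov[OF x t _ h0, of 0] by simp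
    have e2: "U 0 t x = (\<integral>y. pd t x y * H0 t y \<partial>lborel)"
      using U_markov[OF x t, of 0 0] U_zero[OF t0] by simp
    have H0b': "0 \<le> H0 t y" "H0 t y \<le> 1" for y using H0b[of 0 y] by auto
    have \<phi>b: "\<bar>\<phi> y * v\<bar> \<le> 1" if "\<bar>v\<bar> \<le> 1" for y v
      unfolding abs_mult using \<phi>(2,3)[of y] that by (intro mult_le_one) auto
    have i1: "integrable lborel (\<lambda>y. pd t x y * U t h y)"
      by (rule integrable_pd[OF t x, of _ 1]) (use Um U_bounds in auto)
    have i2: "integrable lborel (\<lambda>y. pd t x y * H0 t y)"
      by (rule integrable_pd[OF t x, of _ 1]) (use Um H0b' in auto)
    have i3: "integrable lborel (\<lambda>y. pd t x y * (\<phi> y * V y))"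
      by (rule integrable_pd[OF t x, of _ 1]) (use Vmeas \<phi>m \<phi>b Vb in auto)
    have i4: "integrable lborel (\<lambda>y. pd t x y * (\<phi> y * H0 t y))"
      by (rule integrable_pd[OF t x, of _ 1]) (use Um \<phi>m \<phi>b H0b' in auto)
    \<comment> \<open>A is the part of the increment accessible to symmetry: \<phi> cuts off the
      starting point of the time step, V its end point.\<close>
    define A where "A = (\<integral>y. pd t x y * (\<phi> y * V y) \<partial>lborel) - (\<integral>y. pd t x y * (\<phi> y * H0 t y) \<partial>lborel)"
    have "U 0 (t + h) x - U 0 t x - A =
        (\<integral>y. pd t x y * (U t h y - H0 t y - (\<phi> y * V y - \<phi> y * H0 t y)) \<partial>lborel)"
      unfolding e1 e2 A_def using i1 i2 i3 i4
      by (simp add: right_diff_distrib flip: Bochner_Integration.integral_diff)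
    also have "\<bar>\<dots>\<bar> \<le> K1 h + K2 h"
    proof (rule expectation_le[OF t x])
      fix y assume y: "y \<in> S"
      have inc: "0 \<le> U t h y - H0 t y" "U t h y - H0 t y \<le> measure (P y) (hit_curve t h)"
        using U_increment[OF t0 h0 y] U_zero[OF t0] by auto
      have K1pos: "0 \<le> K1 h"
      proof -
        have "c + r \<in> S" using sub1 r by auto
        then have "measure (P (c + r)) (hit_curve t h) \<le> K1 h" using K1h r by (auto simp: c_def)
        then show ?thesis using measure_nonneg order_trans by blast
      qed
      have K2pos: "0 \<le> K2 h"
      proof -
        have "0 \<le> (\<integral>z. pd h c z * indicator {z. \<bar>z - c\<bar> \<ge> 3 * r} z \<partial>lborel)"
          using pd_nonneg[OF h(1) cS] by (intro integral_nonneg_AE AE_I2) auto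
        also have "\<dots> \<le> K2 h" by (rule K2(2)[OF cS _ h(1)]) (use r in simp)
        finally show ?thesis .
      qed
      \<comment> \<open>Where \<phi> differs from 1 the starting point is farther than r from c, so
        the curve is touched within h with probability at most \<open>K1 h\<close>.\<close>
      have a: "\<bar>(1 - \<phi> y) * (U t h y - H0 t y)\<bar> \<le> K1 h"
      proof (cases "\<bar>y - c\<bar> \<le> r")
        case True then show ?thesis using \<phi>(4) K1pos by simp
      next
        case False
        then have "U t h y - H0 t y \<le> K1 h" using inc K1h y by (auto simp: c_def)
        then have "(1 - \<phi> y) * (U t h y - H0 t y) \<le> 1 * K1 h"
          using \<phi>(2,3)[of y] inc by (intro mult_mono) auto
        then show ?thesis using \<phi>(3)[of y] inc by simp
      qed
      \<comment> \<open>On the support of \<phi>, passing from U to V loses only paths that get from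
        within 2 r to distance at least 3 r in time h.\<close>
      have b: "\<bar>\<phi> y * (U t h y - V y)\<bar> \<le> K2 h"
      proof (cases "\<bar>y - c\<bar> \<le> 2 * r")
        case False then show ?thesis using \<phi>(5)[of y] K2pos by simp
      next
        case True
        have Uy: "U t h y = (\<integral>z. pd h y z * H0 (t + h) z \<partial>lborel)"
          using U_markov[OF y h(1) t0, of 0] U_zero[of "t + h"] t0 h0 by simp
        have j1: "integrable lborel (\<lambda>z. pd h y z * H0 (t + h) z)"
          by (rule integrable_pd[OF h(1) y, of _ 1]) (use H0m[OF h0] H0b[OF h0] in auto)
        have j2: "integrable lborel (\<lambda>z. pd h y z * F h z)"
          by (rule integrable_pd[OF h(1) y, of _ 1]) (use Fm[OF h0] Fb[OF h0] in auto)
        have j3: "integrable lborel (\<lambda>z. pd h y z * indicator {z. \<bar>z - c\<bar> \<ge> 3 * r} z)"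
          by (rule integrable_pd[OF h(1) y, of _ 1]) (auto simp: indicator_def)
        have UV: "U t h y - V y = (\<integral>z. pd h y z * (H0 (t + h) z - F h z) \<partial>lborel)"
          unfolding V_def Uy using y j1 j2 by (simp add: right_diff_distrib flip: Bochner_Integration.integral_diff)
        have dom: "0 \<le> H0 (t + h) z - F h z" "H0 (t + h) z - F h z \<le> indicator {z. \<bar>z - c\<bar> \<ge> 3 * r} z" for z
          using H0b[OF h0, of z] by (auto simp: F_def indicator_def abs_if split: if_splits)
        have "0 \<le> U t h y - V y"
          unfolding UV using pd_nonneg[OF h(1) y] dom(1) by (intro integral_nonneg_AE AE_I2) auto
        moreover have "U t h y - V y \<le> (\<integral>z. pd h y z * indicator {z. \<bar>z - c\<bar> \<ge> 3 * r} z \<partial>lborel)"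
          unfolding UV using pd_nonneg[OF h(1) y] dom(2)
          by (intro integral_mono'[OF j3] mult_left_mono) auto
        then have "U t h y - V y \<le> K2 h" using K2(2)[OF y True h(1)] by linarith
        ultimately have "\<bar>U t h y - V y\<bar> \<le> K2 h" by simp
        then have "\<bar>\<phi> y\<bar> * \<bar>U t h y - V y\<bar> \<le> 1 * K2 h"
          using \<phi>(2,3)[of y] by (intro mult_mono) auto
        then show ?thesis by (simp add: abs_mult)
      qed
      have "U t h y - H0 t y - (\<phi> y * V y - \<phi> y * H0 t y) = (1 - \<phi> y) * (U t h y - H0 t y) + \<phi> y * (U t h y - V y)"
        by (simp add: algebra_simps)
      then show "\<bar>U t h y - H0 t y - (\<phi> y * V y - \<phi> y * H0 t y)\<bar> \<le> K1 h + K2 h" using a b by linarith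
    qed
    finally have A: "\<bar>U 0 (t + h) x - U 0 t x - A\<bar> \<le> K1 h + K2 h" .
    \<comment> \<open>Here \<open>pd t x\<close> times \<phi> is rho times g, and symmetry transfers
      the transition over time h from F to g.\<close>
    have "(\<integral>y. pd t x y * (\<phi> y * V y) \<partial>lborel) = (\<integral>y. indicator S y * rho y * g y * (\<integral>z. pd h y z * F h z \<partial>lborel) \<partial>lborel)"
      by (rule Bochner_Integration.integral_cong) (auto simp: pd_def g_def V_def indicator_def)
    also have "\<dots> = (\<integral>z. indicator S z * rho z * F h z * (\<integral>y. pd h z y * g y \<partial>lborel) \<partial>lborel)"
    proof (rule symmetric_integral[OF h(1) sub3 sub3 gd(3) _ Fm[OF h0] Fb[OF h0] F0])
      show "g y = 0" if "y \<notin> ?I" for y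
        using that r by (intro g0) (auto simp: abs_if split: if_splits)
    qed
    \<comment> \<open>Insert g and then \<open>H0 t\<close>: the expectation of g is g plus h times
      its quotient, and \<open>H0 (t + h)\<close> is \<open>H0 t\<close> plus h times its quotient.
      The remaining product of g and \<open>H0 t\<close> cancels the second integral in A.\<close>
    also have "\<dots> = (\<integral>z. h * T1 h z + h * T2 h z + indicator ?I z * (rho z * g z) * H0 t z \<partial>lborel)"
    proof (rule Bochner_Integration.integral_cong[OF refl])
      fix z
      show "indicator S z * rho z * F h z * (\<integral>y. pd h z y * g y \<partial>lborel) =
          h * T1 h z + h * T2 h z + indicator ?I z * (rho z * g z) * H0 t z"
      proof (cases "z \<in> ?I")
        case True
        then have "z \<in> S" using sub3 by auto
        then show ?thesis using True h by (simp add: T1_def T2_def F_def field_simps)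
      next
        case False
        then have "g z = 0" using r by (intro g0) (auto simp: abs_if split: if_splits)
        then show ?thesis using False by (simp add: T1_def T2_def F0)
      qed
    qed
    also have "\<dots> = h * (\<integral>z. T1 h z \<partial>lborel) + h * (\<integral>z. T2 h z \<partial>lborel) + (\<integral>z. indicator ?I z * (rho z * g z) * H0 t z \<partial>lborel)"
    proof -
      have k1: "integrable lborel (T1 h)"
        by (rule Bochner_Integration.integrable_bound[OF w1]) (use T1m[OF h(1)] T1b[OF h(1)] in \<open>auto intro!: AE_I2 intro: order_trans[OF _ abs_ge_self]\<close>)
      have k2: "integrable lborel (T2 h)"
        by (rule Bochner_Integration.integrable_bound[OF w2]) (use T2m[OF h(1)] T2b[OF h] in \<open>auto intro!: AE_I2 intro: order_trans[OF _ abs_ge_self]\<close>)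
      have w3: "integrable lborel (\<lambda>z. indicator ?I z * (rho z * g z))"
        by (intro lborel_integral_Icc continuous_intros rhoI continuous_on_subset[OF gd(3)]) auto
      have k3: "integrable lborel (\<lambda>z. indicator ?I z * (rho z * g z) * H0 t z)"
      proof (rule Bochner_Integration.integrable_bound[OF w3])
        show "(\<lambda>z. indicator ?I z * (rho z * g z) * H0 t z) \<in> borel_measurable lborel"
          using borel_measurable_integrable[OF w3] Um(2) by simp
        show "AE z in lborel. norm (indicator ?I z * (rho z * g z) * H0 t z) \<le> norm (indicator ?I z * (rho z * g z))"
          using H0b' by (intro AE_I2) (simp add: abs_mult mult_left_le)
      qed
      show ?thesis using k1 k2 k3 by simp
    qed
    also have "(\<integral>z. indicator ?I z * (rho z * g z) * H0 t z \<partial>lborel) = (\<integral>y. pd t x y * (\<phi> y * H0 t y) \<partial>lborel)"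
    proof (rule Bochner_Integration.integral_cong[OF refl])
      fix z
      show "indicator ?I z * (rho z * g z) * H0 t z = pd t x z * (\<phi> z * H0 t z)"
      proof (cases "z \<in> ?I")
        case True
        then show ?thesis using sub3 by (auto simp: pd_def g_def)
      next
        case False
        then have "\<phi> z = 0" using r by (intro \<phi>(5)) (auto simp: abs_if split: if_splits)
        then show ?thesis using False by simp
      qed
    qed
    finally have "A = h * ((\<integral>z. T1 h z \<partial>lborel) + (\<integral>z. T2 h z \<partial>lborel))"
      by (simp add: A_def algebra_simps)
    then have "(U 0 (t + h) x - U 0 t x) / h - ((\<integral>z. T1 h z \<partial>lborel) + (\<integral>z. T2 h z \<partial>lborel)) =
        (U 0 (t + h) x - U 0 t x - A) / h"
      using h by (simp add: diff_divide_distrib)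
    also have "\<bar>\<dots>\<bar> \<le> (K1 h + K2 h) / h"
      unfolding abs_divide using A h by (simp add: divide_right_mono)
    finally show ?thesis by (simp add: add_divide_distrib)
  qed
  have "((\<lambda>h. (U 0 (t + h) x - U 0 t x) / h - ((\<integral>z. T1 h z \<partial>lborel) + (\<integral>z. T2 h z \<partial>lborel))) \<longlongrightarrow> 0) (at_right 0)"
  proof (rule Lim_null_comparison)
    show "\<forall>\<^sub>F h in at_right 0. norm ((U 0 (t + h) x - U 0 t x) / h - ((\<integral>z. T1 h z \<partial>lborel) + (\<integral>z. T2 h z \<partial>lborel))) \<le> K1 h / h + K2 h / h"
      using eventually_at_right_real[OF zero_less_one] K1(2)
      by eventually_elim (use main in auto)
    show "((\<lambda>h. K1 h / h + K2 h / h) \<longlongrightarrow> 0) (at_right 0)" using tendsto_add[OF K1(1) K2(1)] by simp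
  qed
  from tendsto_add[OF this tendsto_add[OF int1 int2]]
  show ?thesis by (simp add: green)
qed

end

section \<open>The density of the last passage time\<close>

context curve_passage
begin

text \<open>Despite its name this is the distribution function of the last passage time, taken with
  strict inequality: that is the event of no contact from t on, and it makes the function left
  continuous.\<close>

definition survival :: "real \<Rightarrow> real \<Rightarrow> real" where
  "survival x t = measure (P x) {\<omega> \<in> \<Omega>. last_passage f \<omega> < ennreal t}"

lemma last_passage_events [measurable]:
  "{\<omega> \<in> \<Omega>. last_passage f \<omega> < a} \<in> sets (path_space l)" "{\<omega> \<in> \<Omega>. last_passage f \<omega> \<le> a} \<in> sets (path_space l)"
proof -
  note [measurable] = last_passage_measurable[OF f_cont, of l]
  show "{\<omega> \<in> \<Omega>. last_passage f \<omega> < a} \<in> sets (path_space l)" "{\<omega> \<in> \<Omega>. last_passage f \<omega> \<le> a} \<in> sets (path_space l)"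
    by measurable
qed

text \<open>Last passage before t only says that the curve is avoided from t on. As the path is
  eventually below the curve, the intermediate value theorem places it below already at time
  t.\<close>

lemma survival_eq_U:
  assumes x: "x \<in> S" and t: "0 < t"
  shows "survival x t = U 0 t x"
proof -
  interpret prob_space "P x" by (rule P_kernel(1)[OF x])
  have "survival x t = measure (P x) (below_after 0 t)"
    unfolding survival_def
  proof (rule measure_eq_AE)
    show "AE \<omega> in P x. \<omega> \<in> {\<omega> \<in> \<Omega>. last_passage f \<omega> < ennreal t} \<longleftrightarrow> \<omega> \<in> below_after 0 t"
      using f_below[OF x] AE_start[OF x]
    proof eventually_elim
      fix \<omega> assume e: "ends_below f \<omega>" and w: "\<omega> 0 = x \<and> \<omega> \<in> \<Omega>"
      then have c: "continuous_on {0..} \<omega>" using path_spaceD(1) by blast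
      have "\<omega> t < f t" if nh: "\<forall>u\<ge>t. \<omega> u \<noteq> f u"
      proof (rule ccontr)
        assume nl: "\<not> \<omega> t < f t"
        obtain L :: ereal where L: "L < 0" "((\<lambda>t. ereal (\<omega> t - f t)) \<longlongrightarrow> L) at_top"
          using e by (auto simp: ends_below_def)
        from order_tendstoD(2)[OF L(2,1)]
        have "\<forall>\<^sub>F u in at_top. \<omega> u - f u < 0" by simp
        then obtain u0 where "\<And>u. u \<ge> u0 \<Longrightarrow> \<omega> u - f u < 0" unfolding eventually_at_top_linorder by blast
        then have u1: "\<omega> (max u0 t) < f (max u0 t)" by (metis diff_less_0_iff_less max.cobounded1)
        obtain v where "t \<le> v" "\<omega> v = f v"
          by (rule crossing[OF c f_cont, of t "max u0 t"]) (use u1 t nl in \<open>auto simp: not_less\<close>)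
        then show False using nh by blast
      qed
      then show "\<omega> \<in> {\<omega> \<in> \<Omega>. last_passage f \<omega> < ennreal t} \<longleftrightarrow> \<omega> \<in> below_after 0 t"
        using w last_passage_less_iff[OF c f_cont t] by (auto simp: below_after_def)
    qed
  qed (use t below_after_measurable[of 0 t] last_passage_events in \<open>auto simp: P_kernel(2)[OF x]\<close>)
  then show ?thesis using x by (simp add: U_def)
qed

lemma survival_mono:
  assumes "x \<in> S" "a \<le> b"
  shows "survival x a \<le> survival x b"
proof -
  interpret prob_space "P x" by (rule P_kernel(1)[OF assms(1)])
  show ?thesis
    unfolding survival_def
    by (rule finite_measure_mono)
      (use assms last_passage_events in \<open>auto simp: P_kernel(2)[OF assms(1)] intro: order.strict_trans2 ennreal_leI\<close>)
qed

text \<open>The limit from the right also counts the paths with last passage exactly at a. For a = 0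
  this is the mass at 0, which the density on positive times must leave out.\<close>

lemma survival_right_limit:
  assumes x: "x \<in> S" and a: "0 \<le> a"
  shows "(survival x \<longlongrightarrow> measure (P x) {\<omega> \<in> \<Omega>. last_passage f \<omega> \<le> ennreal a}) (at_right a)"
proof (rule tendsto_at_right_sequentially[of a "a + 1"])
  interpret prob_space "P x" by (rule P_kernel(1)[OF x])
  fix X :: "nat \<Rightarrow> real" assume X: "\<And>n. a < X n" "decseq X" "X \<longlonglongrightarrow> a"
  have "(\<lambda>n. measure (P x) {\<omega> \<in> \<Omega>. last_passage f \<omega> < ennreal (X n)}) \<longlonglongrightarrow>
      measure (P x) (\<Inter>n. {\<omega> \<in> \<Omega>. last_passage f \<omega> < ennreal (X n)})"
  proof (rule finite_Lim_measure_decseq)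
    show "decseq (\<lambda>n. {\<omega> \<in> \<Omega>. last_passage f \<omega> < ennreal (X n)})"
      using X(2) by (auto simp: decseq_def intro: order.strict_trans2 ennreal_leI)
  qed (use last_passage_events in \<open>auto simp: P_kernel(2)[OF x]\<close>)
  moreover have "(\<Inter>n. {\<omega> \<in> \<Omega>. last_passage f \<omega> < ennreal (X n)}) = {\<omega> \<in> \<Omega>. last_passage f \<omega> \<le> ennreal a}"
  proof -
    have "z \<le> ennreal a" if "\<And>n. z < ennreal (X n)" for z
    proof (rule LIMSEQ_le_const)
      show "(\<lambda>n. ennreal (X n)) \<longlonglongrightarrow> ennreal a" by (rule tendsto_ennrealI[OF X(3)])
      show "\<exists>N. \<forall>n\<ge>N. z \<le> ennreal (X n)" using that by (auto intro: less_imp_le)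
    qed
    moreover have "z < ennreal (X n)" if "z \<le> ennreal a" for z n
      using that ennreal_lessI[OF _ X(1)[of n]] a X(1)[of n] by (meson le_less_trans order.strict_trans1)
    ultimately show ?thesis by blast
  qed
  ultimately show "(\<lambda>n. survival x (X n)) \<longlonglongrightarrow> measure (P x) {\<omega> \<in> \<Omega>. last_passage f \<omega> \<le> ennreal a}"
    by (simp add: survival_def)
qed simp

lemma survival_left_continuous:
  assumes x: "x \<in> S" and t: "0 < t"
  shows "(survival x \<longlongrightarrow> survival x t) (at_left t)"
proof (rule tendsto_at_left_sequentially[of 0 t])
  interpret prob_space "P x" by (rule P_kernel(1)[OF x])
  fix X :: "nat \<Rightarrow> real" assume X: "\<And>n. X n < t" "\<And>n. 0 < X n" "incseq X" "X \<longlonglongrightarrow> t"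
  have "(\<lambda>n. measure (P x) {\<omega> \<in> \<Omega>. last_passage f \<omega> < ennreal (X n)}) \<longlonglongrightarrow>
      measure (P x) (\<Union>n. {\<omega> \<in> \<Omega>. last_passage f \<omega> < ennreal (X n)})"
  proof (rule finite_Lim_measure_incseq)
    show "incseq (\<lambda>n. {\<omega> \<in> \<Omega>. last_passage f \<omega> < ennreal (X n)})"
      using X(3) by (auto simp: incseq_def intro: order.strict_trans2 ennreal_leI)
  qed (use last_passage_events in \<open>auto simp: P_kernel(2)[OF x]\<close>)
  moreover have "(\<Union>n. {\<omega> \<in> \<Omega>. last_passage f \<omega> < ennreal (X n)}) = {\<omega> \<in> \<Omega>. last_passage f \<omega> < ennreal t}"
  proof -
    have "\<exists>n. z < ennreal (X n)" if "z < ennreal t" for z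
    proof -
      have "(\<lambda>n. ennreal (X n)) \<longlonglongrightarrow> ennreal t" by (rule tendsto_ennrealI[OF X(4)])
      from order_tendstoD(1)[OF this that] show ?thesis
        using eventually_happens'[OF sequentially_bot] by blast
    qed
    moreover have "z < ennreal t" if "z < ennreal (X n)" for z n
      using that ennreal_leI[OF less_imp_le[OF X(1)[of n]]] by (rule order.strict_trans2)
    ultimately show ?thesis by blast
  qed
  ultimately show "(\<lambda>n. survival x (X n)) \<longlonglongrightarrow> survival x t"
    by (simp add: survival_def)
qed (use t in simp)

lemma survival_at_top:
  assumes x: "x \<in> S"
  shows "(survival x \<longlongrightarrow> measure (P x) {\<omega> \<in> \<Omega>. last_passage f \<omega> < \<infinity>}) at_top"
proof (rule tendsto_at_topI_sequentially_real)
  interpret prob_space "P x" by (rule P_kernel(1)[OF x])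
  show "mono (survival x)" by (rule monoI) (rule survival_mono[OF x])
  have "(\<lambda>n. measure (P x) {\<omega> \<in> \<Omega>. last_passage f \<omega> < ennreal (real n)}) \<longlonglongrightarrow>
      measure (P x) (\<Union>n. {\<omega> \<in> \<Omega>. last_passage f \<omega> < ennreal (real n)})"
  proof (rule finite_Lim_measure_incseq)
    show "incseq (\<lambda>n. {\<omega> \<in> \<Omega>. last_passage f \<omega> < ennreal (real n)})"
    proof (rule monoI)
      fix m n :: nat assume "m \<le> n"
      then have "ennreal (real m) \<le> ennreal (real n)" by (intro ennreal_leI) simp
      then show "{\<omega> \<in> \<Omega>. last_passage f \<omega> < ennreal (real m)} \<subseteq> {\<omega> \<in> \<Omega>. last_passage f \<omega> < ennreal (real n)}"
        using order.strict_trans2 by blast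
    qed
  qed (use last_passage_events in \<open>auto simp: P_kernel(2)[OF x]\<close>)
  moreover have "(\<Union>n. {\<omega> \<in> \<Omega>. last_passage f \<omega> < ennreal (real n)}) = {\<omega> \<in> \<Omega>. last_passage f \<omega> < \<infinity>}"
  proof -
    have "\<exists>n. z < ennreal (real n)" if zfin: "z < \<infinity>" for z
    proof -
      obtain r where r: "z = ennreal r" "0 \<le> r" using zfin by (cases z) auto
      obtain n where "r < real n" using reals_Archimedean2 by blast
      then have "z < ennreal (real n)" unfolding r(1) using r(2) by (intro ennreal_lessI) auto
      then show ?thesis by blast
    qed
    moreover have "z < \<infinity>" if "z < ennreal (real n)" for z n
      using order.strict_trans[OF that ennreal_less_top] by simp
    ultimately show ?thesis by blast
  qed
  ultimately show "(\<lambda>n. survival x (real n)) \<longlonglongrightarrow> measure (P x) {\<omega> \<in> \<Omega>. last_passage f \<omega> < \<infinity>}"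
    by (simp add: survival_def)
qed

section \<open>Differentiability of the distribution function\<close>

lemma survival_right_derivative:
  assumes x: "x \<in> S" and t: "0 < t"
  shows "((\<lambda>h. (survival x (t + h) - survival x t) / h) \<longlongrightarrow> last_passage_density x t) (at_right 0)"
proof (rule Lim_transform_eventually[OF U_right_derivative[OF x t]])
  show "\<forall>\<^sub>F h in at_right 0. (U 0 (t + h) x - U 0 t x) / h = (survival x (t + h) - survival x t) / h"
    using eventually_at_right_less[of 0] by eventually_elim (use x t in \<open>simp add: survival_eq_U\<close>)
qed

text \<open>Continuity from the right follows from the existence of a right derivative, from the
  left from the strict inequality in the event.\<close>

lemma survival_continuous:
  assumes x: "x \<in> S"
  shows "continuous_on {0<..} (survival x)"
proof (rule continuous_at_imp_continuous_on, rule ballI)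
  fix t :: real assume "t \<in> {0<..}"
  then have t: "0 < t" by simp
  have "((\<lambda>h. (survival x (t + h) - survival x t) / h * h) \<longlongrightarrow> last_passage_density x t * 0) (at_right 0)"
    by (intro tendsto_mult survival_right_derivative[OF x t] tendsto_ident_at)
  then have "((\<lambda>h. (survival x (t + h) - survival x t) / h * h) \<longlongrightarrow> 0) (at_right 0)" by simp
  then have "((\<lambda>h. survival x (t + h) - survival x t) \<longlongrightarrow> 0) (at_right 0)"
    by (rule Lim_transform_eventually) (auto simp: eventually_at_filter)
  then have "((\<lambda>h. survival x (h + t)) \<longlongrightarrow> survival x t) (at_right 0)"
    by (simp add: LIM_zero_cancel add.commute)
  then have "(survival x \<longlongrightarrow> survival x t) (at_right t)" by (subst filterlim_at_right_to_0)
  then show "isCont (survival x) t"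
    using survival_left_continuous[OF x t] by (simp add: isCont_def filterlim_at_split)
qed

lemma last_passage_density_continuous:
  assumes x: "x \<in> S"
  shows "continuous_on {0<..} (last_passage_density x)"
proof -
  have cf: "continuous_on {0<..} f" by (rule continuous_on_subset[OF f_cont]) auto
  have "continuous_on {0<..} (\<lambda>t. case (t, f t) of (t, y) \<Rightarrow> Hy t y)"
    by (rule continuous_on_compose2[OF continuous_Hy])
      (use f_range cf in \<open>auto simp: in_below_curve intro!: continuous_intros\<close>)
  then have "continuous_on {0<..} (\<lambda>t. Hy t (f t))" by simp
  moreover have "continuous_on {0<..} (\<lambda>t. q t x (f t))"
    by (intro continuous_q_compose continuous_intros cf) (use x f_range in auto)
  moreover have "continuous_on {0<..} (\<lambda>t. deriv s (f t))"
    by (rule continuous_on_compose2[OF scale_derivs(2) cf]) (use f_range in auto)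
  ultimately show ?thesis
    unfolding last_passage_density_def
    by (intro continuous_intros) (use f_range scale_deriv_nz in auto)
qed

lemma survival_derivative:
  assumes "x \<in> S" "0 < t"
  shows "(survival x has_real_derivative last_passage_density x t) (at t)"
  by (rule continuous_right_derivative_imp_derivative[OF survival_continuous last_passage_density_continuous
      survival_right_derivative]) (use assms in auto)

text \<open>It is the right derivative of a monotone function. The sign is what yields integrability
  over an unbounded interval from the limits of the primitive.\<close>

lemma last_passage_density_nonneg:
  assumes x: "x \<in> S" and t: "0 < t"
  shows "0 \<le> last_passage_density x t"
proof (rule tendsto_lowerbound[OF survival_right_derivative[OF x t]])
  show "\<forall>\<^sub>F h in at_right 0. 0 \<le> (survival x (t + h) - survival x t) / h"
    using eventually_at_right_less[of 0]
    by eventually_elim (use survival_mono[OF x, of t] in \<open>simp add: divide_nonneg_pos\<close>)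
qed simp

section \<open>From the distribution function to the density\<close>

lemma last_passage_density_integral:
  assumes x: "x \<in> S" and a: "0 \<le> a"
  shows "set_integrable lborel {a<..} (last_passage_density x)"
    "(LINT t:{a<..}|lborel. last_passage_density x t) =
      measure (P x) {\<omega> \<in> \<Omega>. last_passage f \<omega> < \<infinity>} - measure (P x) {\<omega> \<in> \<Omega>. last_passage f \<omega> \<le> ennreal a}"
proof -
  have e: "einterval (ereal a) \<infinity> = {a<..}" by (auto simp: einterval_def)
  have A: "((survival x \<circ> real_of_ereal) \<longlongrightarrow> measure (P x) {\<omega> \<in> \<Omega>. last_passage f \<omega> \<le> ennreal a}) (at_right (ereal a))"
    using survival_right_limit[OF x a] by (simp add: at_right_ereal filterlim_filtermap comp_def)
  have B: "((survival x \<circ> real_of_ereal) \<longlongrightarrow> measure (P x) {\<omega> \<in> \<Omega>. last_passage f \<omega> < \<infinity>}) (at_left \<infinity>)"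
    using survival_at_top[OF x] by (simp add: at_left_PInf filterlim_filtermap comp_def)
  have cont: "isCont (last_passage_density x) t" if "a < t" for t
    using last_passage_density_continuous[OF x] that a by (auto simp: continuous_on_eq_continuous_at)
  \<comment> \<open>Only the limits of the primitive at the two ends enter, so a = 0 is allowed,
    where \<open>survival x\<close> need not be right continuous.\<close>
  note FTC = interval_integral_FTC_nonneg[of "ereal a" \<infinity> "survival x" "last_passage_density x", OF _ _ _ _ A B]
  have 1: "set_integrable lborel (einterval (ereal a) \<infinity>) (last_passage_density x)"
    by (rule FTC(1)) (use a x cont survival_derivative last_passage_density_nonneg in auto)
  have 2: "(LBINT t=ereal a..\<infinity>. last_passage_density x t) =
      measure (P x) {\<omega> \<in> \<Omega>. last_passage f \<omega> < \<infinity>} - measure (P x) {\<omega> \<in> \<Omega>. last_passage f \<omega> \<le> ennreal a}"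
    by (rule FTC(2)) (use a x cont survival_derivative last_passage_density_nonneg in auto)
  show "set_integrable lborel {a<..} (last_passage_density x)" using 1 by (simp add: e)
  show "(LINT t:{a<..}|lborel. last_passage_density x t) =
      measure (P x) {\<omega> \<in> \<Omega>. last_passage f \<omega> < \<infinity>} - measure (P x) {\<omega> \<in> \<Omega>. last_passage f \<omega> \<le> ennreal a}"
    using 2 by (simp add: interval_lebesgue_integral_def e)
qed

text \<open>Two measures on the line that agree and are finite on all right half-lines are equal.
  This is applied to the measure with density \<open>w\<close> and to the law of the last passage
  time restricted to positive finite values.\<close>

lemma last_passage_has_density:
  assumes x: "x \<in> S"
  shows "has_density_on (P x) (last_passage f) {0<..} (last_passage_density x)"
proof -
  interpret prob_space "P x" by (rule P_kernel(1)[OF x])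
  let ?D = "last_passage_density x" and ?G = "last_passage f"
  have Gm: "?G \<in> borel_measurable (P x)"
    unfolding measurable_P[OF x] by (rule last_passage_measurable[OF f_cont])
  note [measurable] = Gm
  define w where "w = (\<lambda>t. indicator {0<..} t * ?D t)"
  have si: "set_integrable lborel {0<..} ?D" using last_passage_density_integral(1)[OF x, of 0] by simp
  then have wi: "integrable lborel w" by (simp add: w_def set_integrable_def)
  have w0: "0 \<le> w t" for t using last_passage_density_nonneg[OF x] by (simp add: w_def indicator_def)
  have [measurable]: "w \<in> borel_measurable borel" using borel_measurable_integrable[OF wi] by simp
  \<comment> \<open>\<open>enn2real\<close> sends \<infinity> to 0; removing both of these values of
    the last passage time keeps spurious mass out of 0 and makes the conversion to reals
    injective.\<close>
  define E where "E = {\<omega> \<in> space (P x). 0 < ?G \<omega> \<and> ?G \<omega> < \<infinity>}"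
  have E[measurable]: "E \<in> events" unfolding E_def by measurable
  define M1 where "M1 = density lborel (\<lambda>t. ennreal (w t))"
  define M2 where "M2 = distr (density (P x) (indicator E)) borel (\<lambda>\<omega>. enn2real (?G \<omega>))"
  have M1: "emeasure M1 B = ennreal (LINT t:B|lborel. w t)" if B: "B \<in> sets borel" for B
  proof -
    have "emeasure M1 B = (\<integral>\<^sup>+t. ennreal (indicator B t * w t) \<partial>lborel)"
      using B w0 by (simp add: M1_def emeasure_density ennreal_mult'' ennreal_indicator mult.commute)
    also have "\<dots> = ennreal (\<integral>t. indicator B t * w t \<partial>lborel)"
      using integrable_real_mult_indicator[of B lborel w] B wi w0
      by (intro nn_integral_eq_integral) (auto simp: mult.commute)
    finally show ?thesis by (simp add: set_lebesgue_integral_def)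
  qed
  have M2: "emeasure M2 B = ennreal (prob {\<omega> \<in> E. enn2real (?G \<omega>) \<in> B})" if B: "B \<in> sets borel" for B
  proof -
    have "emeasure M2 B = emeasure (density (P x) (indicator E)) ((\<lambda>\<omega>. enn2real (?G \<omega>)) -` B \<inter> space (P x))"
      using B by (simp add: M2_def emeasure_distr)
    also have "\<dots> = emeasure (P x) (E \<inter> ((\<lambda>\<omega>. enn2real (?G \<omega>)) -` B \<inter> space (P x)))"
      using B by (intro emeasure_restricted) auto
    also have "E \<inter> ((\<lambda>\<omega>. enn2real (?G \<omega>)) -` B \<inter> space (P x)) = {\<omega> \<in> E. enn2real (?G \<omega>) \<in> B}"
      by (auto simp: E_def)
    finally show ?thesis by (simp add: emeasure_eq_measure)
  qed
  have "M1 = M2"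
  proof (rule measure_eqI_lessThan)
    show "sets M1 = sets borel" "sets M2 = sets borel" by (simp_all add: M1_def M2_def)
    show "emeasure M1 {a<..} < \<infinity>" for a by (simp add: M1)
    fix a :: real
    \<comment> \<open>No mass lies on the negative half-line, so a half-line starting at negative a
      is cut off at 0.\<close>
    define b where "b = max a 0"
    have b: "0 \<le> b" by (simp add: b_def)
    have "(LINT t:{a<..}|lborel. w t) = (LINT t:{b<..}|lborel. ?D t)"
      unfolding set_lebesgue_integral_def
      by (rule Bochner_Integration.integral_cong) (auto simp: w_def b_def indicator_def)
    also have "\<dots> = prob {\<omega> \<in> \<Omega>. ?G \<omega> < \<infinity>} - prob {\<omega> \<in> \<Omega>. ?G \<omega> \<le> ennreal b}"
      by (rule last_passage_density_integral(2)[OF x b])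
    also have "\<dots> = prob ({\<omega> \<in> \<Omega>. ?G \<omega> < \<infinity>} - {\<omega> \<in> \<Omega>. ?G \<omega> \<le> ennreal b})"
      by (rule finite_measure_Diff[symmetric])
        (use last_passage_events(1)[of \<infinity>] last_passage_events(2) in \<open>auto simp: P_kernel(2)[OF x] less_top[symmetric] top_unique\<close>)
    also have "{\<omega> \<in> \<Omega>. ?G \<omega> < \<infinity>} - {\<omega> \<in> \<Omega>. ?G \<omega> \<le> ennreal b} = {\<omega> \<in> E. enn2real (?G \<omega>) \<in> {a<..}}"
    proof -
      have "(z < \<infinity> \<and> \<not> z \<le> ennreal b) \<longleftrightarrow> (0 < z \<and> z < \<infinity> \<and> a < enn2real z)" for z
      proof (cases z)
        case (real g)
        then show ?thesis by (auto simp: b_def ennreal_less_iff not_le max_def)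
      qed simp
      then show ?thesis by (auto simp: E_def P_kernel(3)[OF x])
    qed
    finally show "emeasure M1 {a<..} = emeasure M2 {a<..}" by (simp add: M1 M2)
  qed
  have "measure (P x) {\<omega> \<in> space (P x). ?G \<omega> \<in> ennreal ` B} = (LINT t:B|lborel. ?D t)"
    if B: "B \<in> sets borel" "B \<subseteq> {0<..}" for B
  proof -
    have "{\<omega> \<in> space (P x). ?G \<omega> \<in> ennreal ` B} = {\<omega> \<in> E. enn2real (?G \<omega>) \<in> B}"
    proof -
      have "z \<in> ennreal ` B \<longleftrightarrow> 0 < z \<and> z < \<infinity> \<and> enn2real z \<in> B" for z
      proof
        assume "z \<in> ennreal ` B"
        then obtain b where "z = ennreal b" "b \<in> B" "0 < b" using B(2) by auto
        then show "0 < z \<and> z < \<infinity> \<and> enn2real z \<in> B" by simp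
      next
        assume "0 < z \<and> z < \<infinity> \<and> enn2real z \<in> B"
        then show "z \<in> ennreal ` B" by (cases z) auto
      qed
      then show ?thesis by (auto simp: E_def)
    qed
    then have "ennreal (measure (P x) {\<omega> \<in> space (P x). ?G \<omega> \<in> ennreal ` B}) = ennreal (LINT t:B|lborel. w t)"
      using M1[OF B(1)] M2[OF B(1)] \<open>M1 = M2\<close> by simp
    moreover have "0 \<le> (LINT t:B|lborel. w t)"
      unfolding set_lebesgue_integral_def using w0 by (intro integral_nonneg_AE AE_I2) simp
    ultimately have "measure (P x) {\<omega> \<in> space (P x). ?G \<omega> \<in> ennreal ` B} = (LINT t:B|lborel. w t)" by simp
    also have "\<dots> = (LINT t:B|lborel. ?D t)"
      unfolding set_lebesgue_integral_def
      by (rule Bochner_Integration.integral_cong) (use B(2) in \<open>auto simp: w_def indicator_def\<close>)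
    finally show ?thesis .
  qed
  then show ?thesis using Gm si by (simp add: has_density_on_def)
qed

text \<open>As S is open, the section \<open>S \<inter> {..f t}\<close> is near \<open>f t\<close> a
  left half-neighbourhood, so the derivative along it is the left derivative.\<close>

lemma left_deriv_H:
  assumes t: "0 < t"
  shows "left_deriv (H t) (f t) = Hy t (f t)"
proof (rule left_deriv_eqI)
  have S: "f t \<in> S" using f_range t by simp
  have "(t, f t) \<in> below_curve l f" using t S by (simp add: in_below_curve)
  from Hy[OF this] have "(H t has_real_derivative Hy t (f t)) (at (f t) within S \<inter> {..f t})"
    by (rule has_field_derivative_subset) (use t in \<open>auto simp: in_below_curve\<close>)
  moreover have "at (f t) within S \<inter> {..f t} = at_left (f t)"
    by (rule at_within_nhd[of _ S]) (use S in auto)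
  ultimately show "(H t has_real_derivative Hy t (f t)) (at_left (f t))" by simp
qed

end

theorem theorem7:
  fixes l :: ereal
    and s rho f :: "real \<Rightarrow> real"
    and q :: "real \<Rightarrow> real \<Rightarrow> real \<Rightarrow> real"
    and P :: "real \<Rightarrow> (real \<Rightarrow> real) measure"
    and H :: "real \<Rightarrow> real \<Rightarrow> real"
    and x :: real
  assumes diffusion: "linear_diffusion l s rho q P"
    and natural: "l = -\<infinity> \<Longrightarrow> natural_left l s rho"
    and entrance: "l > -\<infinity> \<Longrightarrow> entrance_not_exit_left l s rho"
    and f_range: "\<And>t. t \<ge> 0 \<Longrightarrow> f t \<in> einterval l \<infinity>"
    and f_cont: "continuous_on {0..} f"
    and f_C1: "f C1_differentiable_on {0<..}"
    and f_lifetime: "curve_lifetime l f = \<infinity>"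
    and f_below: "\<And>x. x \<in> einterval l \<infinity> \<Longrightarrow> AE \<omega> in P x. ends_below f \<omega>"
    and H_def: "H = (\<lambda>t y. measure (P y)
      {\<omega> \<in> space (P y). first_passage (\<lambda>u. f (t + u)) \<omega> = \<infinity>})"
    and H_C12: "C12_on (below_curve l f) H"
    and H_flux: "\<And>x t. x \<in> einterval l \<infinity> \<Longrightarrow> t > 0 \<Longrightarrow>
      (((\<lambda>y. 1 / deriv s y * deriv (H t) y * q t x y) \<circ> real_of_ereal) \<longlongrightarrow> 0) (at_right l)"
    and x: "x \<in> einterval l \<infinity>"
  shows "has_density_on (P x) (last_passage f) {0<..}
           (\<lambda>t. - (q t x (f t) / deriv s (f t)) * left_deriv (H t) (f t))"
proof -
  interpret linear_diffusion l s rho q P by (rule diffusion)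
  obtain Ht Hy Hyy where D:
    "\<forall>(t, y)\<in>below_curve l f.
        ((\<lambda>u. H u y) has_real_derivative Ht t y) (at t within {u. (u, y) \<in> below_curve l f}) \<and>
        ((\<lambda>z. H t z) has_real_derivative Hy t y) (at y within {z. (t, z) \<in> below_curve l f}) \<and>
        ((\<lambda>z. Hy t z) has_real_derivative Hyy t y) (at y within {z. (t, z) \<in> below_curve l f})"
    and cont: "continuous_on (below_curve l f) (\<lambda>(t, y). Ht t y)"
      "continuous_on (below_curve l f) (\<lambda>(t, y). Hy t y)"
      "continuous_on (below_curve l f) (\<lambda>(t, y). Hyy t y)"
    using H_C12 unfolding C12_on_def by blast
  interpret curve_passage l s rho q P f H Ht Hy Hyy
  proof
    show "H = (\<lambda>t y. measure (P y) {\<omega> \<in> space (P y). first_passage (\<lambda>u. f (t + u)) \<omega> = \<infinity>})"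
      by (rule H_def)
  qed (use f_range f_cont f_below D cont in auto)
  \<comment> \<open>The two formulas for the density agree for t > 0; at other times the indicator
    of the domain of integration removes the difference.\<close>
  have "- (q t x (f t) / deriv s (f t)) * left_deriv (H t) (f t) = last_passage_density x t" if "0 < t" for t
    by (simp add: last_passage_density_def left_deriv_H[OF that])
  then have eq: "indicator {0<..} t *\<^sub>R (- (q t x (f t) / deriv s (f t)) * left_deriv (H t) (f t)) =
      indicator {0<..} t *\<^sub>R last_passage_density x t" for t
    by (simp add: indicator_def)
  have eqB: "(LINT t:B|lborel. - (q t x (f t) / deriv s (f t)) * left_deriv (H t) (f t)) =
      (LINT t:B|lborel. last_passage_density x t)" if "B \<subseteq> {0<..}" for B
    unfolding set_lebesgue_integral_def
    by (rule Bochner_Integration.integral_cong) (use that left_deriv_H in \<open>auto simp: indicator_def last_passage_density_def\<close>)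
  show ?thesis
    using last_passage_has_density[OF x] eqB unfolding has_density_on_def set_integrable_def eq by simp
qed

end
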